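(* Let $E \subset \mathbb{C}$ be compact with $\mathrm{cap}(E)>0$, where $\mathrm{cap}(E)$ denotes the logarithmic capacity of $E$ and $\mu_E$ its equilibrium measure. Let $d_E(z):=\max_{t\in E}|z-t|$ and $C_E := \int \log d_E(z)\, d\mu_E(z) - \log\mathrm{cap}(E)$. Suppose that $\nu_j$, $j=1,\ldots,m$, are positive compactly supported Borel measures with potentials $p_j(z)=\int\log|z-t|\,d\nu_j(t)$, such that the total mass of $\sum_{j=1}^m \nu_j$ equals $1$. Then \[ \sum_{j=1}^m \sup_E p_j \le C_E(m) + \sup_E \sum_{j=1}^m p_j, \] where \[ C_E(m):=\max_{c_k\in\partial E} \int \log \max_{1 \le k \le m} |z-c_k|\, d\mu_E(z) - \log\mathrm{cap}(E) \] cannot be replaced by a smaller constant for each fixed $m\ge 2$. Furthermore, if $m < \mathrm{card}(\mathfrak{D}_E)$ then $C_E(m) < C_E$, while $C_E(m)=C_E$ for $m \ge \mathrm{card}(\mathfrak{D}_E)$. When $\mathfrak{D}_E$ is infinite, $C_E(m)<C_E$ holds for all $m\in\mathbb{N}$, $m\ge 2$.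
   Context: A closed set $S\subset E$ is called dominant if $d_E(z)=\max_{t\in S}|z-t|$ for all $z\in\mathrm{supp}(\mu_E)$. When $E$ has a finite dominant set, $\mathfrak{D}_E$ denotes a dominant set with the smallest number of points; otherwise $\mathfrak{D}_E$ is taken to be any dominant set (e.g. $\partial E$), with $\mathrm{card}(\mathfrak{D}_E)=\infty$. *)

theory Defs
  imports "HOL-Analysis.Analysis" "HOL-Library.Extended_Nat"
begin

definition prob_measures_on :: "complex set \<Rightarrow> complex measure set" where
  "prob_measures_on E = {\<mu>. emeasure \<mu> UNIV = 1 \<and> sets \<mu> = sets borel \<and> emeasure \<mu> (UNIV - E) = 0}"

text \<open>Logarithmic energy  I(mu) = double integral of log(1/|z-t|), with values in
  (-inf, +inf]; the kernel is split into its negative and positive parts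
  (the singular part is +inf on the diagonal).\<close>
definition log_energy :: "complex measure \<Rightarrow> ereal" where
  "log_energy \<mu> =
     enn2ereal (\<integral>\<^sup>+ z. (\<integral>\<^sup>+ t. (if t = z then \<infinity> else ennreal (max (- ln (cmod (z - t))) 0)) \<partial>\<mu>) \<partial>\<mu>)
   - enn2ereal (\<integral>\<^sup>+ z. (\<integral>\<^sup>+ t. ennreal (max (ln (cmod (z - t))) 0) \<partial>\<mu>) \<partial>\<mu>)"

definition robin_const :: "complex set \<Rightarrow> ereal" where
  "robin_const E = (INF \<mu>\<in>prob_measures_on E. log_energy \<mu>)"

definition log_cap :: "complex set \<Rightarrow> real" where
  "log_cap E = (if robin_const E = \<infinity> then 0 else exp (- real_of_ereal (robin_const E)))"

text \<open>Equilibrium measure: the (unique, when cap E > 0) energy minimiser.\<close>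
definition equilibrium_measure :: "complex set \<Rightarrow> complex measure" where
  "equilibrium_measure E = (SOME \<mu>. \<mu> \<in> prob_measures_on E \<and> log_energy \<mu> = robin_const E)"

definition msupport :: "complex measure \<Rightarrow> complex set" where
  "msupport \<mu> = {z. \<forall>e>0. emeasure \<mu> (ball z e) > 0}"

definition log_potential :: "complex measure \<Rightarrow> complex \<Rightarrow> ereal" where
  "log_potential \<nu> z =
     enn2ereal (\<integral>\<^sup>+ t. ennreal (max (ln (cmod (z - t))) 0) \<partial>\<nu>)
   - enn2ereal (\<integral>\<^sup>+ t. (if t = z then \<infinity> else ennreal (max (- ln (cmod (z - t))) 0)) \<partial>\<nu>)"

definition farthest_dist :: "complex set \<Rightarrow> complex \<Rightarrow> real" where
  "farthest_dist E z = Sup ((\<lambda>t. cmod (z - t)) ` E)"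

definition C_const :: "complex set \<Rightarrow> real" where
  "C_const E = (\<integral>z. ln (farthest_dist E z) \<partial>(equilibrium_measure E)) - ln (log_cap E)"

definition C_const_m :: "complex set \<Rightarrow> nat \<Rightarrow> real" where
  "C_const_m E m =
     Sup {(\<integral>z. ln (Max ((\<lambda>k. cmod (z - c k)) ` {..<m})) \<partial>(equilibrium_measure E)) | c.
            \<forall>k<m. c k \<in> frontier E}
     - ln (log_cap E)"

definition dominant :: "complex set \<Rightarrow> complex set \<Rightarrow> bool" where
  "dominant E S \<longleftrightarrow> closed S \<and> S \<subseteq> E \<and> S \<noteq> {} \<and>
     (\<forall>z\<in>msupport (equilibrium_measure E). farthest_dist E z = Sup ((\<lambda>t. cmod (z - t)) ` S))"

definition dominant_card :: "complex set \<Rightarrow> enat" where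
  "dominant_card E =
     (if \<exists>S. dominant E S \<and> finite S
      then enat (LEAST n. \<exists>S. dominant E S \<and> finite S \<and> card S = n)
      else \<infinity>)"

definition admissible_family :: "nat \<Rightarrow> (nat \<Rightarrow> complex measure) \<Rightarrow> bool" where
  "admissible_family m \<nu> \<longleftrightarrow>
     (\<forall>j<m. sets (\<nu> j) = sets borel \<and> finite_measure (\<nu> j) \<and>
            (\<exists>K. compact K \<and> emeasure (\<nu> j) (UNIV - K) = 0)) \<and>
     (\<Sum>j<m. measure (\<nu> j) UNIV) = 1"

end

theory Submission
  imports Defs "HOL-Probability.Probability" "HOL-Complex_Analysis.Complex_Analysis"
    "HOL-Computational_Algebra.Fundamental_Theorem_Algebra"
begin

text \<open>
  The maximum of each potential over \<open>E\<close> is taken at a frontier point \<open>c\<^sub>j\<close>, so the sum of the maxima is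
  at most the integral of \<open>u(z) = ln max |z - c\<^sub>k|\<close> against the sum \<open>\<nu>\<close> of the measures. The Bernstein-Walsh
  inequality compares the potential of \<open>\<nu>\<close> with that of the equilibrium measure \<open>\<mu>\<close> everywhere in the plane;
  since \<open>u\<close> is nearly an average of kernels \<open>ln |z - a|\<close> over the zeros \<open>a\<close> of \<open>\<Sum> (z - c\<^sub>k)\<^sup>n\<close>, this gives
  \<open>\<integral>u d\<nu> \<le> \<integral>u d\<mu> - ln cap E + sup p\<close>.

  The constant is sharp because \<open>\<mu>\<close>, corrected by a small mass on the capacity-zero set where its potential
  exceeds \<open>ln cap E\<close>, can be cut into the cells in which a given \<open>c\<^sub>k\<close> is farthest. The integral of \<open>u\<close> against
  \<open>\<mu>\<close> reaches that of \<open>ln d_E\<close> exactly when the points \<open>c\<^sub>k\<close> form a dominant set.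

  All potentials are handled through the truncated kernel \<open>ln max(|w|, e)\<close>, which is Lipschitz continuous
  and decreases to \<open>ln |w|\<close>.
\<close>
section \<open>Truncated logarithmic potentials\<close>

text \<open>The bound for the integral of \<open>u\<close> is reciprocity with the Riesz measure of
  \<open>u\<close>: when the points are not all equal, \<open>u\<close> is a continuous subharmonic
  function and the logarithmic potential of a probability measure \<sigma>. With \<open>p\<close>
  the potential of \<open>\<nu>\<close>, exchanging integrals turns \<integral> u d\<nu> into
  \<integral> p d\<sigma>, and Bernstein-Walsh bounds \<open>p\<close> by the potential of
  \<open>\<mu>\<close> plus a constant. The zeros of the power sums stand in for \<sigma>, so no
  Riesz decomposition has to be built. If all points coincide, \<open>u\<close> has a pole and the
  inequality is obtained directly.

  The obstacle is that potentials are only upper semicontinuous and may take the value -\<infinity>.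
  Bernstein-Walsh needs the potential of \<open>\<mu>\<close> to be at least ln cap E in the whole
  plane, whereas variation of the energy gives information only almost everywhere and on the
  support. Sharpness needs the opposite bound at every point of E, and this one can truly fail, for
  instance at an isolated point.\<close>

definition tlog :: "real \<Rightarrow> complex \<Rightarrow> real" where
  "tlog e w = ln (max (cmod w) e)"

definition tpot :: "real \<Rightarrow> complex measure \<Rightarrow> complex \<Rightarrow> real" where
  "tpot e \<nu> z = (\<integral>t. tlog e (z - t) \<partial>\<nu>)"

definition ball_measure :: "real \<Rightarrow> complex measure \<Rightarrow> bool" where
  "ball_measure R \<nu> \<longleftrightarrow> sets \<nu> = sets borel \<and> finite_measure \<nu> \<and> (AE t in \<nu>. cmod t \<le> R)"

lemma ball_measureD:
  assumes "ball_measure R \<nu>"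
  shows "sets \<nu> = sets borel" "finite_measure \<nu>" "AE t in \<nu>. cmod t \<le> R" "space \<nu> = UNIV"
  using assms sets_eq_imp_space_eq[of \<nu> borel] by (auto simp: ball_measure_def)

lemma ball_measure_mono: "ball_measure R \<nu> \<Longrightarrow> R \<le> R' \<Longrightarrow> ball_measure R' \<nu>"
  unfolding ball_measure_def by (auto elim!: AE_mp)

lemma tlog_commute: "tlog e (z - t) = tlog e (t - z)"
  by (simp add: tlog_def norm_minus_commute)

lemma tlog_mono: "0 < e \<Longrightarrow> e \<le> e' \<Longrightarrow> tlog e w \<le> tlog e' w"
  unfolding tlog_def by (intro ln_mono) auto

lemma tlog_ge: "0 < e \<Longrightarrow> ln e \<le> tlog e w"
  unfolding tlog_def by (intro ln_mono) auto

lemma tlog_le: "0 < e \<Longrightarrow> cmod w \<le> D \<Longrightarrow> e \<le> D \<Longrightarrow> tlog e w \<le> ln D"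
  unfolding tlog_def by (intro ln_mono) auto

lemma tlog_eq_ln: "e \<le> cmod w \<Longrightarrow> tlog e w = ln (cmod w)"
  by (simp add: tlog_def max_def)

lemma ln_le_tlog: "0 < e \<Longrightarrow> 0 < cmod w \<Longrightarrow> ln (cmod w) \<le> tlog e w"
  unfolding tlog_def by (intro ln_mono) auto

lemma ln_diff_le_divide:
  fixes x y e :: real
  assumes "0 < e" "e \<le> x" "e \<le> y"
  shows "\<bar>ln x - ln y\<bar> \<le> \<bar>x - y\<bar> / e"
proof -
  have *: "ln b - ln a \<le> \<bar>x - y\<bar> / e" if "e \<le> a" "a \<le> b" "b - a = \<bar>x - y\<bar>" for a b
  proof -
    have "ln b - ln a \<le> (b - a) / a" using that assms by (intro ln_diff_le) auto
    also have "\<dots> \<le> (b - a) / e" using that assms by (intro divide_left_mono) auto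
    finally show ?thesis using that by simp
  qed
  show ?thesis
  proof (cases "x \<le> y")
    case True
    then have "ln x \<le> ln y" using assms by (intro ln_mono) auto
    then show ?thesis using *[of x y] True assms by auto
  next
    case False
    then have "ln y \<le> ln x" using assms by (intro ln_mono) auto
    then show ?thesis using *[of y x] False assms by auto
  qed
qed

lemma tlog_lipschitz:
  assumes "0 < e"
  shows "\<bar>tlog e w - tlog e w'\<bar> \<le> cmod (w - w') / e"
proof -
  have "\<bar>tlog e w - tlog e w'\<bar> \<le> \<bar>max (cmod w) e - max (cmod w') e\<bar> / e"
    unfolding tlog_def using assms by (intro ln_diff_le_divide) auto
  also have "\<bar>max (cmod w) e - max (cmod w') e\<bar> \<le> cmod (w - w')"
    using norm_triangle_ineq2[of w w'] norm_triangle_ineq2[of w' w]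
    by (auto simp: max_def norm_minus_commute)
  finally show ?thesis using assms by (simp add: divide_right_mono)
qed

lemma continuous_on_tlog [continuous_intros]:
  assumes "0 < e" "continuous_on A f"
  shows "continuous_on A (\<lambda>x. tlog e (f x))"
proof -
  have "max (cmod w) e > 0" for w using assms(1) by (auto simp: max_def)
  then show ?thesis unfolding tlog_def using assms
    by (intro continuous_intros) (auto simp: less_imp_neq)
qed

lemma measurable_tlog [measurable]: "tlog e \<in> borel_measurable borel"
  unfolding tlog_def[abs_def] by measurable

lemma tlog_abs_bound:
  assumes "0 < e" "cmod w \<le> D"
  shows "\<bar>tlog e w\<bar> \<le> \<bar>ln e\<bar> + \<bar>ln (max D e)\<bar>"
proof -
  have "tlog e w \<le> ln (max D e)" using assms by (intro tlog_le) auto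
  then show ?thesis using tlog_ge[OF assms(1), of w] by linarith
qed

lemma measurable_ball_measure:
  "ball_measure R \<nu> \<Longrightarrow> f \<in> borel_measurable borel \<Longrightarrow> f \<in> borel_measurable \<nu>"
  by (simp add: ball_measureD(1) cong: measurable_cong_sets)

lemma integrable_ball_measure:
  fixes f :: "complex \<Rightarrow> real"
  assumes "ball_measure R \<nu>" "f \<in> borel_measurable borel" "\<And>t. cmod t \<le> R \<Longrightarrow> \<bar>f t\<bar> \<le> B"
  shows "integrable \<nu> f"
proof -
  interpret finite_measure \<nu> using assms ball_measureD by auto
  have "AE t in \<nu>. norm (f t) \<le> B"
    using ball_measureD(3)[OF assms(1)] assms(3) by (auto elim!: AE_mp)
  then show ?thesis
    using measurable_ball_measure[OF assms(1,2)] by (intro integrable_const_bound)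
qed

lemma integrable_continuous_ball_measure:
  fixes f :: "complex \<Rightarrow> real"
  assumes "ball_measure R \<nu>" "continuous_on UNIV f"
  shows "integrable \<nu> f"
proof -
  have "compact (f ` cball 0 R)"
    using assms(2) by (intro compact_continuous_image) (auto intro: continuous_on_subset)
  then have "bounded (f ` cball 0 R)" by (rule compact_imp_bounded)
  then obtain B where B: "\<And>z. z \<in> cball 0 R \<Longrightarrow> \<bar>f z\<bar> \<le> B"
    unfolding bounded_iff real_norm_def by blast
  show ?thesis
    using B by (intro integrable_ball_measure[OF assms(1), where B = B]
      borel_measurable_continuous_onI[OF assms(2)]) auto
qed

lemma integrable_tlog:
  assumes "ball_measure R \<nu>" "0 < e"
  shows "integrable \<nu> (\<lambda>t. tlog e (z - t))"
  using assms(2) by (intro integrable_continuous_ball_measure[OF assms(1)] continuous_intros)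

lemma tpot_mono:
  assumes "ball_measure R \<nu>" "0 < e" "e \<le> e'"
  shows "tpot e \<nu> z \<le> tpot e' \<nu> z"
  unfolding tpot_def using assms by (intro integral_mono integrable_tlog tlog_mono) auto

lemma tpot_le:
  assumes "ball_measure R \<nu>" "0 < e" "\<And>t. cmod t \<le> R \<Longrightarrow> tlog e (z - t) \<le> B"
  shows "tpot e \<nu> z \<le> B * measure \<nu> UNIV"
proof -
  interpret finite_measure \<nu> using assms ball_measureD by auto
  have "tpot e \<nu> z \<le> (\<integral>t. B \<partial>\<nu>)" unfolding tpot_def
    using ball_measureD(3)[OF assms(1)] assms
    by (intro integral_mono_AE integrable_tlog) (auto elim!: AE_mp)
  then show ?thesis using ball_measureD(4)[OF assms(1)] by (simp add: mult.commute)
qed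

lemma tpot_ge:
  assumes "ball_measure R \<nu>" "0 < e" "\<And>t. cmod t \<le> R \<Longrightarrow> B \<le> tlog e (z - t)"
  shows "B * measure \<nu> UNIV \<le> tpot e \<nu> z"
proof -
  interpret finite_measure \<nu> using assms ball_measureD by auto
  have "(\<integral>t. B \<partial>\<nu>) \<le> tpot e \<nu> z" unfolding tpot_def
    using ball_measureD(3)[OF assms(1)] assms
    by (intro integral_mono_AE integrable_tlog) (auto elim!: AE_mp)
  then show ?thesis using ball_measureD(4)[OF assms(1)] by (simp add: mult.commute)
qed

lemma tpot_lipschitz:
  assumes "ball_measure R \<nu>" "0 < e"
  shows "\<bar>tpot e \<nu> z - tpot e \<nu> z'\<bar> \<le> cmod (z - z') / e * measure \<nu> UNIV"
proof -
  interpret finite_measure \<nu> using assms ball_measureD by auto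
  have "\<bar>tpot e \<nu> z - tpot e \<nu> z'\<bar> = norm (\<integral>t. tlog e (z - t) - tlog e (z' - t) \<partial>\<nu>)"
    unfolding tpot_def using integrable_tlog[OF assms] by simp
  also have "\<dots> \<le> (\<integral>t. norm (tlog e (z - t) - tlog e (z' - t)) \<partial>\<nu>)"
    by (rule integral_norm_bound)
  also have "\<dots> \<le> (\<integral>t. cmod (z - z') / e \<partial>\<nu>)"
  proof (rule integral_mono)
    show "norm (tlog e (z - t) - tlog e (z' - t)) \<le> cmod (z - z') / e" for t
      using tlog_lipschitz[OF assms(2), of "z - t" "z' - t"] by simp
  qed (use integrable_tlog[OF assms] in auto)
  finally show ?thesis using ball_measureD(4)[OF assms(1)] by (simp add: mult.commute)
qed

lemma continuous_on_tpot [continuous_intros]: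
  assumes "ball_measure R \<nu>" "0 < e"
  shows "continuous_on A (tpot e \<nu>)"
proof -
  have "(measure \<nu> UNIV / e)-lipschitz_on A (tpot e \<nu>)"
    using tpot_lipschitz[OF assms] assms(2)
    by (intro lipschitz_onI) (auto simp: dist_norm mult.commute)
  then show ?thesis by (rule lipschitz_on_continuous_on)
qed

lemma measurable_tpot:
  assumes "ball_measure R \<nu>" "0 < e"
  shows "tpot e \<nu> \<in> borel_measurable borel"
  using continuous_on_tpot[OF assms] by (rule borel_measurable_continuous_onI)

lemma integrable_tpot:
  assumes "ball_measure R \<nu>" "0 < e" "ball_measure R' \<sigma>"
  shows "integrable \<sigma> (tpot e \<nu>)"
  using assms by (intro integrable_continuous_ball_measure[OF assms(3)] continuous_on_tpot)

lemma tpot_swap: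
  assumes "ball_measure R \<nu>" "0 < e" "ball_measure R' \<sigma>"
  shows "(\<integral>z. tpot e \<nu> z \<partial>\<sigma>) = (\<integral>z. tpot e \<sigma> z \<partial>\<nu>)"
proof -
  interpret n: finite_measure \<nu> using assms ball_measureD by auto
  interpret l: finite_measure \<sigma> using assms ball_measureD by auto
  interpret pair_sigma_finite \<nu> \<sigma> ..
  interpret P: finite_measure "\<nu> \<Otimes>\<^sub>M \<sigma>"
    by (rule finite_measure_pair_measure) unfold_locales
  note [measurable_cong] = ball_measureD(1)[OF assms(1)] ball_measureD(1)[OF assms(3)]
  have AE: "AE p in \<nu> \<Otimes>\<^sub>M \<sigma>. cmod (fst p) \<le> R \<and> cmod (snd p) \<le> R'"
    using ball_measureD(3)[OF assms(1)] ball_measureD(3)[OF assms(3)]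
    by (intro AE_pair_measure) (auto elim!: AE_mp)
  have int: "integrable (\<nu> \<Otimes>\<^sub>M \<sigma>) (case_prod (\<lambda>t z. tlog e (z - t)))"
  proof (rule P.integrable_const_bound)
    show "AE p in \<nu> \<Otimes>\<^sub>M \<sigma>. norm (case_prod (\<lambda>t z. tlog e (z - t)) p)
        \<le> \<bar>ln e\<bar> + \<bar>ln (max (R + R') e)\<bar>"
      using AE
    proof eventually_elim
      case (elim p)
      have "cmod (snd p - fst p) \<le> R + R'" using norm_triangle_ineq4[of "snd p" "fst p"] elim by linarith
      then show ?case using tlog_abs_bound[OF assms(2)] by (auto simp: case_prod_beta)
    qed
  qed measurable
  have "(\<integral>z. tpot e \<nu> z \<partial>\<sigma>) = (\<integral>t. (\<integral>z. tlog e (z - t) \<partial>\<sigma>) \<partial>\<nu>)"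
    unfolding tpot_def by (rule Fubini_integral[OF int])
  also have "\<dots> = (\<integral>t. tpot e \<sigma> t \<partial>\<nu>)"
    unfolding tpot_def by (simp add: tlog_commute)
  finally show ?thesis .
qed

section \<open>Potentials and energies as limits of truncations\<close>

text \<open>Truncation levels running down to 0. Since \<open>eps 0 = 1\<close>, a bound valid at
  all levels includes the level 1, whose kernel is the positive part of the logarithm.\<close>

definition eps :: "nat \<Rightarrow> real" where "eps n = 1 / (real n + 1)"

lemma eps_pos [simp]: "0 < eps n" and eps_le_1 [simp]: "eps n \<le> 1"
  by (auto simp: eps_def)

lemma eps_antimono: "n \<le> m \<Longrightarrow> eps m \<le> eps n"
  by (auto simp: eps_def frac_le)

lemma eps_less_ex: "0 < e \<Longrightarrow> \<exists>n. eps n < e"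
  using reals_Archimedean[of e] by (auto simp: eps_def inverse_eq_divide add.commute)

lemma tlog_1: "tlog 1 w = max (ln (cmod w)) 0"
proof (cases "cmod w \<ge> 1")
  case True
  then have "0 \<le> ln (cmod w)" by simp
  then show ?thesis using True by (simp add: tlog_def)
next
  case False
  then have "ln (cmod w) \<le> 0" by (cases "w = 0") auto
  then show ?thesis using False by (simp add: tlog_def max_def)
qed

text \<open>The negative part of the logarithm is its positive part minus the logarithm itself;
  replacing the latter by truncations gives an increasing sequence, to which monotone convergence
  applies. On the diagonal its terms are \<open>ln (n + 1)\<close>.\<close>

lemma log_kernel_SUP:
  "(if t = z then \<infinity> else ennreal (max (- ln (cmod (z - t))) 0))
     = (SUP n. ennreal (tlog 1 (z - t) - tlog (eps n) (z - t)))" (is "?l = ?r")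
proof (cases "t = z")
  case True
  have "ennreal (real n) \<le> ?r" for n :: nat
  proof -
    obtain k :: nat where k: "exp (real n) \<le> real k" using real_arch_simple by blast
    have "real n \<le> ln (real k + 1)" using k ln_ge_iff[of "real k + 1" "real n"] by auto
    then have "ennreal (real n) \<le> ennreal (tlog 1 (z - t) - tlog (eps k) (z - t))"
      using True by (intro ennreal_leI) (simp add: tlog_def eps_def ln_div max_def)
    also have "\<dots> \<le> ?r" by (rule SUP_upper) simp
    finally show ?thesis .
  qed
  then have "?r = \<infinity>"
    using ennreal_Ex_less_of_nat[of ?r] by (metis ennreal_of_nat_eq_real_of_nat infinity_ennreal_def
      linorder_not_less top.not_eq_extremum)
  moreover have "?l = \<infinity>" using True by simp
  ultimately show ?thesis by (rule trans[rotated, OF sym])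
next
  case False
  let ?w = "z - t"
  have w: "cmod ?w > 0" using False by simp
  have *: "max (- ln (cmod ?w)) 0 = tlog 1 ?w - ln (cmod ?w)" by (simp add: tlog_1 max_def)
  obtain n where n: "eps n < cmod ?w" using eps_less_ex[OF w] by blast
  show ?thesis
  proof (rule antisym)
    have "?l = ennreal (tlog 1 ?w - tlog (eps n) ?w)"
      using False n * by (simp add: tlog_eq_ln)
    also have "\<dots> \<le> ?r" by (rule SUP_upper) simp
    finally show "?l \<le> ?r" .
    show "?r \<le> ?l"
      using False * ln_le_tlog[OF eps_pos w] by (auto intro!: SUP_least ennreal_leI)
  qed
qed

lemma nn_integral_tlog_1:
  assumes "ball_measure R \<nu>"
  shows "(\<integral>\<^sup>+ t. ennreal (max (ln (cmod (z - t))) 0) \<partial>\<nu>) = ennreal (tpot 1 \<nu> z)"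
  unfolding tlog_1[symmetric] tpot_def
  by (intro nn_integral_eq_integral integrable_tlog[OF assms]) (auto simp: tlog_1)

lemma nn_integral_log_kernel:
  assumes "ball_measure R \<nu>"
  shows "(\<integral>\<^sup>+ t. (if t = z then \<infinity> else ennreal (max (- ln (cmod (z - t))) 0)) \<partial>\<nu>)
      = (SUP n. ennreal (tpot 1 \<nu> z - tpot (eps n) \<nu> z))"
proof -
  note [measurable_cong] = ball_measureD(1)[OF assms]
  have "(\<integral>\<^sup>+ t. (if t = z then \<infinity> else ennreal (max (- ln (cmod (z - t))) 0)) \<partial>\<nu>)
      = (SUP n. \<integral>\<^sup>+ t. ennreal (tlog 1 (z - t) - tlog (eps n) (z - t)) \<partial>\<nu>)"
    unfolding log_kernel_SUP
    by (rule nn_integral_monotone_convergence_SUP)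
       (auto simp: incseq_def le_fun_def intro!: ennreal_leI diff_mono tlog_mono eps_antimono)
  also have "\<dots> = (SUP n. ennreal (tpot 1 \<nu> z - tpot (eps n) \<nu> z))"
  proof (intro SUP_cong refl)
    fix n
    have "(\<integral>\<^sup>+ t. ennreal (tlog 1 (z - t) - tlog (eps n) (z - t)) \<partial>\<nu>)
        = ennreal (\<integral>t. tlog 1 (z - t) - tlog (eps n) (z - t) \<partial>\<nu>)"
      by (intro nn_integral_eq_integral Bochner_Integration.integrable_diff integrable_tlog[OF assms])
         (auto intro!: tlog_mono)
    then show "(\<integral>\<^sup>+ t. ennreal (tlog 1 (z - t) - tlog (eps n) (z - t)) \<partial>\<nu>)
        = ennreal (tpot 1 \<nu> z - tpot (eps n) \<nu> z)"
      unfolding tpot_def using integrable_tlog[OF assms] by simp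
  qed
  finally show ?thesis .
qed

lemma tpot_1_nonneg: "0 \<le> tpot 1 \<nu> z"
  unfolding tpot_def by (auto simp: tlog_1)

text \<open>The right-hand difference is the infimum of the \<open>q n\<close> in disguise.
  Comparing it with a real \<open>x\<close> gives a criterion in real numbers that also covers an
  infinite supremum.\<close>

lemma ereal_diff_SUP_ennreal_ge_iff:
  fixes p x :: real and q :: "nat \<Rightarrow> real"
  assumes "0 \<le> p" "\<And>n. q n \<le> p"
  shows "ereal x \<le> enn2ereal (ennreal p) - enn2ereal (SUP n. ennreal (p - q n)) \<longleftrightarrow> (\<forall>n. x \<le> q n)"
proof
  assume L: "ereal x \<le> enn2ereal (ennreal p) - enn2ereal (SUP n. ennreal (p - q n))"
  show "\<forall>n. x \<le> q n"
  proof
    fix n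
    have "enn2ereal (ennreal (p - q n)) \<le> enn2ereal (SUP n. ennreal (p - q n))"
      by (intro less_eq_ennreal.rep_eq[THEN iffD1] SUP_upper) simp
    then have "ereal x \<le> enn2ereal (ennreal p) - enn2ereal (ennreal (p - q n))"
      using L ereal_minus_mono order_trans by blast
    then show "x \<le> q n" using assms by simp
  qed
next
  assume R: "\<forall>n. x \<le> q n"
  then have "x \<le> p" using assms(2) order_trans by blast
  have "(SUP n. ennreal (p - q n)) \<le> ennreal (p - x)"
    using R by (intro SUP_least ennreal_leI) auto
  then have "enn2ereal (SUP n. ennreal (p - q n)) \<le> enn2ereal (ennreal (p - x))"
    by (simp add: less_eq_ennreal.rep_eq)
  also have "\<dots> = ereal (p - x)" using \<open>x \<le> p\<close> by simp
  finally have "ereal p - ereal (p - x) \<le> ereal p - enn2ereal (SUP n. ennreal (p - q n))"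
    by (intro ereal_minus_mono) auto
  then show "ereal x \<le> enn2ereal (ennreal p) - enn2ereal (SUP n. ennreal (p - q n))"
    using assms(1) by simp
qed

lemma log_potential_ge_iff:
  assumes "ball_measure R \<nu>"
  shows "ereal x \<le> log_potential \<nu> z \<longleftrightarrow> (\<forall>n. x \<le> tpot (eps n) \<nu> z)"
  unfolding log_potential_def nn_integral_tlog_1[OF assms] nn_integral_log_kernel[OF assms]
  by (intro ereal_diff_SUP_ennreal_ge_iff tpot_1_nonneg tpot_mono[OF assms]) auto

lemma log_potential_le:
  assumes "ball_measure R \<nu>"
  shows "log_potential \<nu> z \<le> ereal (tpot (eps n) \<nu> z)"
proof (cases "log_potential \<nu> z")
  case (real r)
  then show ?thesis using log_potential_ge_iff[OF assms, of r z] by simp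
next
  case PInf
  then have "\<forall>k. tpot (eps n) \<nu> z + 1 \<le> tpot (eps k) \<nu> z"
    using log_potential_ge_iff[OF assms, of "tpot (eps n) \<nu> z + 1" z] by simp
  then have "tpot (eps n) \<nu> z + 1 \<le> tpot (eps n) \<nu> z" by blast
  then show ?thesis by simp
qed simp

text \<open>Truncated mutual energy. The sign comes from the energy kernel log(1/|z - t|), while
  potentials carry log |z - t|; lowering the level therefore raises the energy.\<close>

definition tenergy :: "real \<Rightarrow> complex measure \<Rightarrow> complex measure \<Rightarrow> real" where
  "tenergy e \<mu> \<nu> = - (\<integral>z. tpot e \<mu> z \<partial>\<nu>)"

text \<open>Monotone convergence in both variables. It makes a finite upper bound on the energy
  equivalent to one real bound for all truncated energies, and this is the only form in which
  energies are used later.\<close>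

lemma log_energy_le_iff:
  assumes "ball_measure R \<mu>"
  shows "log_energy \<mu> \<le> ereal A \<longleftrightarrow> (\<forall>n. tenergy (eps n) \<mu> \<mu> \<le> A)"
proof -
  note [measurable_cong] = ball_measureD(1)[OF assms]
  note mt = measurable_ball_measure[OF assms measurable_tpot[OF assms]]
  have 1: "(\<integral>\<^sup>+ z. ennreal (tpot 1 \<mu> z) \<partial>\<mu>) = ennreal (\<integral>z. tpot 1 \<mu> z \<partial>\<mu>)"
    by (intro nn_integral_eq_integral integrable_tpot[OF assms _ assms]) (auto simp: tpot_1_nonneg)
  have "(\<integral>\<^sup>+ z. (SUP n. ennreal (tpot 1 \<mu> z - tpot (eps n) \<mu> z)) \<partial>\<mu>)
      = (SUP n. \<integral>\<^sup>+ z. ennreal (tpot 1 \<mu> z - tpot (eps n) \<mu> z) \<partial>\<mu>)"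
    using mt by (intro nn_integral_monotone_convergence_SUP)
       (auto simp: incseq_def le_fun_def intro!: ennreal_leI diff_mono tpot_mono[OF assms] eps_antimono)
  also have "\<dots> = (SUP n. ennreal ((\<integral>z. tpot 1 \<mu> z \<partial>\<mu>) - (\<integral>z. tpot (eps n) \<mu> z \<partial>\<mu>)))"
  proof (intro SUP_cong refl)
    fix n
    have "(\<integral>\<^sup>+ z. ennreal (tpot 1 \<mu> z - tpot (eps n) \<mu> z) \<partial>\<mu>)
        = ennreal (\<integral>z. tpot 1 \<mu> z - tpot (eps n) \<mu> z \<partial>\<mu>)"
      by (intro nn_integral_eq_integral Bochner_Integration.integrable_diff integrable_tpot[OF assms _ assms])
         (auto intro!: tpot_mono[OF assms])
    then show "(\<integral>\<^sup>+ z. ennreal (tpot 1 \<mu> z - tpot (eps n) \<mu> z) \<partial>\<mu>)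
        = ennreal ((\<integral>z. tpot 1 \<mu> z \<partial>\<mu>) - (\<integral>z. tpot (eps n) \<mu> z \<partial>\<mu>))"
      using integrable_tpot[OF assms _ assms] by simp
  qed
  finally have 2: "(\<integral>\<^sup>+ z. (SUP n. ennreal (tpot 1 \<mu> z - tpot (eps n) \<mu> z)) \<partial>\<mu>)
      = (SUP n. ennreal ((\<integral>z. tpot 1 \<mu> z \<partial>\<mu>) - (\<integral>z. tpot (eps n) \<mu> z \<partial>\<mu>)))" .
  let ?p = "\<integral>z. tpot 1 \<mu> z \<partial>\<mu>" and ?q = "\<lambda>n. \<integral>z. tpot (eps n) \<mu> z \<partial>\<mu>"
  let ?N = "enn2ereal (SUP n. ennreal (?p - ?q n))"
  have le: "log_energy \<mu> = ?N - enn2ereal (ennreal ?p)"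
    unfolding log_energy_def nn_integral_tlog_1[OF assms] nn_integral_log_kernel[OF assms] 1 2 ..
  have p: "0 \<le> ?p" by (intro integral_nonneg_AE) (auto simp: tpot_1_nonneg)
  have aux: "X - ereal p \<le> ereal A \<longleftrightarrow> ereal (- A) \<le> ereal p - X" for X p
    by (cases X) auto
  have "log_energy \<mu> \<le> ereal A \<longleftrightarrow> ereal (- A) \<le> enn2ereal (ennreal ?p) - ?N"
    unfolding le using p aux[of ?N ?p] by simp
  also have "\<dots> \<longleftrightarrow> (\<forall>n. - A \<le> ?q n)"
    by (intro ereal_diff_SUP_ennreal_ge_iff p integral_mono integrable_tpot[OF assms _ assms] tpot_mono[OF assms]) auto
  finally show ?thesis unfolding tenergy_def by (auto simp: minus_le_iff)
qed

lemma tenergy_antimono: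
  assumes "ball_measure R \<mu>" "ball_measure R' \<nu>" "0 < e" "e \<le> e'"
  shows "tenergy e' \<mu> \<nu> \<le> tenergy e \<mu> \<nu>"
  unfolding tenergy_def using assms
  by (auto intro!: integral_mono integrable_tpot tpot_mono[OF assms(1)])

lemma tenergy_commute:
  assumes "ball_measure R \<mu>" "ball_measure R' \<nu>" "0 < e"
  shows "tenergy e \<mu> \<nu> = tenergy e \<nu> \<mu>"
  unfolding tenergy_def using tpot_swap assms by metis

lemma prob_measures_onD:
  assumes "\<mu> \<in> prob_measures_on E"
  shows "prob_space \<mu>" "sets \<mu> = sets borel" "space \<mu> = UNIV" "measure \<mu> UNIV = 1"
proof -
  show s: "sets \<mu> = sets borel" and sp: "space \<mu> = UNIV"
    using assms sets_eq_imp_space_eq[of \<mu> borel] by (auto simp: prob_measures_on_def)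
  show "prob_space \<mu>" using assms sp by (intro prob_spaceI) (auto simp: prob_measures_on_def)
  show "measure \<mu> UNIV = 1" using assms by (auto simp: prob_measures_on_def measure_def)
qed

lemma prob_measures_on_AE:
  assumes "\<mu> \<in> prob_measures_on E" "closed E"
  shows "AE t in \<mu>. t \<in> E"
proof -
  have "UNIV - E \<in> null_sets \<mu>"
    using assms prob_measures_onD(2)[OF assms(1)] by (auto simp: prob_measures_on_def null_sets_def)
  then show ?thesis by (rule AE_I'[of "UNIV - E"]) auto
qed

lemma prob_measures_onI:
  assumes "prob_space \<mu>" "sets \<mu> = sets borel" "AE t in \<mu>. t \<in> E" "closed E"
  shows "\<mu> \<in> prob_measures_on E"
proof -
  have sp: "space \<mu> = UNIV" using assms(2) sets_eq_imp_space_eq[of \<mu> borel] by simp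
  have "emeasure \<mu> (UNIV - E) = 0"
    using assms sp by (subst AE_iff_measurable[symmetric, where P = "\<lambda>t. t \<in> E"]) auto
  then show ?thesis using assms sp prob_space.emeasure_space_1[of \<mu>] by (auto simp: prob_measures_on_def)
qed

lemma prob_measures_on_ball_measure:
  assumes "\<mu> \<in> prob_measures_on E" "closed E" "E \<subseteq> cball 0 R"
  shows "ball_measure R \<mu>"
proof -
  have "AE t in \<mu>. cmod t \<le> R"
    using prob_measures_on_AE[OF assms(1,2)] by eventually_elim (use assms(3) in auto)
  then show ?thesis
    using prob_measures_onD[OF assms(1)] by (auto simp: ball_measure_def prob_space_def)
qed

section \<open>Weak compactness of probability measures on a compact plane set\<close>

text \<open>At the first index \<open>k\<close> where the digits differ, the terms differ by
  \<open>(1/3) ^ k\<close>, while all later digits together contribute at most half of that. Digits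
  0 and 1 in base 3 leave this gap; in base 2 it would close.\<close>

lemma ternary_code_separates:
  fixes a b :: "nat \<Rightarrow> real"
  assumes a: "\<And>n. a n \<in> {0, 1}" and b: "\<And>n. b n \<in> {0, 1}"
    and close: "\<bar>(\<Sum>n. a n * (1/3) ^ n) - (\<Sum>n. b n * (1/3) ^ n)\<bar> < (1/3) ^ N / 2"
    and "n \<le> N"
  shows "a n = b n"
proof (rule ccontr)
  assume "a n \<noteq> b n"
  define k where "k = (LEAST n. a n \<noteq> b n)"
  have k: "a k \<noteq> b k" unfolding k_def by (rule LeastI) fact
  have kn: "k \<le> n" unfolding k_def by (rule Least_le) fact
  have lt: "a i = b i" if "i < k" for i using that not_less_Least unfolding k_def by blast
  have geo: "summable (\<lambda>n. (1/3::real) ^ n)" by (rule summable_geometric) simp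
  have sa: "summable (\<lambda>n. a n * (1/3) ^ n)"
  proof (rule summable_comparison_test'[OF geo, of 0])
    show "norm (a n * (1/3) ^ n) \<le> (1/3) ^ n" for n using a[of n] by auto
  qed
  have sb: "summable (\<lambda>n. b n * (1/3) ^ n)"
  proof (rule summable_comparison_test'[OF geo, of 0])
    show "norm (b n * (1/3) ^ n) \<le> (1/3) ^ n" for n using b[of n] by auto
  qed
  define d where "d = (\<lambda>n. (a n - b n) * (1/3) ^ n)"
  have sd: "summable d" and d: "suminf d = (\<Sum>n. a n * (1/3) ^ n) - (\<Sum>n. b n * (1/3) ^ n)"
    using summable_diff[OF sa sb] suminf_diff[OF sa sb] by (auto simp: d_def left_diff_distrib)
  have ab: "\<bar>a i - b i\<bar> \<le> 1" for i using a[of i] b[of i] by auto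
  have nd: "norm (d i) \<le> (1/3) ^ i" for i
    using ab[of i] by (auto simp: d_def abs_mult mult_left_le_one_le)
  have "suminf d = (\<Sum>i. d (i + Suc k)) + sum d {..<Suc k}"
    by (rule suminf_split_initial_segment[OF sd])
  also have "sum d {..<Suc k} = d k" using lt by (simp add: d_def)
  finally have eq: "d k = suminf d - (\<Sum>i. d (i + Suc k))" by simp
  have "norm (\<Sum>i. d (i + Suc k)) \<le> (\<Sum>i. (1/3) ^ Suc k * (1/3) ^ i)"
  proof (intro norm_suminf_le summable_mult geo)
    show "norm (d (i + Suc k)) \<le> (1/3) ^ Suc k * (1/3) ^ i" for i
      using nd[of "i + Suc k"] by (simp add: power_add mult.commute)
  qed
  also have "\<dots> = (1/3) ^ Suc k * (3/2)"
    by (subst suminf_mult[OF geo]) (simp add: suminf_geometric)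
  finally have tail: "\<bar>\<Sum>i. d (i + Suc k)\<bar> \<le> (1/3) ^ k / 2" by simp
  have "\<bar>a k - b k\<bar> = 1" using k a[of k] b[of k] by auto
  then have "\<bar>d k\<bar> = (1/3) ^ k" by (simp add: d_def abs_mult)
  then have "(1/3) ^ k / 2 \<le> \<bar>suminf d\<bar>" using eq tail by linarith
  moreover have "(1/3) ^ N \<le> (1/3::real) ^ k" using kn \<open>n \<le> N\<close> by (intro power_decreasing) auto
  ultimately show False using close d by simp
qed

text \<open>The code of a point records in ternary digits which sets of a countable base contain it; on a
  compact set the decoding is uniformly continuous, so Helly's theorem on the line becomes available.\<close>

lemma compact_real_code:
  fixes E :: "complex set"
  assumes "compact E"
  obtains s :: "complex \<Rightarrow> real" and g :: "real \<Rightarrow> complex"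
  where "s \<in> borel_measurable borel" "\<And>z. 0 \<le> s z" "\<And>z. s z \<le> 2"
    "continuous_on UNIV g" "\<And>z. z \<in> E \<Longrightarrow> g (s z) = z"
proof -
  obtain \<B> :: "complex set set" where \<B>: "countable \<B>" "topological_basis \<B>"
    using ex_countable_basis by blast
  have ne: "\<B> \<noteq> {}" using \<B>(2) topological_basisE[OF \<B>(2) open_UNIV, of 0] by auto
  define B where "B = from_nat_into \<B>"
  have rB: "range B = \<B>" unfolding B_def using \<B>(1) ne by (rule range_from_nat_into[rotated])
  have oB: "open (B n)" for n using rB \<B>(2) topological_basis_open by blast
  have basis: "\<exists>n. z \<in> B n \<and> B n \<subseteq> U" if "open U" "z \<in> U" for U z
    using topological_basisE[OF \<B>(2) that] rB by (metis rangeE)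
  have [measurable]: "B n \<in> sets borel" for n using oB by auto
  define s where "s z = (\<Sum>n. indicator (B n) z * (1/3) ^ n :: real)" for z
  have geo: "summable (\<lambda>n. (1/3::real) ^ n)" by (rule summable_geometric) simp
  have summ: "summable (\<lambda>n. indicator (B n) z * (1/3) ^ n :: real)" for z
    by (rule summable_comparison_test'[OF geo, of 0]) (auto simp: indicator_def)
  have s_meas: "s \<in> borel_measurable borel" unfolding s_def by measurable
  have s0: "0 \<le> s z" for z unfolding s_def by (intro suminf_nonneg summ) auto
  have s2: "s z \<le> 2" for z
  proof -
    have "s z \<le> (\<Sum>n. (1/3) ^ n)" unfolding s_def
      by (intro suminf_le summ geo) (auto simp: indicator_def)
    also have "\<dots> = 3/2" by (simp add: suminf_geometric)
    finally show ?thesis by simp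
  qed
  have agree: "z \<in> B n \<longleftrightarrow> z' \<in> B n" if "\<bar>s z - s z'\<bar> < (1/3) ^ N / 2" "n \<le> N" for z z' n N
  proof -
    have "indicator (B n) z = (indicator (B n) z' :: real)"
      using that unfolding s_def
      by (intro ternary_code_separates[of "\<lambda>n. indicator (B n) z" "\<lambda>n. indicator (B n) z'" N])
         (auto simp: indicator_def)
    then show ?thesis by (auto simp: indicator_def split: if_splits)
  qed
  have unif: "\<exists>d>0. \<forall>z\<in>E. \<forall>z'\<in>E. \<bar>s z - s z'\<bar> < d \<longrightarrow> dist z z' < e" if "e > 0" for e
  proof -
    \<comment> \<open>Finitely many base sets of small diameter cover \<open>E\<close>. Codes that
      agree up to the largest of their indices put both points into a common one.\<close>
    define I where "I = {n. \<exists>x. B n \<subseteq> ball x (e/2)}"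
    have "E \<subseteq> (\<Union>n\<in>I. B n)"
    proof
      fix z assume "z \<in> E"
      obtain n where "z \<in> B n" "B n \<subseteq> ball z (e/2)" using basis[of "ball z (e/2)" z] \<open>e > 0\<close> by auto
      then show "z \<in> (\<Union>n\<in>I. B n)" by (auto simp: I_def)
    qed
    then obtain J where J: "J \<subseteq> I" "finite J" "E \<subseteq> (\<Union>n\<in>J. B n)"
      using compactE_image[OF assms, of I B] oB by blast
    define N where "N = Max (insert 0 J)"
    have "dist z z' < e" if z: "z \<in> E" "z' \<in> E" "\<bar>s z - s z'\<bar> < (1/3) ^ N / 2" for z z'
    proof -
      have "z \<in> (\<Union>n\<in>J. B n)" using J(3) z(1) by (rule subsetD)
      then obtain n where n: "n \<in> J" "z \<in> B n" by (rule UN_E)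
      have "n \<le> N" using n J(2) by (simp add: N_def)
      then have "z' \<in> B n" using agree z(3) n by blast
      obtain x where "B n \<subseteq> ball x (e/2)" using n J(1) by (auto simp: I_def)
      then have "dist x z < e/2" "dist x z' < e/2" using n \<open>z' \<in> B n\<close> by auto
      then show ?thesis using dist_triangle_half_r by blast
    qed
    then show ?thesis by (intro exI[of _ "(1/3) ^ N / 2"]) auto
  qed
  have inj: "inj_on s E"
  proof (rule inj_onI)
    fix z z' assume z: "z \<in> E" "z' \<in> E" "s z = s z'"
    have "dist z z' < e" if "e > 0" for e using unif[OF that] z by auto
    then show "z = z'" using zero_less_dist_iff by blast
  qed
  define h where "h = inv_into E s"
  have h: "h (s z) = z" if "z \<in> E" for z unfolding h_def using inj that by simp
  have "uniformly_continuous_on (s ` E) h"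
    unfolding uniformly_continuous_on_def
  proof (intro allI impI)
    fix e :: real assume "e > 0"
    from unif[OF this] obtain d where d: "d > 0"
      "\<forall>z\<in>E. \<forall>z'\<in>E. \<bar>s z - s z'\<bar> < d \<longrightarrow> dist z z' < e" by blast
    then show "\<exists>d>0. \<forall>x\<in>s ` E. \<forall>x'\<in>s ` E. dist x' x < d \<longrightarrow> dist (h x') (h x) < e"
      by (intro exI[of _ d]) (auto simp: h dist_real_def)
  qed
  then obtain g0 where g0: "uniformly_continuous_on (closure (s ` E)) g0"
      "\<And>x. x \<in> s ` E \<Longrightarrow> h x = g0 x"
    by (rule uniformly_continuous_on_extension_on_closure) blast
  obtain g where g: "continuous_on UNIV g" "\<And>x. x \<in> closure (s ` E) \<Longrightarrow> g x = g0 x"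
    using Tietze_unbounded[OF uniformly_continuous_imp_continuous[OF g0(1)], of UNIV] by auto
  have "g (s z) = z" if "z \<in> E" for z
    using that g(2)[of "s z"] g0(2)[of "s z"] h closure_subset[of "s ` E"] by force
  with s_meas s0 s2 g(1) show ?thesis by (rule that)
qed

text \<open>The measures are pushed to the line by the code \<open>s\<close>, Helly's selection
  theorem is applied there, and the limit is brought back by \<open>g\<close>. As
  \<open>g (s z) = z\<close> on \<open>E\<close>, integrals of \<open>f\<close> become integrals of
  the continuous \<open>f \<circ> g\<close>, so it does not matter that \<open>s\<close> is merely
  measurable.\<close>

lemma weak_compact_prob_measures_on:
  assumes "compact E" "\<And>n. \<mu> n \<in> prob_measures_on E"
  shows "\<exists>r \<mu>'. strict_mono (r :: nat \<Rightarrow> nat) \<and> \<mu>' \<in> prob_measures_on E \<and>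
    (\<forall>f :: complex \<Rightarrow> real. continuous_on UNIV f \<longrightarrow> bounded (range f) \<longrightarrow>
      (\<lambda>n. \<integral>z. f z \<partial>\<mu> (r n)) \<longlonglongrightarrow> (\<integral>z. f z \<partial>\<mu>'))"
proof -
  obtain s :: "complex \<Rightarrow> real" and g :: "real \<Rightarrow> complex" where
    s[measurable]: "s \<in> borel_measurable borel" and s0: "\<And>z. 0 \<le> s z" and s2: "\<And>z. s z \<le> 2"
    and g: "continuous_on UNIV g" and gs: "\<And>z. z \<in> E \<Longrightarrow> g (s z) = z"
    using compact_real_code[OF assms(1)] by blast
  have [measurable]: "g \<in> borel_measurable borel" using g by (rule borel_measurable_continuous_onI)
  note [measurable_cong] = prob_measures_onD(2)[OF assms(2)]
  define \<tau> where "\<tau> n = distr (\<mu> n) borel s" for n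
  have rd: "real_distribution (\<tau> n)" for n
    unfolding \<tau>_def real_distribution_def real_distribution_axioms_def
    using prob_measures_onD[OF assms(2)] by (auto intro!: prob_space.prob_space_distr)
  have "measure (\<tau> n) {-1<..3} = 1" for n
  proof -
    interpret prob_space "\<mu> n" using prob_measures_onD[OF assms(2)] by blast
    have "-1 < s z" "s z \<le> 3" for z using s0[of z] s2[of z] by linarith+
    then have "s -` {-1<..3} = UNIV" by auto
    then show ?thesis unfolding \<tau>_def using prob_measures_onD[OF assms(2)]
      by (subst measure_distr) auto
  qed
  then have "(-1::real) < 3 \<and> (\<forall>n. measure (\<tau> n) {-1<..3} > 1 - \<epsilon>)" if "\<epsilon> > 0" for \<epsilon> :: real
    using that by simp
  then have "tight \<tau>" unfolding tight_def using rd by blast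
  then obtain r M where r: "strict_mono (r :: nat \<Rightarrow> nat)" and M: "real_distribution M"
      and conv: "weak_conv_m (\<tau> \<circ> id \<circ> r) M"
    using tight_imp_convergent_subsubsequence[of \<tau> id] by (auto simp: strict_mono_def)
  interpret M: real_distribution M by fact
  define \<mu>' where "\<mu>' = distr M borel g"
  have lim: "(\<lambda>n. \<integral>z. f z \<partial>\<mu> (r n)) \<longlonglongrightarrow> (\<integral>z. f z \<partial>\<mu>')"
    if f: "continuous_on UNIV f" "bounded (range f)" for f :: "complex \<Rightarrow> real"
  proof -
    have [measurable]: "f \<in> borel_measurable borel" using f(1) by (rule borel_measurable_continuous_onI)
    obtain B where B: "\<And>x. \<bar>f x\<bar> \<le> B" using f(2) by (auto simp: bounded_iff)
    have "isCont (\<lambda>x. f (g x)) x" for x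
      using continuous_on_compose2[OF f(1) g] by (simp add: continuous_on_eq_continuous_at)
    then have "(\<lambda>n. \<integral>x. f (g x) \<partial>((\<tau> \<circ> id \<circ> r) n)) \<longlonglongrightarrow> (\<integral>x. f (g x) \<partial>M)"
      using conv rd M B
      by (intro weak_conv_imp_integral_bdd_continuous_conv[where B = B]) (auto simp: o_def)
    moreover have "(\<integral>x. f (g x) \<partial>((\<tau> \<circ> id \<circ> r) n)) = (\<integral>z. f z \<partial>\<mu> (r n))" for n
    proof -
      have "(\<integral>x. f (g x) \<partial>((\<tau> \<circ> id \<circ> r) n)) = (\<integral>z. f (g (s z)) \<partial>\<mu> (r n))"
        unfolding \<tau>_def o_def id_def by (subst integral_distr) auto
      also have "\<dots> = (\<integral>z. f z \<partial>\<mu> (r n))"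
      proof (rule integral_cong_AE)
        show "AE z in \<mu> (r n). f (g (s z)) = f z"
          using prob_measures_on_AE[OF assms(2)[of "r n"] compact_imp_closed[OF assms(1)]]
          by eventually_elim (simp add: gs)
      qed measurable
      finally show ?thesis .
    qed
    moreover have "(\<integral>x. f (g x) \<partial>M) = (\<integral>z. f z \<partial>\<mu>')"
      unfolding \<mu>'_def by (subst integral_distr) auto
    ultimately show ?thesis by simp
  qed
  have "\<mu>' \<in> prob_measures_on E"
  proof (rule prob_measures_onI)
    show ps: "prob_space \<mu>'" unfolding \<mu>'_def by (intro M.prob_space_distr) simp
    show sets: "sets \<mu>' = sets borel" by (simp add: \<mu>'_def)
    note [measurable_cong] = sets
    interpret \<mu>': prob_space \<mu>' by fact
    show "closed E" using assms(1) compact_imp_closed by blast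
    interpret \<mu>0: prob_space "\<mu> 0" using prob_measures_onD[OF assms(2)] by blast
    have "E \<noteq> {}"
      using assms(2)[of 0] by (auto simp: prob_measures_on_def)
    \<comment> \<open>A bounded continuous function whose zero set is exactly \<open>E\<close>: its
      integrals vanish along the sequence, hence in the limit, and so the limit lives on
      \<open>E\<close>.\<close>
    define f where "f z = min 1 (infdist z E)" for z
    have fc: "continuous_on UNIV f" unfolding f_def by (intro continuous_intros)
    have fb: "bounded (range f)"
      by (rule boundedI[of _ 1]) (auto simp: f_def infdist_nonneg)
    have [measurable]: "f \<in> borel_measurable borel" using fc by (rule borel_measurable_continuous_onI)
    have "(\<integral>z. f z \<partial>\<mu> (r n)) = (\<integral>z. 0 \<partial>\<mu> (r n))" for n
    proof (rule integral_cong_AE)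
      show "AE z in \<mu> (r n). f z = 0"
        using prob_measures_on_AE[OF assms(2)[of "r n"] \<open>closed E\<close>]
        by eventually_elim (simp add: f_def)
    qed measurable
    then have "(\<integral>z. f z \<partial>\<mu>') = 0" using lim[OF fc fb] by (simp add: LIMSEQ_const_iff)
    moreover have "integrable \<mu>' f"
      by (rule \<mu>'.integrable_const_bound[of _ 1]) (auto simp: f_def infdist_nonneg)
    ultimately have "AE z in \<mu>'. f z = 0"
      by (subst (asm) integral_nonneg_eq_0_iff_AE) (auto simp: f_def infdist_nonneg)
    then show "AE z in \<mu>'. z \<in> E"
    proof eventually_elim
      case (elim z)
      then have "infdist z E = 0" by (auto simp: f_def min_def split: if_splits)
      then show ?case using in_closed_iff_infdist_zero[OF \<open>closed E\<close> \<open>E \<noteq> {}\<close>] by simp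
    qed
  qed
  with r lim show ?thesis by blast
qed

text \<open>Convergence on a finite net of \<open>E\<close> controls all other points through the
  common Lipschitz constant, which the limit inherits; mesh \<open>e / (4 * C)\<close> leaves three
  errors of at most \<open>e / 4\<close>.\<close>

lemma lipschitz_pointwise_imp_uniform:
  fixes h :: "nat \<Rightarrow> complex \<Rightarrow> real"
  assumes "compact E" "0 < C"
    and lip: "\<And>n z z'. \<bar>h n z - h n z'\<bar> \<le> C * dist z z'"
    and lim: "\<And>z. (\<lambda>n. h n z) \<longlonglongrightarrow> h' z"
    and "0 < e"
  shows "\<forall>\<^sub>F n in sequentially. \<forall>z\<in>E. \<bar>h n z - h' z\<bar> < e"
proof -
  have lip': "\<bar>h' z - h' z'\<bar> \<le> C * dist z z'" for z z'
    by (rule tendsto_upperbound[OF tendsto_rabs[OF tendsto_diff[OF lim lim]]])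
       (intro always_eventually allI lip, simp)
  define d where "d = e / (4 * C)"
  have d: "d > 0" "C * d = e/4" using assms by (auto simp: d_def)
  have "\<forall>e>0. \<exists>k. finite k \<and> E \<subseteq> (\<Union>x\<in>k. ball x e)"
    using assms(1) unfolding compact_eq_totally_bounded by (rule conjunct2)
  then obtain F where F: "finite F" "E \<subseteq> (\<Union>x\<in>F. ball x d)"
    using d(1) by (elim allE[of _ d]) auto
  have "\<forall>\<^sub>F n in sequentially. \<forall>x\<in>F. \<bar>h n x - h' x\<bar> < e/4"
    using F(1)
  proof (rule eventually_ball_finite, intro ballI)
    fix x show "\<forall>\<^sub>F n in sequentially. \<bar>h n x - h' x\<bar> < e/4"
      using tendstoD[OF lim, of "e/4" x] \<open>0 < e\<close> by (simp add: dist_real_def)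
  qed
  then show ?thesis
  proof eventually_elim
    case (elim n)
    show ?case
    proof
      fix z assume "z \<in> E"
      then obtain x where x: "x \<in> F" "dist x z < d" using F by auto
      then have "C * dist z x \<le> e/4" using d assms(2) by (simp add: dist_commute flip: d(2))
      then show "\<bar>h n z - h' z\<bar> < e"
        using bspec[OF elim x(1)] lip[of n z x] lip'[of z x] by linarith
    qed
  qed
qed

text \<open>At a fixed level \<open>e\<close> the potentials converge uniformly on \<open>E\<close>,
  so the truncated energy is continuous under weak convergence. The level \<open>eps n\<close> in
  the hypothesis moves with the measure; once it is below \<open>e\<close>, its energy dominates the
  one at level \<open>e\<close>.\<close>

lemma energy_lower_semicontinuous:
  assumes "compact E" "\<And>n. \<mu> n \<in> prob_measures_on E"
    and en: "\<And>n. tenergy (eps n) (\<mu> n) (\<mu> n) \<le> A n" and A: "A \<longlonglongrightarrow> A'"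
  obtains \<mu>' where "\<mu>' \<in> prob_measures_on E" "\<And>n. tenergy (eps n) \<mu>' \<mu>' \<le> A'"
proof -
  obtain R where R: "E \<subseteq> cball 0 R"
    using compact_imp_bounded[OF assms(1)] unfolding bounded_iff subset_iff mem_cball_0 by blast
  have cl: "closed E" using assms(1) compact_imp_closed by blast
  have bm: "ball_measure R \<nu>" if "\<nu> \<in> prob_measures_on E" for \<nu>
    using prob_measures_on_ball_measure[OF that cl R] .
  obtain r \<mu>' where r: "strict_mono (r :: nat \<Rightarrow> nat)" and \<mu>': "\<mu>' \<in> prob_measures_on E"
    and lim: "\<And>f :: complex \<Rightarrow> real. continuous_on UNIV f \<Longrightarrow> bounded (range f) \<Longrightarrow>
      (\<lambda>n. \<integral>z. f z \<partial>\<mu> (r n)) \<longlonglongrightarrow> (\<integral>z. f z \<partial>\<mu>')"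
    using weak_compact_prob_measures_on[where \<mu> = \<mu>, OF assms(1,2)] by blast
  have lim': "(\<lambda>n. \<integral>z. f z \<partial>\<mu> (r n)) \<longlonglongrightarrow> (\<integral>z. f z \<partial>\<mu>')"
    if f: "continuous_on UNIV f" for f :: "complex \<Rightarrow> real"
  proof -
    have "compact (f ` E)" using f assms(1) by (intro compact_continuous_image) (auto intro: continuous_on_subset)
    then have "bounded (f ` E)" by (rule compact_imp_bounded)
    then obtain B where B: "\<And>z. z \<in> E \<Longrightarrow> \<bar>f z\<bar> \<le> B"
      unfolding bounded_iff real_norm_def by blast
    \<comment> \<open>Weak convergence is available for bounded functions only; clamping
      \<open>f\<close> outside \<open>E\<close> does not change the integrals.\<close>
    define f' where "f' z = max (-B) (min B (f z))" for z
    have c: "continuous_on UNIV f'" unfolding f'_def using f by (intro continuous_intros)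
    have b: "bounded (range f')"
      by (rule boundedI[of _ "\<bar>B\<bar>"]) (auto simp: f'_def)
    have eq: "(\<integral>z. f z \<partial>\<nu>) = (\<integral>z. f' z \<partial>\<nu>)" if "\<nu> \<in> prob_measures_on E" for \<nu>
    proof (rule integral_cong_AE)
      show "f \<in> borel_measurable \<nu>" "f' \<in> borel_measurable \<nu>"
        using measurable_ball_measure[OF bm[OF that] borel_measurable_continuous_onI] f c by simp_all
      show "AE z in \<nu>. f z = f' z"
        using prob_measures_on_AE[OF that cl]
      proof eventually_elim
        case (elim z) then show ?case using B[of z] by (auto simp: f'_def)
      qed
    qed
    show ?thesis using lim[OF c b] eq \<mu>' assms(2) by simp
  qed
  have key: "tenergy e \<mu>' \<mu>' \<le> A'" if e: "0 < e" for e
  proof -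
    have uc: "\<forall>\<^sub>F n in sequentially. \<forall>z\<in>E. \<bar>tpot e (\<mu> (r n)) z - tpot e \<mu>' z\<bar> < d" if "0 < d" for d
    proof (rule lipschitz_pointwise_imp_uniform[OF assms(1), where C = "1/e"])
      show "\<bar>tpot e (\<mu> (r n)) z - tpot e (\<mu> (r n)) z'\<bar> \<le> 1 / e * dist z z'" for n z z'
        using tpot_lipschitz[OF bm[OF assms(2)] e, of "r n" z z'] prob_measures_onD(4)[OF assms(2)]
        by (simp add: dist_norm)
      show "(\<lambda>n. tpot e (\<mu> (r n)) z) \<longlonglongrightarrow> tpot e \<mu>' z" for z
        unfolding tpot_def using e by (intro lim' continuous_intros)
    qed (use e that in auto)
    have l2: "(\<lambda>n. \<integral>z. tpot e \<mu>' z \<partial>\<mu> (r n)) \<longlonglongrightarrow> (\<integral>z. tpot e \<mu>' z \<partial>\<mu>')"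
      using continuous_on_tpot[OF bm[OF \<mu>'] e] by (rule lim')
    have l3: "(\<lambda>n. A (r n)) \<longlonglongrightarrow> A'" using LIMSEQ_subseq_LIMSEQ[OF A r] by (simp add: o_def)
    have "- A' \<le> (\<integral>z. tpot e \<mu>' z \<partial>\<mu>') + d" if d: "0 < d" for d
    proof (rule tendsto_le[OF _ tendsto_add[OF l2 tendsto_const] tendsto_minus[OF l3]])
      obtain N where N: "eps N < e" using eps_less_ex e by blast
      show "\<forall>\<^sub>F n in sequentially. - A (r n) \<le> (\<integral>z. tpot e \<mu>' z \<partial>\<mu> (r n)) + d"
        using uc[OF d] eventually_ge_at_top[of N]
      proof eventually_elim
        case (elim n)
        note unif = elim(1)
        interpret prob_space "\<mu> (r n)" using prob_measures_onD assms(2) by blast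
        have "eps (r n) \<le> e"
          using N eps_antimono[of N "r n"] seq_suble[OF r, of n] elim(2) by linarith
        then have "- A (r n) \<le> (\<integral>z. tpot e (\<mu> (r n)) z \<partial>\<mu> (r n))"
          using en[of "r n"] tenergy_antimono[OF bm[OF assms(2)] bm[OF assms(2)] eps_pos, of "r n" e "r n" "r n"]
          unfolding tenergy_def by simp
        also have "\<dots> \<le> (\<integral>z. tpot e \<mu>' z + d \<partial>\<mu> (r n))"
        proof (rule integral_mono_AE)
          show "integrable (\<mu> (r n)) (tpot e (\<mu> (r n)))" "integrable (\<mu> (r n)) (\<lambda>z. tpot e \<mu>' z + d)"
            using integrable_tpot[OF bm[OF assms(2)] e bm[OF assms(2)]]
              integrable_tpot[OF bm[OF \<mu>'] e bm[OF assms(2)]] by simp_all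
          show "AE z in \<mu> (r n). tpot e (\<mu> (r n)) z \<le> tpot e \<mu>' z + d"
            using prob_measures_on_AE[OF assms(2) cl]
          proof eventually_elim
            case (elim z)
            with unif have "\<bar>tpot e (\<mu> (r n)) z - tpot e \<mu>' z\<bar> < d" by blast
            then show ?case by linarith
          qed
        qed
        also have "\<dots> = (\<integral>z. tpot e \<mu>' z \<partial>\<mu> (r n)) + d"
          using integrable_tpot[OF bm[OF \<mu>'] e bm[OF assms(2)]] prob_space by simp
        finally show ?case .
      qed
    qed simp
    then have "- A' \<le> (\<integral>z. tpot e \<mu>' z \<partial>\<mu>')" by (rule field_le_epsilon)
    then show ?thesis unfolding tenergy_def by simp
  qed
  show ?thesis using that[OF \<mu>'] key by simp
qed

section \<open>The maximum principle\<close>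

text \<open>A four-point substitute for the circle mean. The four factors \<open>a + r\<close>,
  \<open>a - r\<close>, \<open>a + \<i> r\<close>, \<open>a - \<i> r\<close> multiply to
  \<open>a ^ 4 - r ^ 4\<close>, so a logarithm obeys the mean value property up to an error of order
  \<open>r ^ 4\<close>, without any contour integral.\<close>

definition avg4 :: "(complex \<Rightarrow> real) \<Rightarrow> complex \<Rightarrow> real \<Rightarrow> real" where
  "avg4 f z r = (f (z + of_real r) + f (z - of_real r) + f (z + \<i> * of_real r) + f (z - \<i> * of_real r)) / 4"

lemma avg4_norm_square: "avg4 (\<lambda>z. (cmod z)\<^sup>2) z r = (cmod z)\<^sup>2 + r\<^sup>2"
  unfolding avg4_def cmod_power2 by (simp add: power2_eq_square algebra_simps)

lemma avg4_leI:
  assumes "\<And>c. cmod c = \<bar>r\<bar> \<Longrightarrow> f (z + c) \<le> m"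
  shows "avg4 f z r \<le> m"
proof -
  have "(x1 + x2 + x3 + x4) / 4 \<le> m" if "x1 \<le> m" "x2 \<le> m" "x3 \<le> m" "x4 \<le> m" for x1 x2 x3 x4 :: real
    using that by simp
  then show ?thesis unfolding avg4_def
    using assms[of "of_real r"] assms[of "- of_real r"] assms[of "\<i> * of_real r"] assms[of "- (\<i> * of_real r)"]
    by (simp add: norm_mult)
qed

lemma avg4_uminus: "avg4 (\<lambda>z. - f z) z r = - avg4 f z r"
  unfolding avg4_def minus_divide_left by (simp only: minus_add_distrib)

text \<open>The perturbation by a multiple of the squared modulus gains a term of order two in the radius,
  which beats the error of order four.\<close>

lemma max_principle:
  fixes f :: "complex \<Rightarrow> real"
  assumes "compact K" and cont: "continuous_on K f"
    and F: "\<And>z. z \<in> K \<Longrightarrow> z \<in> F \<Longrightarrow> f z \<le> M"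
    and sub: "\<And>z. z \<in> K \<Longrightarrow> z \<notin> F \<Longrightarrow> \<exists>C r0. 0 < r0 \<and>
       (\<forall>r. 0 < r \<longrightarrow> r < r0 \<longrightarrow> cball z r \<subseteq> K \<and> f z \<le> avg4 f z r + C * r ^ 4)"
    and "z \<in> K"
  shows "f z \<le> M"
proof (rule ccontr)
  assume neg: "\<not> f z \<le> M"
  obtain B where B: "0 < B" "\<And>z. z \<in> K \<Longrightarrow> (cmod z)\<^sup>2 \<le> B"
  proof -
    obtain b where "\<forall>z\<in>K. cmod z \<le> b" using compact_imp_bounded[OF assms(1)] unfolding bounded_iff by blast
    then have "(cmod z)\<^sup>2 \<le> b\<^sup>2 + 1" if "z \<in> K" for z
      using that power_mono[of "cmod z" b 2] by (auto intro: order_trans)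
    then show ?thesis using that[of "b\<^sup>2 + 1"] by (simp add: add_nonneg_pos)
  qed
  define \<eta> where "\<eta> = (f z - M) / (2 * B)"
  have \<eta>: "0 < \<eta>" "f z = M + 2 * B * \<eta>" using neg B(1) by (auto simp: \<eta>_def)
  define g where "g w = f w + \<eta> * (cmod w)\<^sup>2" for w
  have "continuous_on K g" unfolding g_def by (intro continuous_intros cont)
  then obtain w where w: "w \<in> K" "\<And>y. y \<in> K \<Longrightarrow> g y \<le> g w"
    using continuous_attains_sup[OF assms(1), of g] \<open>z \<in> K\<close> by blast
  have wF: "w \<notin> F"
  proof
    assume "w \<in> F"
    then have "g w \<le> M + \<eta> * B" using F[OF w(1)] B(2)[OF w(1)] \<eta>(1) by (auto simp: g_def intro!: add_mono)
    moreover have "f z \<le> g w" using w(2)[OF \<open>z \<in> K\<close>] \<eta>(1) by (simp add: g_def order_trans[rotated])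
    moreover have "0 < \<eta> * B" using \<eta> B by simp
    ultimately show False using \<eta>(2) by (simp add: algebra_simps)
  qed
  obtain C r0 where r0: "0 < r0"
      "\<And>r. 0 < r \<Longrightarrow> r < r0 \<Longrightarrow> cball w r \<subseteq> K \<and> f w \<le> avg4 f w r + C * r ^ 4"
    using sub[OF w(1) wF] by blast
  \<comment> \<open>Small enough for \<open>C * r\<^sup>2 < \<eta>\<close>, so that the gain \<eta>
    \<open>r\<^sup>2\<close> exceeds the error.\<close>
  define r where "r = min (r0 / 2) (min 1 (\<eta> / (2 * (\<bar>C\<bar> + 1))))"
  have r: "0 < r" "r < r0" "r \<le> 1" "r \<le> \<eta> / (2 * (\<bar>C\<bar> + 1))"
    using r0(1) \<eta>(1) by (auto simp: r_def)
  have "C * r\<^sup>2 \<le> \<bar>C\<bar> * r" using r by (intro mult_mono) (auto simp: power2_eq_square mult_left_le)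
  also have "\<dots> \<le> \<bar>C\<bar> * (\<eta> / (2 * (\<bar>C\<bar> + 1)))" using r by (intro mult_left_mono) auto
  also have "\<dots> < \<eta>" using \<eta>(1) by (simp add: field_simps add_nonneg_pos)
  finally have "C * r\<^sup>2 * r\<^sup>2 < \<eta> * r\<^sup>2" using r by simp
  then have Cr: "C * r ^ 4 < \<eta> * r\<^sup>2" by (simp add: power2_eq_square power4_eq_xxxx mult.assoc)
  have sub_K: "cball w r \<subseteq> K" and le: "f w \<le> avg4 f w r + C * r ^ 4" using r0(2) r by auto
  have "avg4 g w r \<le> g w"
    using r(1) by (intro avg4_leI w(2) subsetD[OF sub_K]) (simp add: dist_norm)
  moreover have "avg4 g w r = avg4 f w r + \<eta> * ((cmod w)\<^sup>2 + r\<^sup>2)"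
    unfolding avg4_norm_square[symmetric] by (simp add: avg4_def g_def algebra_simps add_divide_distrib)
  ultimately show False using le Cr by (simp add: g_def algebra_simps)
qed

lemma sum_ln_four_points:
  assumes "0 < r" "r < cmod a"
  shows "ln (cmod (a + of_real r)) + ln (cmod (a - of_real r)) + ln (cmod (a + \<i> * of_real r))
     + ln (cmod (a - \<i> * of_real r)) = ln (cmod (a ^ 4 - of_real (r ^ 4)))"
proof -
  have nz: "a + c \<noteq> 0" if "cmod c = r" for c
    using assms that by (metis add_eq_0_iff less_irrefl norm_minus_cancel)
  have "a + of_real r \<noteq> 0" "a + - of_real r \<noteq> 0" "a + \<i> * of_real r \<noteq> 0" "a + - (\<i> * of_real r) \<noteq> 0"
    using assms(1) by (intro nz; simp add: norm_mult)+
  moreover have "a ^ 4 - of_real (r ^ 4)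
      = (a + of_real r) * (a - of_real r) * (a + \<i> * of_real r) * (a - \<i> * of_real r)"
  proof -
    have 1: "(a + of_real r) * (a - of_real r) = a\<^sup>2 - of_real (r\<^sup>2)"
      by (simp add: algebra_simps power2_eq_square)
    have 2: "(a + \<i> * of_real r) * (a - \<i> * of_real r) = a\<^sup>2 + of_real (r\<^sup>2)"
      by (simp add: algebra_simps power2_eq_square)
    show ?thesis
      unfolding mult.assoc[of _ "a + \<i> * of_real r"] 1 2
      by (simp add: algebra_simps power2_eq_square power4_eq_xxxx)
  qed
  ultimately show ?thesis by (simp add: norm_mult ln_mult)
qed

lemma ln_fourth_power: "0 < x \<Longrightarrow> ln (x ^ 4) = 4 * ln (x :: real)"
  by (simp add: ln_realpow)

text \<open>The truncated kernel is the maximum of a harmonic function and a constant, hence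
  subharmonic. Inside the truncation disc it sits at its minimum; outside, the product of the four
  factors has modulus at least \<open>(cmod a) ^ 4 * (1 - (r / e) ^ 4)\<close>.\<close>

lemma avg4_tlog_ge:
  assumes "0 < r" "r \<le> e / 2"
  shows "tlog e a \<le> avg4 (tlog e) a r + (r / e) ^ 4"
proof (cases "cmod a \<le> e")
  case True
  have e: "0 < e" using assms by simp
  have "tlog e a = ln e" using True by (simp add: tlog_def max_def)
  moreover have "ln e \<le> avg4 (tlog e) a r"
    using avg4_leI[of r "\<lambda>w. - tlog e w" a "- ln e"] tlog_ge[OF e] by (simp add: avg4_uminus)
  ultimately show ?thesis using e assms by (simp add: add_increasing2)
next
  case False
  have e: "0 < e" and a: "e < cmod a" and ra: "r < cmod a" using assms False by auto
  define x where "x = (r / e) ^ 4"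
  have "(r / e) ^ 4 \<le> (1/2) ^ 4" using assms e by (intro power_mono) (auto simp: field_simps)
  moreover have "(1/2) ^ 4 \<le> (1/2 :: real)" by (simp add: power4_eq_xxxx)
  ultimately have x: "0 \<le> x" "x \<le> 1/2" unfolding x_def by (simp, linarith)
  have pos: "0 < cmod (a + c)" if "cmod c = r" for c
    using ra that by (metis add_eq_0_iff less_irrefl norm_minus_cancel zero_less_norm_iff)
  have "(cmod a) ^ 4 * (1 - x) \<le> (cmod a) ^ 4 - r ^ 4"
  proof -
    have "r ^ 4 = e ^ 4 * x" using e by (simp add: x_def power_divide)
    also have "\<dots> \<le> (cmod a) ^ 4 * x" using a e x by (intro mult_right_mono power_mono) auto
    finally show ?thesis by (simp add: algebra_simps)
  qed
  also have "\<dots> \<le> cmod (a ^ 4 - of_real (r ^ 4))"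
    using norm_triangle_ineq2[of "a ^ 4" "of_real (r ^ 4)"] assms(1) by (simp add: norm_power)
  finally have *: "(cmod a) ^ 4 * (1 - x) \<le> cmod (a ^ 4 - of_real (r ^ 4))" .
  have a4: "0 < (cmod a) ^ 4" using a e by (intro zero_less_power) linarith
  have "4 * ln (cmod a) + ln (1 - x) = ln ((cmod a) ^ 4 * (1 - x))"
    using ln_mult_pos[OF a4, of "1 - x"] ln_fourth_power[of "cmod a"] a e x by linarith
  also have "\<dots> \<le> ln (cmod (a ^ 4 - of_real (r ^ 4)))"
    using * a4 x by (intro ln_mono) (auto intro: mult_pos_pos)
  also have "\<dots> = ln (cmod (a + of_real r)) + ln (cmod (a + - of_real r)) + ln (cmod (a + \<i> * of_real r))
     + ln (cmod (a + - (\<i> * of_real r)))"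
    using sum_ln_four_points[OF assms(1) ra] by simp
  also have "\<dots> \<le> 4 * avg4 (tlog e) a r" unfolding avg4_def
    using assms(1) by (auto intro!: add_mono ln_le_tlog e pos simp: norm_mult simp flip: add_uminus_conv_diff)
  finally have "4 * ln (cmod a) + ln (1 - x) \<le> 4 * avg4 (tlog e) a r" .
  moreover have "- 2 * x \<le> ln (1 - x)"
  proof -
    have "1 - 1 / (1 - x) \<le> ln (1 - x)" using ln_le_minus_one[of "1 / (1 - x)"] x by (simp add: ln_div)
    moreover have "- 2 * x \<le> 1 - 1 / (1 - x)"
    proof -
      have "0 \<le> x * (1 - 2 * x)" using x by simp
      then have "0 \<le> (x * (1 - 2 * x)) / (1 - x)" using x by simp
      also have "\<dots> = 1 - 1 / (1 - x) + 2 * x" using x by (simp add: field_simps)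
      finally show ?thesis by simp
    qed
    ultimately show ?thesis by linarith
  qed
  moreover have "tlog e a = ln (cmod a)" using a by (simp add: tlog_eq_ln)
  ultimately show ?thesis using x(1) unfolding x_def[symmetric] by linarith
qed

text \<open>When all four points stay outside the truncation disc, the kernel is the harmonic
  function ln |w| at each of them, and the reverse mean value inequality holds as well.\<close>

lemma avg4_tlog_le:
  assumes "0 < r" "0 < e" "e + r \<le> cmod a"
  shows "avg4 (tlog e) a r \<le> tlog e a + (r / e) ^ 4"
proof -
  have ra: "r < cmod a" using assms by simp
  have big: "e \<le> cmod (a + c)" if "cmod c = r" for c
    using norm_diff_ineq[of a c] that assms(3) by simp
  have "4 * avg4 (tlog e) a r = ln (cmod (a + of_real r)) + ln (cmod (a + - of_real r))
      + ln (cmod (a + \<i> * of_real r)) + ln (cmod (a + - (\<i> * of_real r)))"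
    unfolding avg4_def using assms(1) big[of "of_real r"] big[of "- of_real r"] big[of "\<i> * of_real r"]
      big[of "- (\<i> * of_real r)"] by (simp add: norm_mult tlog_eq_ln)
  also have "\<dots> = ln (cmod (a ^ 4 - of_real (r ^ 4)))"
    using sum_ln_four_points[OF assms(1) ra] by simp
  also have "\<dots> \<le> ln ((cmod a) ^ 4 * (1 + (r / cmod a) ^ 4))"
  proof (rule ln_mono)
    have "r ^ 4 < (cmod a) ^ 4" using ra assms by (intro power_strict_mono) auto
    moreover have "cmod (of_real (r ^ 4)) = r ^ 4" using assms(1) by (simp add: norm_power)
    ultimately show "0 < cmod (a ^ 4 - of_real (r ^ 4))"
      using norm_triangle_ineq2[of "a ^ 4" "of_real (r ^ 4)"] unfolding norm_power[of a] by linarith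
    have "cmod (a ^ 4 - of_real (r ^ 4)) \<le> (cmod a) ^ 4 + r ^ 4"
      using norm_triangle_ineq4[of "a ^ 4" "of_real (r ^ 4)"] assms(1) by (simp add: norm_power)
    also have "\<dots> = (cmod a) ^ 4 * (1 + (r / cmod a) ^ 4)" using ra assms(1) by (auto simp: power_divide field_simps)
    finally show "cmod (a ^ 4 - of_real (r ^ 4)) \<le> (cmod a) ^ 4 * (1 + (r / cmod a) ^ 4)" .
  qed
  also have "\<dots> = 4 * ln (cmod a) + ln (1 + (r / cmod a) ^ 4)"
  proof -
    have "0 \<le> (r / cmod a) ^ 4" by simp
    then have p: "0 < 1 + (r / cmod a) ^ 4" by linarith
    have "0 < (cmod a) ^ 4" using ra assms by (intro zero_less_power) linarith
    with p have "ln ((cmod a) ^ 4 * (1 + (r / cmod a) ^ 4)) = ln ((cmod a) ^ 4) + ln (1 + (r / cmod a) ^ 4)"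
      by (intro ln_mult_pos)
    moreover have "0 < cmod a" using ra assms by linarith
    ultimately show ?thesis by (simp add: ln_fourth_power)
  qed
  also have "ln (1 + (r / cmod a) ^ 4) \<le> (r / cmod a) ^ 4" by (rule ln_add_one_self_le_self) simp
  also have "(r / cmod a) ^ 4 \<le> (r / e) ^ 4"
    using assms by (intro power_mono divide_left_mono mult_pos_pos) auto
  finally have "4 * avg4 (tlog e) a r \<le> 4 * ln (cmod a) + (r / e) ^ 4" by simp
  moreover have "tlog e a = ln (cmod a)" using assms by (simp add: tlog_eq_ln)
  moreover have "0 \<le> (r / e) ^ 4" by simp
  ultimately show ?thesis by linarith
qed

lemma avg4_tpot:
  assumes "ball_measure R \<nu>" "0 < e"
  shows "avg4 (tpot e \<nu>) z r = (\<integral>t. avg4 (tlog e) (z - t) r \<partial>\<nu>)"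
    "integrable \<nu> (\<lambda>t. avg4 (tlog e) (z - t) r)"
proof -
  note i = integrable_tlog[OF assms]
  have eq: "avg4 (tlog e) (z - t) r = (tlog e (z + of_real r - t) + tlog e (z - of_real r - t)
     + tlog e (z + \<i> * of_real r - t) + tlog e (z - \<i> * of_real r - t)) / 4" for t
    by (simp add: avg4_def algebra_simps)
  show "avg4 (tpot e \<nu>) z r = (\<integral>t. avg4 (tlog e) (z - t) r \<partial>\<nu>)"
    unfolding eq unfolding avg4_def tpot_def using i by simp
  show "integrable \<nu> (\<lambda>t. avg4 (tlog e) (z - t) r)" unfolding eq using i by simp
qed

lemma avg4_tpot_ge:
  assumes "ball_measure R \<nu>" "0 < r" "r \<le> e / 2"
  shows "tpot e \<nu> z \<le> avg4 (tpot e \<nu>) z r + measure \<nu> UNIV / e ^ 4 * r ^ 4"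
proof -
  interpret finite_measure \<nu> using assms ball_measureD by auto
  have e: "0 < e" using assms by simp
  have "tpot e \<nu> z \<le> (\<integral>t. avg4 (tlog e) (z - t) r + (r / e) ^ 4 \<partial>\<nu>)"
    unfolding tpot_def using avg4_tlog_ge[OF assms(2,3)]
    by (intro integral_mono integrable_tlog[OF assms(1) e] Bochner_Integration.integrable_add avg4_tpot(2)[OF assms(1) e]) auto
  also have "\<dots> = avg4 (tpot e \<nu>) z r + measure \<nu> UNIV / e ^ 4 * r ^ 4"
    using avg4_tpot[OF assms(1) e] ball_measureD(4)[OF assms(1)] by (simp add: power_divide)
  finally show ?thesis .
qed

lemma avg4_tpot_le:
  assumes "ball_measure R \<nu>" "0 < r" "0 < e" "AE t in \<nu>. e + r \<le> cmod (z - t)"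
  shows "avg4 (tpot e \<nu>) z r \<le> tpot e \<nu> z + measure \<nu> UNIV / e ^ 4 * r ^ 4"
proof -
  interpret finite_measure \<nu> using assms ball_measureD by auto
  have "avg4 (tpot e \<nu>) z r \<le> (\<integral>t. tlog e (z - t) + (r / e) ^ 4 \<partial>\<nu>)"
    unfolding avg4_tpot(1)[OF assms(1,3)]
  proof (rule integral_mono_AE)
    show "AE t in \<nu>. avg4 (tlog e) (z - t) r \<le> tlog e (z - t) + (r / e) ^ 4"
      using assms(4) by eventually_elim (rule avg4_tlog_le[OF assms(2,3)])
  qed (use integrable_tlog[OF assms(1,3)] avg4_tpot(2)[OF assms(1,3)] in auto)
  also have "\<dots> = tpot e \<nu> z + measure \<nu> UNIV / e ^ 4 * r ^ 4"
    using integrable_tlog[OF assms(1,3)] ball_measureD(4)[OF assms(1)]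
    by (simp add: power_divide tpot_def)
  finally show ?thesis .
qed

section \<open>Mixtures\<close>

text \<open>The convex combination is realised as the law of a point drawn from
  \<open>\<sigma>\<close> with probability \<open>s\<close> and from \<open>\<mu>\<close> otherwise.
  The monadic construction yields the formula for nonnegative integrands; adding a bound for |f| on
  \<open>E\<close> carries it to real ones.\<close>

lemma prob_measures_on_mixture:
  assumes "\<mu> \<in> prob_measures_on E" "\<sigma> \<in> prob_measures_on E" "closed E" "0 \<le> s" "s \<le> 1"
  shows "\<exists>\<kappa>\<in>prob_measures_on E. \<forall>f :: complex \<Rightarrow> real. f \<in> borel_measurable borel \<longrightarrow>
     bounded (f ` E) \<longrightarrow> (\<integral>z. f z \<partial>\<kappa>) = (1 - s) * (\<integral>z. f z \<partial>\<mu>) + s * (\<integral>z. f z \<partial>\<sigma>)"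
proof -
  define N where "N b = (if b then \<sigma> else \<mu>)" for b
  define M where "M = measure_pmf (bernoulli_pmf s)"
  define \<kappa> where "\<kappa> = M \<bind> N"
  have NE: "N b \<in> prob_measures_on E" for b using assms by (auto simp: N_def)
  have N': "N \<in> M \<rightarrow>\<^sub>M prob_algebra borel"
    using prob_measures_onD[OF NE] by (auto simp: M_def space_prob_algebra)
  have N: "N \<in> M \<rightarrow>\<^sub>M subprob_algebra borel" using N' by (rule measurable_prob_algebraD)
  have Ms: "space M \<noteq> {}" by (simp add: M_def)
  have s\<kappa>: "sets \<kappa> = sets borel" unfolding \<kappa>_def by (rule sets_bind_measurable[OF N Ms])
  have p\<kappa>: "prob_space \<kappa>"
    using measurable_bind_prob_space2 unfolding \<kappa>_def M_def
    by (intro prob_space.prob_space_bind[OF _ _ N[unfolded M_def]])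
       (auto simp: prob_space_measure_pmf prob_measures_onD[OF NE])
  have AE: "AE z in \<kappa>. z \<in> E"
    unfolding \<kappa>_def using assms(3)
    by (subst AE_bind[OF N pred_sets2[OF borel_closed[OF assms(3)] measurable_ident_sets[OF refl]]]) (auto intro!: AE_I2 prob_measures_on_AE[OF NE])
  have \<kappa>E: "\<kappa> \<in> prob_measures_on E" using p\<kappa> s\<kappa> AE assms(3) by (rule prob_measures_onI)
  have nn: "(\<integral>\<^sup>+ z. f z \<partial>\<kappa>) = ennreal (1 - s) * (\<integral>\<^sup>+ z. f z \<partial>\<mu>) + ennreal s * (\<integral>\<^sup>+ z. f z \<partial>\<sigma>)"
    if "f \<in> borel_measurable borel" for f
    unfolding \<kappa>_def nn_integral_bind[OF that N] unfolding M_def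
    using assms(4,5) by (simp add: nn_integral_measure_pmf nn_integral_count_space_finite N_def UNIV_bool mult.commute add.commute)
  have "(\<integral>z. f z \<partial>\<kappa>) = (1 - s) * (\<integral>z. f z \<partial>\<mu>) + s * (\<integral>z. f z \<partial>\<sigma>)"
    if f[measurable]: "f \<in> borel_measurable borel" and bf: "bounded (f ` E)" for f :: "complex \<Rightarrow> real"
  proof -
    obtain B where B: "\<And>z. z \<in> E \<Longrightarrow> \<bar>f z\<bar> \<le> B" using bf unfolding bounded_iff by auto
    have int: "integrable \<nu> f" and nni: "(\<integral>\<^sup>+ z. ennreal (f z + B) \<partial>\<nu>) = ennreal ((\<integral>z. f z \<partial>\<nu>) + B)"
      and pos: "0 \<le> (\<integral>z. f z \<partial>\<nu>) + B"
      if \<nu>: "\<nu> \<in> prob_measures_on E" for \<nu>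
    proof -
      interpret prob_space \<nu> using prob_measures_onD[OF \<nu>] by blast
      note [measurable_cong] = prob_measures_onD(2)[OF \<nu>]
      have AE: "AE z in \<nu>. \<bar>f z\<bar> \<le> B" using prob_measures_on_AE[OF \<nu> assms(3)]
        by eventually_elim (rule B)
      show i: "integrable \<nu> f" using AE by (intro integrable_const_bound[of _ B]) auto
      have AE0: "AE z in \<nu>. 0 \<le> f z + B" using AE by eventually_elim linarith
      have "(\<integral>\<^sup>+ z. ennreal (f z + B) \<partial>\<nu>) = ennreal (\<integral>z. f z + B \<partial>\<nu>)"
        using i AE0 by (intro nn_integral_eq_integral) auto
      then show "(\<integral>\<^sup>+ z. ennreal (f z + B) \<partial>\<nu>) = ennreal ((\<integral>z. f z \<partial>\<nu>) + B)"
        using i prob_space by simp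
      have "0 \<le> (\<integral>z. f z + B \<partial>\<nu>)" using AE0 by (rule integral_nonneg_AE)
      then show "0 \<le> (\<integral>z. f z \<partial>\<nu>) + B" using i prob_space by simp
    qed
    have "ennreal ((\<integral>z. f z \<partial>\<kappa>) + B) = ennreal ((1 - s) * ((\<integral>z. f z \<partial>\<mu>) + B) + s * ((\<integral>z. f z \<partial>\<sigma>) + B))"
      using nn[of "\<lambda>z. ennreal (f z + B)"] nni[OF \<kappa>E] nni[OF assms(1)] nni[OF assms(2)]
        pos[OF assms(1)] pos[OF assms(2)] assms(4,5)
      by (simp add: ennreal_mult ennreal_plus)
    moreover have "0 \<le> (1 - s) * ((\<integral>z. f z \<partial>\<mu>) + B) + s * ((\<integral>z. f z \<partial>\<sigma>) + B)"
      using pos[OF assms(1)] pos[OF assms(2)] assms(4,5) by simp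
    ultimately have "(\<integral>z. f z \<partial>\<kappa>) + B = (1 - s) * ((\<integral>z. f z \<partial>\<mu>) + B) + s * ((\<integral>z. f z \<partial>\<sigma>) + B)"
      using pos[OF \<kappa>E] by simp
    then show ?thesis by (simp add: algebra_simps)
  qed
  then show ?thesis using \<kappa>E by blast
qed

lemma bounded_image_tlog:
  assumes "compact E" "0 < e"
  shows "bounded ((\<lambda>t. tlog e (z - t)) ` E)"
  using assms by (intro compact_imp_bounded compact_continuous_image continuous_intros)

lemma compact_subset_cball: "compact (E :: complex set) \<Longrightarrow> \<exists>R\<ge>1. E \<subseteq> cball 0 R"
proof -
  assume "compact E"
  then have "bounded E" by (rule compact_imp_bounded)
  then obtain R where "\<forall>z\<in>E. cmod z \<le> R" unfolding bounded_iff by blast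
  then show ?thesis by (intro exI[of _ "max 1 R"]) (auto simp: max.coboundedI2)
qed

lemma tenergy_mixture:
  assumes "compact E" "\<mu> \<in> prob_measures_on E" "\<sigma> \<in> prob_measures_on E" "0 \<le> s" "s \<le> 1"
  shows "\<exists>\<kappa>\<in>prob_measures_on E. \<forall>e>0. tenergy e \<kappa> \<kappa>
     = (1 - s)\<^sup>2 * tenergy e \<mu> \<mu> + 2 * s * (1 - s) * tenergy e \<mu> \<sigma> + s\<^sup>2 * tenergy e \<sigma> \<sigma>"
proof -
  have cl: "closed E" using assms(1) compact_imp_closed by blast
  obtain R where R: "E \<subseteq> cball 0 R" using compact_subset_cball[OF assms(1)] by blast
  note bm = prob_measures_on_ball_measure[OF _ cl R]
  obtain \<kappa> where \<kappa>: "\<kappa> \<in> prob_measures_on E"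
    and I: "\<And>f :: complex \<Rightarrow> real. f \<in> borel_measurable borel \<Longrightarrow>
     bounded (f ` E) \<Longrightarrow> (\<integral>z. f z \<partial>\<kappa>) = (1 - s) * (\<integral>z. f z \<partial>\<mu>) + s * (\<integral>z. f z \<partial>\<sigma>)"
    using prob_measures_on_mixture[OF assms(2,3) cl assms(4,5)] by blast
  have "tenergy e \<kappa> \<kappa>
     = (1 - s)\<^sup>2 * tenergy e \<mu> \<mu> + 2 * s * (1 - s) * tenergy e \<mu> \<sigma> + s\<^sup>2 * tenergy e \<sigma> \<sigma>" if e: "0 < e" for e
  proof -
    have p: "tpot e \<kappa> z = (1 - s) * tpot e \<mu> z + s * tpot e \<sigma> z" for z
      unfolding tpot_def using bounded_image_tlog[OF assms(1) e] by (intro I) auto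
    have b: "bounded (tpot e \<nu> ` E)" if "\<nu> \<in> prob_measures_on E" for \<nu>
      using continuous_on_tpot[OF bm[OF that] e] assms(1) by (intro compact_imp_bounded compact_continuous_image)
    have i: "integrable \<nu> (tpot e \<nu>')" if "\<nu> \<in> prob_measures_on E" "\<nu>' \<in> prob_measures_on E" for \<nu> \<nu>'
      using integrable_tpot[OF bm e bm] that by blast
    have "tenergy e \<kappa> \<kappa> = (1 - s) * tenergy e \<kappa> \<mu> + s * tenergy e \<kappa> \<sigma>"
      unfolding tenergy_def using I[OF measurable_tpot[OF bm[OF \<kappa>] e] b[OF \<kappa>]] by simp
    moreover have "tenergy e \<kappa> \<nu> = (1 - s) * tenergy e \<mu> \<nu> + s * tenergy e \<sigma> \<nu>"
      if "\<nu> \<in> prob_measures_on E" for \<nu>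
      unfolding tenergy_def p using i[OF that assms(2)] i[OF that assms(3)] by simp
    moreover have "tenergy e \<sigma> \<mu> = tenergy e \<mu> \<sigma>"
      using bm[OF assms(2)] bm[OF assms(3)] e by (intro tenergy_commute)
    ultimately show ?thesis using assms(2,3) by (simp add: power2_eq_square algebra_simps)
  qed
  then show ?thesis using \<kappa> by blast
qed

lemma restrict_ball_measure:
  assumes "ball_measure R \<nu>" and L[measurable]: "L \<in> sets borel"
  defines "\<nu>' \<equiv> density \<nu> (\<lambda>t. ennreal (indicator L t))"
  shows "ball_measure R \<nu>'" "AE t in \<nu>'. t \<in> L" "measure \<nu>' UNIV = measure \<nu> L"
    "\<And>f :: complex \<Rightarrow> real. f \<in> borel_measurable borel \<Longrightarrow> (\<integral>t. f t \<partial>\<nu>') = (\<integral>t. indicator L t * f t \<partial>\<nu>)"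
proof -
  note [measurable_cong] = ball_measureD(1)[OF assms(1)]
  interpret finite_measure \<nu> using assms ball_measureD by auto
  have sp: "space \<nu> = UNIV" by (rule ball_measureD[OF assms(1)])
  have em: "emeasure \<nu>' UNIV = emeasure \<nu> L"
    unfolding \<nu>'_def ennreal_indicator using sets.top[of \<nu>] sp by (subst emeasure_density) auto
  then show "measure \<nu>' UNIV = measure \<nu> L" by (simp add: measure_def)
  show "AE t in \<nu>'. t \<in> L" unfolding \<nu>'_def by (subst AE_density) (auto simp: indicator_def)
  have "AE t in \<nu>'. cmod t \<le> R" unfolding \<nu>'_def
    using ball_measureD(3)[OF assms(1)] by (subst AE_density) (auto elim: AE_mp)
  moreover have "finite_measure \<nu>'"
    using em sp by (intro finite_measureI) (auto simp: \<nu>'_def emeasure_finite)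
  ultimately show "ball_measure R \<nu>'"
    unfolding ball_measure_def using ball_measureD(1)[OF assms(1)] by (auto simp: \<nu>'_def)
  fix f :: "complex \<Rightarrow> real" assume [measurable]: "f \<in> borel_measurable borel"
  show "(\<integral>t. f t \<partial>\<nu>') = (\<integral>t. indicator L t * f t \<partial>\<nu>)"
    unfolding \<nu>'_def by (subst integral_density) auto
qed

section \<open>The support of a measure\<close>

lemma closed_msupport:
  assumes "sets \<mu> = sets borel"
  shows "closed (msupport \<mu>)"
proof -
  have "\<exists>e>0. ball z e \<subseteq> - msupport \<mu>" if "z \<in> - msupport \<mu>" for z
  proof -
    from that obtain e where e: "0 < e" "emeasure \<mu> (ball z e) = 0" by (auto simp: msupport_def)
    have "w \<in> - msupport \<mu>" if w: "w \<in> ball z e" for w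
    proof -
      obtain d where d: "0 < d" "ball w d \<subseteq> ball z e"
        using open_ball[of z e, unfolded open_contains_ball] w by blast
      have "emeasure \<mu> (ball w d) \<le> emeasure \<mu> (ball z e)"
        using d(2) assms by (intro emeasure_mono) auto
      then show ?thesis using d(1) e(2) by (auto simp: msupport_def)
    qed
    then show ?thesis using e(1) by blast
  qed
  then have "open (- msupport \<mu>)" unfolding open_contains_ball by blast
  then show ?thesis by (simp add: closed_def)
qed

text \<open>The complement of the support is a union of null balls, and by Lindelof countably many
  of them suffice.\<close>

lemma AE_msupport:
  assumes "sets \<mu> = sets borel"
  shows "AE z in \<mu>. z \<in> msupport \<mu>"
proof -
  define \<F> where "\<F> = {ball z e | z e. emeasure \<mu> (ball z e) = 0}"
  have "\<And>B. B \<in> \<F> \<Longrightarrow> open B" by (auto simp: \<F>_def)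
  then obtain \<F>' where F': "\<F>' \<subseteq> \<F>" "countable \<F>'" "\<Union>\<F>' = \<Union>\<F>" by (rule Lindelof)
  have "\<Union>\<F>' \<in> null_sets \<mu>"
    using F' assms by (intro null_sets_UN'[where N = "\<lambda>x. x", simplified]) (auto simp: \<F>_def null_sets_def)
  moreover have "- msupport \<mu> \<subseteq> \<Union>\<F>"
  proof
    fix z assume "z \<in> - msupport \<mu>"
    then obtain e where "0 < e" "emeasure \<mu> (ball z e) = 0" by (auto simp: msupport_def)
    then have "ball z e \<in> \<F>" "z \<in> ball z e" by (auto simp: \<F>_def)
    then show "z \<in> \<Union>\<F>" by blast
  qed
  ultimately show ?thesis using F'(3) by (intro AE_I'[of "\<Union>\<F>'"]) auto
qed

lemma msupport_subset:
  assumes "\<mu> \<in> prob_measures_on E" "closed E"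
  shows "msupport \<mu> \<subseteq> E"
proof
  fix z assume z: "z \<in> msupport \<mu>"
  show "z \<in> E"
  proof (rule ccontr)
    assume "z \<notin> E"
    then obtain e where e: "0 < e" "ball z e \<subseteq> - E"
      using assms(2) open_contains_ball[of "- E"] by auto
    have "emeasure \<mu> (ball z e) \<le> emeasure \<mu> (UNIV - E)"
      using e(2) assms prob_measures_onD(2)[OF assms(1)] by (intro emeasure_mono) auto
    then show False using z e(1) assms(1) by (auto simp: msupport_def prob_measures_on_def)
  qed
qed

section \<open>The equilibrium measure\<close>

text \<open>\<open>V\<close> is the Robin constant. Attainment and minimality are both phrased
  through truncated energies, so that no extended real occurs, and \<open>\<mu>\<close> may be
  whichever minimiser the choice in \<open>equilibrium_measure\<close> returns.\<close>

locale energy_minimiser =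
  fixes E :: "complex set" and \<mu> :: "complex measure" and V R :: real
  assumes compact_E: "compact E" and R_ge_1: "1 \<le> R" and E_subset: "E \<subseteq> cball 0 R"
    and mu_on: "\<mu> \<in> prob_measures_on E"
    and energy_le: "\<And>n. tenergy (eps n) \<mu> \<mu> \<le> V"
    and energy_min: "\<And>\<sigma> A. \<sigma> \<in> prob_measures_on E \<Longrightarrow> (\<And>n. tenergy (eps n) \<sigma> \<sigma> \<le> A) \<Longrightarrow> V \<le> A"
begin

lemma closed_E: "closed E"
  using compact_E by (rule compact_imp_closed)

lemma bm_on: "\<sigma> \<in> prob_measures_on E \<Longrightarrow> ball_measure R \<sigma>"
  using prob_measures_on_ball_measure[OF _ closed_E E_subset] .

lemma bm: "ball_measure R \<mu>"
  by (rule bm_on[OF mu_on])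

lemma sets_mu [measurable_cong, simp]: "sets \<mu> = sets borel"
  by (rule prob_measures_onD[OF mu_on])

lemma space_mu [simp]: "space \<mu> = UNIV"
  by (rule prob_measures_onD[OF mu_on])

lemma AE_E: "AE z in \<mu>. z \<in> E"
  by (rule prob_measures_on_AE[OF mu_on closed_E])

sublocale prob_space \<mu>
  by (rule prob_measures_onD[OF mu_on])

lemma E_ne: "E \<noteq> {}"
  using mu_on by (auto simp: prob_measures_on_def)

text \<open>First variation along \<open>(1 - s) \<mu> + s \<sigma>\<close>: the derivative of the
  energy at \<open>s = 0\<close> is at most \<open>2 * (X - V)\<close> and cannot be negative at a
  minimum. The finite energy bound \<open>Y\<close> keeps the quadratic term under control.\<close>

lemma variation:
  assumes "\<sigma> \<in> prob_measures_on E" "\<And>n. tenergy (eps n) \<sigma> \<sigma> \<le> Y" "\<And>n. tenergy (eps n) \<mu> \<sigma> \<le> X"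
  shows "V \<le> X"
proof (rule ccontr)
  assume neg: "\<not> V \<le> X"
  \<comment> \<open>\<open>V - 2 * X + Y\<close> is the coefficient of \<open>s\<^sup>2\<close>.
    With \<open>s * c \<le> V - X\<close> the quadratic term eats at most half of the linear gain
    \<open>2 * (V - X)\<close>.\<close>
  define c where "c = \<bar>V - 2 * X + Y\<bar> + 1"
  define s where "s = min 1 ((V - X) / c)"
  have c: "0 < c" by (simp add: c_def)
  have s: "0 < s" "s \<le> 1" "s * c \<le> V - X" using neg c by (auto simp: s_def min_def field_simps)
  obtain \<kappa> where \<kappa>: "\<kappa> \<in> prob_measures_on E" "\<And>e. 0 < e \<Longrightarrow> tenergy e \<kappa> \<kappa>
     = (1 - s)\<^sup>2 * tenergy e \<mu> \<mu> + 2 * s * (1 - s) * tenergy e \<mu> \<sigma> + s\<^sup>2 * tenergy e \<sigma> \<sigma>"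
    using tenergy_mixture[OF compact_E mu_on assms(1), of s] s by auto
  have "tenergy (eps n) \<kappa> \<kappa> \<le> (1 - s)\<^sup>2 * V + 2 * s * (1 - s) * X + s\<^sup>2 * Y" for n
    unfolding \<kappa>(2)[OF eps_pos] using s assms(2,3) energy_le
    by (intro add_mono mult_left_mono) auto
  then have "V \<le> (1 - s)\<^sup>2 * V + 2 * s * (1 - s) * X + s\<^sup>2 * Y" by (rule energy_min[OF \<kappa>(1)])
  then have "s * (2 * (V - X)) \<le> s * (s * (V - 2 * X + Y))"
    by (simp add: power2_eq_square algebra_simps)
  then have "2 * (V - X) \<le> s * (V - 2 * X + Y)" using s(1) by simp
  also have "\<dots> \<le> s * c" using s(1) by (intro mult_left_mono) (auto simp: c_def)
  also have "\<dots> \<le> V - X" by (rule s(3))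
  finally show False using neg by simp
qed

definition D :: real where "D = 2 * R"

lemma D_ge_1: "1 \<le> D" using R_ge_1 by (simp add: D_def)

lemma lnD_nonneg: "0 \<le> ln D" using D_ge_1 by simp

lemma tlog_le_lnD: "cmod z \<le> R \<Longrightarrow> cmod t \<le> R \<Longrightarrow> 0 < e \<Longrightarrow> e \<le> 1 \<Longrightarrow> tlog e (z - t) \<le> ln D"
  using norm_triangle_ineq4[of z t] R_ge_1 by (intro tlog_le) (auto simp: D_def)

lemma tpot_le_lnD:
  assumes "\<sigma> \<in> prob_measures_on E" "cmod z \<le> R" "0 < e" "e \<le> 1"
  shows "tpot e \<sigma> z \<le> ln D"
  using tpot_le[OF bm_on[OF assms(1)] assms(3), of z "ln D"] tlog_le_lnD assms prob_measures_onD(4)[OF assms(1)]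
  by simp

text \<open>If the set had positive mass, the normalised restriction of \<open>\<mu>\<close> to it
  would have finite energy and mutual energy at most \<open>V - \<eta>\<close> with
  \<open>\<mu>\<close>, against \<open>variation\<close>.\<close>

lemma superlevel_null:
  assumes "0 < \<eta>"
  shows "emeasure \<mu> {z. \<forall>n. - V + \<eta> \<le> tpot (eps n) \<mu> z} = 0"
proof (rule ccontr)
  define A where "A = {z. \<forall>n. - V + \<eta> \<le> tpot (eps n) \<mu> z}"
  assume "emeasure \<mu> {z. \<forall>n. - V + \<eta> \<le> tpot (eps n) \<mu> z} \<noteq> 0"
  then have A0: "0 < measure \<mu> A" by (simp add: A_def emeasure_eq_measure zero_less_measure_iff)
  define a where "a = measure \<mu> A"
  have a: "0 < a" using A0 by (simp add: a_def)
  have "closed A" unfolding A_def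
    by (intro closed_Collect_all closed_Collect_le continuous_intros continuous_on_tpot[OF bm]) auto
  then have [measurable]: "A \<in> sets borel" by simp
  define \<sigma> where "\<sigma> = density \<mu> (\<lambda>z. ennreal (indicator A z / a))"
  have em: "emeasure \<sigma> UNIV = 1"
  proof -
    have "emeasure \<sigma> UNIV = (\<integral>\<^sup>+ z. ennreal (indicator A z / a) \<partial>\<mu>)"
      unfolding \<sigma>_def by (subst emeasure_density) auto
    also have "\<dots> = (\<integral>\<^sup>+ z. ennreal (1 / a) * indicator A z \<partial>\<mu>)"
      by (intro nn_integral_cong) (auto simp: indicator_def)
    also have "\<dots> = ennreal (1 / a) * ennreal a"
      by (subst nn_integral_cmult_indicator) (auto simp: emeasure_eq_measure a_def)
    finally show ?thesis using a by (simp flip: ennreal_mult)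
  qed
  have \<sigma>: "\<sigma> \<in> prob_measures_on E"
  proof (rule prob_measures_onI[OF _ _ _ closed_E])
    show "prob_space \<sigma>" using em by (intro prob_spaceI) (simp add: \<sigma>_def)
    show "sets \<sigma> = sets borel" by (simp add: \<sigma>_def)
    show "AE t in \<sigma>. t \<in> E" unfolding \<sigma>_def using AE_E by (subst AE_density) (auto elim: AE_mp)
  qed
  have I: "(\<integral>z. f z \<partial>\<sigma>) = (\<integral>z. indicator A z / a * f z \<partial>\<mu>)" if "f \<in> borel_measurable borel" for f :: "complex \<Rightarrow> real"
    unfolding \<sigma>_def using a that by (subst integral_density) auto
  \<comment> \<open>This is \<open>\<sigma> \<le> \<mu> / a\<close>. It is applied twice to
    \<open>ln D\<close> minus a kernel or potential, which is nonnegative on \<open>E\<close>; this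
    is how \<open>\<sigma>\<close> inherits finite energy.\<close>
  have Ile: "(\<integral>z. f z \<partial>\<sigma>) \<le> (\<integral>z. f z \<partial>\<mu>) / a"
    if f[measurable]: "f \<in> borel_measurable borel" "integrable \<mu> f" "\<And>z. z \<in> E \<Longrightarrow> 0 \<le> f z" for f
  proof -
    have "(\<integral>z. indicator A z / a * f z \<partial>\<mu>) \<le> (\<integral>z. f z / a \<partial>\<mu>)"
    proof (rule integral_mono_AE)
      have "integrable \<mu> (\<lambda>z. indicator A z *\<^sub>R f z)" using f by (intro integrable_mult_indicator) auto
      then show "integrable \<mu> (\<lambda>z. indicator A z / a * f z)" by simp
      show "AE z in \<mu>. indicator A z / a * f z \<le> f z / a"
        using AE_E by eventually_elim (use f(3) a in \<open>auto simp: indicator_def\<close>)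
    qed (use f in simp)
    then show ?thesis using I[OF f(1)] by simp
  qed
  interpret s: prob_space \<sigma> by (rule prob_measures_onD[OF \<sigma>])
  have "tenergy (eps n) \<sigma> \<sigma> \<le> (ln D + V) / a / a" for n
  proof -
    note i = integrable_tpot[OF bm eps_pos bm_on] integrable_tpot[OF bm_on eps_pos bm_on]
    have p: "ln D - tpot (eps n) \<sigma> z \<le> (ln D - tpot (eps n) \<mu> z) / a" if z: "z \<in> E" for z
    proof -
      have zR: "cmod z \<le> R" using z E_subset by auto
      have "(\<integral>t. ln D - tlog (eps n) (z - t) \<partial>\<sigma>) \<le> (\<integral>t. ln D - tlog (eps n) (z - t) \<partial>\<mu>) / a"
      proof (rule Ile)
        show "integrable \<mu> (\<lambda>t. ln D - tlog (eps n) (z - t))"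
          using integrable_tlog[OF bm eps_pos] by simp
        show "0 \<le> ln D - tlog (eps n) (z - t)" if "t \<in> E" for t
          using tlog_le_lnD[OF zR _ eps_pos eps_le_1, of t] that E_subset by auto
      qed simp
      then show ?thesis
        using integrable_tlog[OF bm eps_pos] integrable_tlog[OF bm_on[OF \<sigma>] eps_pos] prob_space
          s.prob_space by (simp add: tpot_def)
    qed
    have "(\<integral>z. ln D - tpot (eps n) \<sigma> z \<partial>\<sigma>) \<le> (\<integral>z. (ln D - tpot (eps n) \<mu> z) / a \<partial>\<sigma>)"
    proof (rule integral_mono_AE)
      show "integrable \<sigma> (\<lambda>z. ln D - tpot (eps n) \<sigma> z)" "integrable \<sigma> (\<lambda>z. (ln D - tpot (eps n) \<mu> z) / a)"
        using i[OF \<sigma>] \<sigma> by auto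
      show "AE z in \<sigma>. ln D - tpot (eps n) \<sigma> z \<le> (ln D - tpot (eps n) \<mu> z) / a"
        using prob_measures_on_AE[OF \<sigma> closed_E] by eventually_elim (rule p)
    qed
    also have "\<dots> \<le> (\<integral>z. (ln D - tpot (eps n) \<mu> z) / a \<partial>\<mu>) / a"
    proof (rule Ile)
      have [measurable]: "tpot (eps n) \<mu> \<in> borel_measurable borel" by (rule measurable_tpot[OF bm eps_pos])
      show "(\<lambda>z. (ln D - tpot (eps n) \<mu> z) / a) \<in> borel_measurable borel" by measurable
      show "integrable \<mu> (\<lambda>z. (ln D - tpot (eps n) \<mu> z) / a)"
        using integrable_tpot[OF bm eps_pos bm] by auto
      show "0 \<le> (ln D - tpot (eps n) \<mu> z) / a" if "z \<in> E" for z
        using tpot_le_lnD[OF mu_on _ eps_pos eps_le_1, of z n] that E_subset a by auto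
    qed
    also have "\<dots> = (ln D + tenergy (eps n) \<mu> \<mu>) / a / a"
      using integrable_tpot[OF bm eps_pos bm] prob_space by (simp add: tenergy_def)
    also have "\<dots> \<le> (ln D + V) / a / a"
      using energy_le[of n] a by (intro divide_right_mono) auto
    finally show ?thesis
      using i(2)[OF \<sigma> \<sigma>] s.prob_space lnD_nonneg by (simp add: tenergy_def)
  qed
  moreover have "tenergy (eps n) \<mu> \<sigma> \<le> V - \<eta>" for n
  proof -
    have "(\<integral>z. - V + \<eta> \<partial>\<sigma>) \<le> (\<integral>z. tpot (eps n) \<mu> z \<partial>\<sigma>)"
    proof (rule integral_mono_AE)
      show "integrable \<sigma> (\<lambda>z. - V + \<eta>)" by simp
      show "integrable \<sigma> (tpot (eps n) \<mu>)" using integrable_tpot[OF bm eps_pos bm_on[OF \<sigma>]] .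
      have "AE z in \<sigma>. z \<in> A" unfolding \<sigma>_def by (subst AE_density) (auto simp: indicator_def)
      then show "AE z in \<sigma>. - V + \<eta> \<le> tpot (eps n) \<mu> z"
        by eventually_elim (auto simp: A_def)
    qed
    then show ?thesis using s.prob_space by (simp add: tenergy_def)
  qed
  ultimately have "V \<le> V - \<eta>" by (rule variation[OF \<sigma>])
  then show False using assms by simp
qed

text \<open>The energy bound says that the potential has \<open>\<mu>\<close>-mean at least
  \<open>- V\<close>. A value below \<open>- V\<close> at a support point spreads to a neighbourhood
  of positive mass, and since \<open>superlevel_null\<close> allows no excess elsewhere, nothing
  could restore the mean.\<close>

lemma tpot_support_ge:
  assumes z0: "z0 \<in> msupport \<mu>"
  shows "- V \<le> tpot (eps k) \<mu> z0"
proof (rule ccontr)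
  assume "\<not> ?thesis"
  then obtain \<eta> where \<eta>: "0 < \<eta>" "tpot (eps k) \<mu> z0 < - V - \<eta>"
    by (metis add.commute diff_add_cancel dense less_diff_eq linorder_not_less zero_less_diff diff_gt_0_iff_gt minus_diff_eq)
  define U where "U = {z. tpot (eps k) \<mu> z < - V - \<eta>}"
  have oU: "open U" unfolding U_def
    by (intro open_Collect_less continuous_intros continuous_on_tpot[OF bm]) auto
  then obtain d where d: "0 < d" "ball z0 d \<subseteq> U" using \<eta> open_contains_ball[of U] by (auto simp: U_def)
  have [measurable]: "U \<in> sets borel" using oU by simp
  have "0 < emeasure \<mu> (ball z0 d)" using z0 d(1) by (auto simp: msupport_def)
  also have "\<dots> \<le> emeasure \<mu> U" using d(2) by (intro emeasure_mono) auto
  finally have U0: "0 < measure \<mu> U" by (simp add: emeasure_eq_measure)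
  \<comment> \<open>The cut at \<open>- V\<close> supplies a dominating bound; by
    \<open>superlevel_null\<close> the cut potentials tend to \<open>- V\<close> almost
    everywhere.\<close>
  let ?g = "\<lambda>n z. max (- V) (tpot (eps n) \<mu> z)"
  have [measurable]: "tpot (eps n) \<mu> \<in> borel_measurable borel" for n by (rule measurable_tpot[OF bm eps_pos])
  have AE: "AE z in \<mu>. \<forall>m. \<exists>n. tpot (eps n) \<mu> z < - V + eps m"
  proof (rule AE_all_countable[THEN iffD2], rule allI)
    fix m
    have "{z. \<forall>n. - V + eps m \<le> tpot (eps n) \<mu> z} \<in> null_sets \<mu>"
      using superlevel_null[OF eps_pos, of m] by (auto simp: null_sets_def)
    then show "AE z in \<mu>. \<exists>n. tpot (eps n) \<mu> z < - V + eps m"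
      by (rule AE_I') (auto simp: not_less)
  qed
  have "(\<lambda>n. \<integral>z. ?g n z \<partial>\<mu>) \<longlonglongrightarrow> (\<integral>z. - V \<partial>\<mu>)"
  proof (rule integral_dominated_convergence)
    show "integrable \<mu> (\<lambda>z. \<bar>V\<bar> + ln D)" by simp
    show "AE z in \<mu>. norm (?g n z) \<le> \<bar>V\<bar> + ln D" for n
      using AE_E
    proof eventually_elim
      case (elim z)
      then have "tpot (eps n) \<mu> z \<le> ln D"
        using E_subset by (intro tpot_le_lnD[OF mu_on]) auto
      then show ?case using lnD_nonneg by (auto simp: max_def)
    qed
    show "AE z in \<mu>. (\<lambda>n. ?g n z) \<longlonglongrightarrow> - V"
      using AE
    proof eventually_elim
      case (elim z)
      show ?case
      proof (rule LIMSEQ_I)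
        fix r :: real assume "0 < r"
        obtain m where m: "eps m < r" using eps_less_ex[OF \<open>0 < r\<close>] by blast
        obtain n0 where n0: "tpot (eps n0) \<mu> z < - V + eps m" using elim by blast
        have "norm (?g n z - - V) < r" if "n0 \<le> n" for n
          using tpot_mono[OF bm eps_pos eps_antimono[OF that], of z] n0 m \<open>0 < r\<close> by (auto simp: max_def)
        then show "\<exists>no. \<forall>n\<ge>no. norm (?g n z - - V) < r" by blast
      qed
    qed
  qed measurable
  then have "(\<lambda>n. (\<integral>z. ?g n z \<partial>\<mu>) - \<eta> * measure \<mu> U) \<longlonglongrightarrow> - V - \<eta> * measure \<mu> U"
    using prob_space by (auto intro!: tendsto_intros)
  moreover have "- V \<le> (\<integral>z. ?g n z \<partial>\<mu>) - \<eta> * measure \<mu> U" if "k \<le> n" for n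
  proof -
    have ig: "integrable \<mu> (?g n)"
      using integrable_tpot[OF bm eps_pos bm, of n] by (intro Bochner_Integration.integrable_max) auto
    have iU: "integrable \<mu> (\<lambda>z. \<eta> * indicator U z)"
      by (intro integrable_mult_right integrable_real_indicator) (auto simp: less_top[symmetric])
    have "- V \<le> (\<integral>z. tpot (eps n) \<mu> z \<partial>\<mu>)" using energy_le[of n] by (simp add: tenergy_def)
    also have "\<dots> \<le> (\<integral>z. ?g n z - \<eta> * indicator U z \<partial>\<mu>)"
    proof (rule integral_mono)
      show "tpot (eps n) \<mu> z \<le> ?g n z - \<eta> * indicator U z" for z
        using tpot_mono[OF bm eps_pos eps_antimono[OF that], of z] by (auto simp: indicator_def U_def)
    qed (use integrable_tpot[OF bm eps_pos bm] ig iU in auto)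
    also have "\<dots> = (\<integral>z. ?g n z \<partial>\<mu>) - \<eta> * measure \<mu> U"
      using ig iU by simp
    finally show ?thesis .
  qed
  ultimately have "- V \<le> - V - \<eta> * measure \<mu> U" by (intro tendsto_lowerbound) (auto simp: eventually_at_top_linorder intro!: exI[of _ k])
  then show False using U0 \<eta>(1) by (simp add: mult_le_0_iff)
qed

end

text \<open>The infimum is not -\<infinity> because the kernel is at most \<open>ln (2 * R)\<close>
  on \<open>E\<close>, and not \<infinity> because the capacity is positive. A minimising sequence
  has a weak limit attaining it, so the choice operator does pick a minimiser.\<close>

lemma energy_minimiser_exists:
  assumes "compact E" "log_cap E > 0"
  shows "\<exists>V R. energy_minimiser E (equilibrium_measure E) V R \<and> ln (log_cap E) = - V"
proof -
  obtain R where R: "1 \<le> R" "E \<subseteq> cball 0 R" using compact_subset_cball[OF assms(1)] by blast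
  have cl: "closed E" using assms(1) compact_imp_closed by blast
  note bm = prob_measures_on_ball_measure[OF _ cl R(2)]
  have fin: "robin_const E \<noteq> \<infinity>" using assms(2) by (auto simp: log_cap_def)
  have lower: "- ln (2 * R) \<le> A" if \<sigma>: "\<sigma> \<in> prob_measures_on E" "\<And>n. tenergy (eps n) \<sigma> \<sigma> \<le> A" for \<sigma> A
  proof -
    interpret prob_space \<sigma> by (rule prob_measures_onD[OF \<sigma>(1)])
    have "(\<integral>z. tpot 1 \<sigma> z \<partial>\<sigma>) \<le> (\<integral>z. ln (2 * R) \<partial>\<sigma>)"
    proof (rule integral_mono_AE)
      show "integrable \<sigma> (tpot 1 \<sigma>)" using integrable_tpot[OF bm _ bm] \<sigma> by auto
      show "AE z in \<sigma>. tpot 1 \<sigma> z \<le> ln (2 * R)"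
        using prob_measures_on_AE[OF \<sigma>(1) cl]
      proof eventually_elim
        case (elim z)
        have "tlog 1 (z - t) \<le> ln (2 * R)" if "cmod t \<le> R" for t
          using norm_triangle_ineq4[of z t] R elim that by (intro tlog_le) auto
        then show ?case using tpot_le[OF bm[OF \<sigma>(1)], of 1 z "ln (2 * R)"] prob_measures_onD(4)[OF \<sigma>(1)] by simp
      qed
    qed simp
    moreover have "tenergy 1 \<sigma> \<sigma> \<le> A" using \<sigma>(2)[of 0] by (simp add: eps_def)
    ultimately show ?thesis using prob_space by (simp add: tenergy_def)
  qed
  have "ereal (- ln (2 * R)) \<le> log_energy \<sigma>" if "\<sigma> \<in> prob_measures_on E" for \<sigma>
  proof (cases "log_energy \<sigma>")
    case (real r)
    then show ?thesis using lower[OF that, of r] log_energy_le_iff[OF bm[OF that], of r] by simp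
  next
    case MInf
    then show ?thesis using lower[OF that, of "- ln (2 * R) - 1"] log_energy_le_iff[OF bm[OF that], of "- ln (2 * R) - 1"] by simp
  qed simp
  then have "ereal (- ln (2 * R)) \<le> robin_const E" unfolding robin_const_def by (rule INF_greatest)
  with fin obtain V where V: "robin_const E = ereal V" by (cases "robin_const E") auto
  have "\<exists>\<sigma>\<in>prob_measures_on E. log_energy \<sigma> < ereal (V + eps n)" for n
    using V unfolding robin_const_def by (intro INF_less_iff[THEN iffD1]) simp
  then obtain \<sigma> where \<sigma>: "\<And>n. \<sigma> n \<in> prob_measures_on E" "\<And>n. log_energy (\<sigma> n) < ereal (V + eps n)"
    by metis
  have en: "tenergy (eps n) (\<sigma> n) (\<sigma> n) \<le> V + eps n" for n
    using \<sigma> log_energy_le_iff[OF bm[OF \<sigma>(1)[of n]], of "V + eps n"] by (simp add: less_imp_le)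
  have "(\<lambda>n. V + eps n) \<longlonglongrightarrow> V + 0"
    unfolding eps_def using LIMSEQ_inverse_real_of_nat by (intro tendsto_intros) (simp add: inverse_eq_divide add.commute)
  then obtain \<mu>' where \<mu>': "\<mu>' \<in> prob_measures_on E" "\<And>n. tenergy (eps n) \<mu>' \<mu>' \<le> V"
    using energy_lower_semicontinuous[OF assms(1) \<sigma>(1) en] by auto
  have "log_energy \<mu>' \<le> ereal V" using \<mu>' log_energy_le_iff[OF bm[OF \<mu>'(1)]] by simp
  moreover have "ereal V \<le> log_energy \<sigma>" if "\<sigma> \<in> prob_measures_on E" for \<sigma>
    using that V unfolding robin_const_def by (metis INF_lower)
  ultimately have "\<mu>' \<in> prob_measures_on E \<and> log_energy \<mu>' = robin_const E"
    using \<mu>'(1) V by (simp add: antisym)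
  then have "equilibrium_measure E \<in> prob_measures_on E \<and> log_energy (equilibrium_measure E) = robin_const E"
    unfolding equilibrium_measure_def by (rule someI)
  then have eq: "equilibrium_measure E \<in> prob_measures_on E" "log_energy (equilibrium_measure E) \<le> ereal V"
    using V by auto
  have "energy_minimiser E (equilibrium_measure E) V R"
  proof
    show "tenergy (eps n) (equilibrium_measure E) (equilibrium_measure E) \<le> V" for n
      using eq log_energy_le_iff[OF bm[OF eq(1)]] by blast
    show "V \<le> A" if "\<sigma> \<in> prob_measures_on E" "\<And>n. tenergy (eps n) \<sigma> \<sigma> \<le> A" for \<sigma> A
    proof -
      have "log_energy \<sigma> \<le> ereal A" using that log_energy_le_iff[OF bm[OF that(1)]] by blast
      then have "robin_const E \<le> ereal A" unfolding robin_const_def using that(1) by (rule INF_lower2[rotated])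
      then show ?thesis using V by simp
    qed
  qed (use assms R eq in auto)
  moreover have "ln (log_cap E) = - V" using V by (simp add: log_cap_def)
  ultimately show ?thesis by blast
qed

section \<open>The equilibrium potential in the whole plane\<close>

text \<open>By scaling, the loss from level \<open>d / 2\<close> to \<open>e\<close> at
  \<open>a\<close> equals the loss from \<open>d\<close> to \<open>2 * e\<close> at
  \<open>2 * a\<close>; and the loss between fixed levels decreases with the modulus.\<close>

lemma tlog_doubling:
  assumes "cmod b \<le> 2 * cmod a" "0 < e" "e \<le> d / 2"
  shows "tlog (d / 2) a - tlog e a \<le> tlog d b - tlog (2 * e) b"
proof (cases "d / 2 \<le> cmod a")
  case True
  then have "tlog (d / 2) a - tlog e a = 0" using assms by (simp add: tlog_eq_ln)
  moreover have "tlog (2 * e) b \<le> tlog d b" using assms by (intro tlog_mono) auto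
  ultimately show ?thesis by simp
next
  case False
  have m: "0 < max (cmod a) e" using assms by auto
  have "tlog (2 * e) b \<le> ln (2 * max (cmod a) e)"
    unfolding tlog_def using assms by (intro ln_mono) (auto simp: max_def)
  also have "\<dots> = ln 2 + tlog e a" using m by (simp add: ln_mult_pos tlog_def)
  finally have "tlog (2 * e) b \<le> ln 2 + tlog e a" .
  moreover have "tlog (d / 2) a = ln d - ln 2" using False assms by (simp add: tlog_def max_def ln_div)
  moreover have "ln d \<le> tlog d b" using assms by (intro tlog_ge) auto
  ultimately show ?thesis by linarith
qed

context energy_minimiser
begin

lemma tpot_restrict_add:
  assumes [measurable]: "L \<in> sets borel" and "0 < e"
  shows "tpot e \<mu> z = tpot e (density \<mu> (\<lambda>t. ennreal (indicator L t))) z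
     + (\<integral>t. indicator (- L) t * tlog e (z - t) \<partial>\<mu>)" (is "_ = tpot e ?n z + _")
    "integrable \<mu> (\<lambda>t. indicator L t * tlog e (z - t))"
    "integrable \<mu> (\<lambda>t. indicator (- L) t * tlog e (z - t))"
proof -
  note i = integrable_tlog[OF bm assms(2), of z]
  have i1: "integrable \<mu> (\<lambda>t. indicator A t * tlog e (z - t))" if "A \<in> sets borel" for A
    using integrable_mult_indicator[OF _ i, of A] that by simp
  show "integrable \<mu> (\<lambda>t. indicator L t * tlog e (z - t))"
    "integrable \<mu> (\<lambda>t. indicator (- L) t * tlog e (z - t))" by (intro i1; measurable)+
  have "tpot e ?n z = (\<integral>t. indicator L t * tlog e (z - t) \<partial>\<mu>)"
    unfolding tpot_def by (rule restrict_ball_measure(4)[OF bm]) auto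
  moreover have "tpot e \<mu> z = (\<integral>t. indicator L t * tlog e (z - t) + indicator (- L) t * tlog e (z - t) \<partial>\<mu>)"
    unfolding tpot_def by (intro Bochner_Integration.integral_cong) (auto simp: indicator_def)
  ultimately show "tpot e \<mu> z = tpot e ?n z + (\<integral>t. indicator (- L) t * tlog e (z - t) \<partial>\<mu>)"
    using i1[of L] i1[of "- L"] by simp
qed

text \<open>Off a set of small mass the truncations converge uniformly, and for the nearest point
  \<open>z'\<close> of the remaining compact set \<open>L\<close> the inequality \<open>|z' - t| \<le> 2 |z - t|\<close> carries this
  uniformity to all points of the plane; then the minimum principle applies off \<open>L\<close>.\<close>

lemma tpot_ge_neg_V_approx:
  assumes a: "a \<notin> msupport \<mu>" and \<eta>: "0 < \<eta>" "\<eta> \<le> 1/2" and e0: "0 < e0"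
  shows "- V - \<eta> * (ln D + 2 + \<bar>ln (infdist a (msupport \<mu>))\<bar>) \<le> tpot e0 \<mu> a"
proof -
  define S where "S = msupport \<mu>"
  have S: "closed S" "S \<subseteq> E" "AE z in \<mu>. z \<in> S"
    unfolding S_def using closed_msupport AE_msupport msupport_subset[OF mu_on closed_E] by auto
  have S_ne: "S \<noteq> {}" using S(3) by auto
  \<comment> \<open>An Egorov argument with closed sets: on the support the truncated potentials
    decrease and are bounded below by \<open>- V\<close>, so these sets exhaust it.\<close>
  define A where "A N = {z. \<forall>n. tpot (eps N) \<mu> z - tpot (eps n) \<mu> z \<le> \<eta>} \<inter> S" for N
  have Acl: "closed (A N)" for N unfolding A_def
    by (intro closed_Int closed_Collect_all closed_Collect_le continuous_intros continuous_on_tpot[OF bm] S) auto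
  have "(\<lambda>N. measure \<mu> (A N)) \<longlonglongrightarrow> measure \<mu> (\<Union>N. A N)"
  proof (rule finite_Lim_measure_incseq)
    show "range A \<subseteq> sets \<mu>" using Acl by auto
    show "incseq A"
    proof (rule incseq_SucI, rule subsetI)
      fix N z assume z: "z \<in> A N"
      have "tpot (eps (Suc N)) \<mu> z \<le> tpot (eps N) \<mu> z"
        by (intro tpot_mono[OF bm] eps_antimono) auto
      then show "z \<in> A (Suc N)" using z unfolding A_def by (auto intro: order_trans[OF diff_right_mono])
    qed
  qed
  moreover have "measure \<mu> (\<Union>N. A N) = 1"
  proof -
    have sub: "S \<subseteq> (\<Union>N. A N)"
    proof
      fix z assume z: "z \<in> S"
      define x where "x n = tpot (eps n) \<mu> z" for n
      have bdd: "bdd_below (range x)"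
        using tpot_support_ge[of z] z by (auto simp: x_def S_def intro!: bdd_belowI[of _ "- V"])
      obtain N where N: "x N < Inf (range x) + \<eta>"
        using cInf_lessD[of "range x" "Inf (range x) + \<eta>"] \<eta> by auto
      have "x N - x n \<le> \<eta>" for n using N cInf_lower[OF _ bdd, of "x n"] by auto
      then show "z \<in> (\<Union>N. A N)" using z by (auto simp: A_def x_def)
    qed
    have "AE z in \<mu>. z \<in> (\<Union>N. A N)" using S(3) by eventually_elim (rule subsetD[OF sub])
    then show ?thesis using Acl by (intro prob_eq_1[THEN iffD2]) auto
  qed
  ultimately have "(\<lambda>N. measure \<mu> (A N)) \<longlonglongrightarrow> 1" by simp
  then have "\<forall>\<^sub>F N in sequentially. 1 - \<eta> < measure \<mu> (A N)" using \<eta> by (intro order_tendstoD) auto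
  then obtain N where N: "1 - \<eta> < measure \<mu> (A N)" by (auto simp: eventually_at_top_linorder)
  define L where "L = A N"
  define \<delta> where "\<delta> = eps N"
  have Lcl: "closed L" and L[measurable]: "L \<in> sets borel" using Acl by (auto simp: L_def)
  have LS: "L \<subseteq> S" by (auto simp: L_def A_def)
  have mL: "1/2 < measure \<mu> L" using N \<eta> by (simp add: L_def)
  have mLc: "measure \<mu> (- L) \<le> \<eta>" using N prob_compl[of L] L by (simp add: L_def[symmetric] Compl_eq_Diff_UNIV)
  have L_ne: "L \<noteq> {}" using mL by auto
  have LR: "cmod t \<le> R" if "t \<in> L" for t using subsetD[OF E_subset, of t] that LS S(2) by auto
  have \<delta>: "0 < \<delta>" "\<delta> \<le> 1" by (auto simp: \<delta>_def)
  define \<nu> where "\<nu> = density \<mu> (\<lambda>t. ennreal (indicator L t))"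
  have \<nu>: "ball_measure R \<nu>" "AE t in \<nu>. t \<in> L" "measure \<nu> UNIV = measure \<mu> L"
    unfolding \<nu>_def using restrict_ball_measure[OF bm L] by auto
  have \<nu>1: "measure \<nu> UNIV \<le> 1" using \<nu>(3) by simp
  have \<nu>_int: "tpot e \<nu> z = (\<integral>t. indicator L t * tlog e (z - t) \<partial>\<mu>)" for e z
    unfolding \<nu>_def tpot_def by (rule restrict_ball_measure(4)[OF bm L]) auto
  have icL: "(\<integral>t. indicator (- L) t * c \<partial>\<mu>) = measure \<mu> (- L) * c" for c :: real
    by simp
  have iind: "integrable \<mu> (\<lambda>t. indicator (- L) t * c)" for c :: real
    by (intro integrable_mult_left integrable_real_indicator) (auto simp: less_top[symmetric])
  \<comment> \<open>The losses are \<open>\<eta> * ln D\<close> for discarding the mass off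
    \<open>L\<close>, \<eta> for lowering the level from \<open>\<delta> / 2\<close>, and \<eta> for
    moving from a point of \<open>L\<close> to a point within \<rho> of it.\<close>
  define W where "W = V + \<eta> * ln D + 2 * \<eta>"
  define \<rho> where "\<rho> = \<eta> * \<delta> / 2"
  have \<rho>: "0 < \<rho>" using \<eta> \<delta> by (simp add: \<rho>_def)
  have on_L: "- V - \<eta> * ln D \<le> tpot (\<delta> / 2) \<nu> z" if "z \<in> L" for z
  proof -
    have "- V \<le> tpot (\<delta> / 2) \<mu> z"
    proof -
      obtain k where "eps k < \<delta> / 2" using eps_less_ex[of "\<delta> / 2"] \<delta> by auto
      then show ?thesis using tpot_support_ge[of z k] tpot_mono[OF bm eps_pos, of k "\<delta> / 2" z] that LS
        by (auto simp: S_def)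
    qed
    moreover have "(\<integral>t. indicator (- L) t * tlog (\<delta> / 2) (z - t) \<partial>\<mu>) \<le> (\<integral>t. indicator (- L) t * ln D \<partial>\<mu>)"
    proof (rule integral_mono_AE[OF tpot_restrict_add(3)[OF L] iind])
      show "AE t in \<mu>. indicator (- L) t * tlog (\<delta> / 2) (z - t) \<le> indicator (- L) t * ln D"
        using AE_E
      proof eventually_elim
        case (elim t)
        have "tlog (\<delta> / 2) (z - t) \<le> ln D"
          using elim E_subset LR[OF that] \<delta> by (intro tlog_le_lnD) auto
        then show ?case by (auto simp: indicator_def)
      qed
    qed (use \<delta> in simp)
    moreover have "measure \<mu> (- L) * ln D \<le> \<eta> * ln D" using mLc lnD_nonneg by (rule mult_right_mono)
    ultimately show ?thesis
      using tpot_restrict_add(1)[OF L, of "\<delta> / 2" z] \<delta> icL[of "ln D"] by (simp add: \<nu>_def)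
  qed
  have unif: "tpot (\<delta> / 2) \<nu> z - \<eta> \<le> tpot e \<nu> z" if e: "0 < e" "e \<le> \<delta> / 2" for z e
  proof -
    obtain z' where z': "z' \<in> L" "dist z z' = infdist z L"
      using infdist_attains_inf[OF Lcl L_ne, of z] by metis
    obtain n where n: "eps n < 2 * e" using eps_less_ex[of "2 * e"] e by auto
    have n\<delta>: "eps n \<le> \<delta>" using n e by simp
    have pt: "indicator L t * (tlog (\<delta> / 2) (z - t) - tlog e (z - t))
        \<le> tlog \<delta> (z' - t) - tlog (eps n) (z' - t)" for t
    proof (cases "t \<in> L")
      case True
      have "cmod (z' - t) \<le> dist z z' + dist z t"
        using dist_triangle[of z' t z] by (simp add: dist_norm norm_minus_commute)
      also have "\<dots> \<le> 2 * cmod (z - t)" using infdist_le[OF True, of z] z'(2) by (simp add: dist_norm)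
      finally have "tlog (\<delta> / 2) (z - t) - tlog e (z - t) \<le> tlog \<delta> (z' - t) - tlog (2 * e) (z' - t)"
        using e by (intro tlog_doubling) auto
      also have "\<dots> \<le> tlog \<delta> (z' - t) - tlog (eps n) (z' - t)"
        using n by (intro diff_left_mono tlog_mono) auto
      finally show ?thesis using True by simp
    next
      case False
      then show ?thesis using tlog_mono[OF eps_pos n\<delta>, of "z' - t"] by simp
    qed
    have "tpot (\<delta> / 2) \<nu> z - tpot e \<nu> z
        = (\<integral>t. indicator L t * (tlog (\<delta> / 2) (z - t) - tlog e (z - t)) \<partial>\<mu>)"
      unfolding \<nu>_int right_diff_distrib using tpot_restrict_add(2)[OF L] e by simp
    also have "\<dots> \<le> (\<integral>t. tlog \<delta> (z' - t) - tlog (eps n) (z' - t) \<partial>\<mu>)"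
      using pt tpot_restrict_add(2)[OF L] integrable_tlog[OF bm] e \<delta>
      by (intro integral_mono) (auto simp: right_diff_distrib)
    also have "\<dots> = tpot \<delta> \<mu> z' - tpot (eps n) \<mu> z'"
      unfolding tpot_def using integrable_tlog[OF bm] \<delta> by simp
    also have "\<dots> \<le> \<eta>" using z'(1) by (auto simp: L_def A_def \<delta>_def)
    finally show ?thesis by simp
  qed
  have near: "- W \<le> tpot e \<nu> z" if e: "0 < e" "e \<le> \<delta> / 2" and z: "infdist z L \<le> \<rho>" for z e
  proof -
    obtain z' where z': "z' \<in> L" "dist z z' = infdist z L"
      using infdist_attains_inf[OF Lcl L_ne, of z] by metis
    have "\<bar>tpot (\<delta> / 2) \<nu> z - tpot (\<delta> / 2) \<nu> z'\<bar> \<le> cmod (z - z') / (\<delta> / 2) * measure \<nu> UNIV"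
      using \<delta> by (intro tpot_lipschitz[OF \<nu>(1)]) auto
    also have "\<dots> \<le> cmod (z - z') / (\<delta> / 2) * 1"
      using \<nu>1 \<delta> by (intro mult_left_mono) auto
    also have "\<dots> \<le> \<eta>" using z z'(2) \<delta> by (simp add: \<rho>_def dist_norm field_simps)
    finally show ?thesis using on_L[OF z'(1)] unif[OF e, of z] unfolding W_def by linarith
  qed
  define e where "e = min e0 (min (\<delta> / 2) (\<rho> / 2))"
  have e: "0 < e" "e \<le> \<delta> / 2" "e \<le> \<rho> / 2" "e \<le> e0" using e0 \<delta> \<rho> by (auto simp: e_def)
  \<comment> \<open>On the circle of this radius the kernel is at least
    \<open>2 * \<bar>W\<bar>\<close>; as \<nu> has mass above 1/2, its potential there is at least
    \<open>\<bar>W\<bar>\<close>.\<close>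
  define R' where "R' = R + cmod a + exp (2 * \<bar>W\<bar>)"
  have "- tpot e \<nu> a \<le> W"
  proof (rule max_principle[where K = "cball 0 R'" and F = "{z. infdist z L \<le> \<rho> \<or> R' \<le> cmod z}"])
    show "continuous_on (cball 0 R') (\<lambda>z. - tpot e \<nu> z)"
      by (intro continuous_intros continuous_on_tpot[OF \<nu>(1)] e)
    show "a \<in> cball 0 R'" using R_ge_1 by (simp add: R'_def add_nonneg_nonneg)
  next
    fix z assume z: "z \<in> cball 0 R'" "z \<in> {z. infdist z L \<le> \<rho> \<or> R' \<le> cmod z}"
    show "- tpot e \<nu> z \<le> W"
    proof (cases "infdist z L \<le> \<rho>")
      case True then show ?thesis using near[OF e(1,2), of z] by simp
    next
      case False
      with z have zR: "cmod z = R'" by auto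
      have "2 * \<bar>W\<bar> * measure \<nu> UNIV \<le> tpot e \<nu> z"
      proof (rule tpot_ge[OF \<nu>(1) e(1)])
        fix t assume "cmod t \<le> R"
        then have "exp (2 * \<bar>W\<bar>) \<le> cmod (z - t)"
          using norm_triangle_ineq2[of z t] zR norm_ge_zero[of a] unfolding R'_def by linarith
        then have "2 * \<bar>W\<bar> \<le> ln (cmod (z - t))"
          using ln_mono[of "exp (2 * \<bar>W\<bar>)" "cmod (z - t)"] by simp
        also have "\<dots> \<le> tlog e (z - t)"
          using \<open>exp (2 * \<bar>W\<bar>) \<le> cmod (z - t)\<close> e by (intro ln_le_tlog) (auto intro: less_le_trans[OF exp_gt_zero])
        finally show "2 * \<bar>W\<bar> \<le> tlog e (z - t)" .
      qed
      moreover have "2 * \<bar>W\<bar> * (1/2) \<le> 2 * \<bar>W\<bar> * measure \<nu> UNIV"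
        using mL \<nu>(3) by (intro mult_left_mono) auto
      ultimately have "\<bar>W\<bar> \<le> tpot e \<nu> z" by linarith
      then show ?thesis by linarith
    qed
  next
    fix z assume z: "z \<in> cball 0 R'" "z \<notin> {z. infdist z L \<le> \<rho> \<or> R' \<le> cmod z}"
    define r0 where "r0 = min e (R' - cmod z)"
    have r0: "0 < r0" using z e by (auto simp: r0_def)
    have "cball z r \<subseteq> cball 0 R' \<and>
        - tpot e \<nu> z \<le> avg4 (\<lambda>z. - tpot e \<nu> z) z r + measure \<nu> UNIV / e ^ 4 * r ^ 4" if r: "0 < r" "r < r0" for r
    proof
      show "cball z r \<subseteq> cball 0 R'"
        using r by (intro cball_subset_cball_iff[THEN iffD2]) (auto simp: r0_def dist_norm)
      have "AE t in \<nu>. e + r \<le> cmod (z - t)"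
        using \<nu>(2)
      proof eventually_elim
        case (elim t)
        have "\<rho> < cmod (z - t)" using infdist_le[OF elim, of z] z(2) by (auto simp: dist_norm)
        then show ?case using e(3) r by (auto simp: r0_def)
      qed
      from avg4_tpot_le[OF \<nu>(1) r(1) e(1) this]
      show "- tpot e \<nu> z \<le> avg4 (\<lambda>z. - tpot e \<nu> z) z r + measure \<nu> UNIV / e ^ 4 * r ^ 4"
        unfolding avg4_uminus by linarith
    qed
    then show "\<exists>C r0. 0 < r0 \<and> (\<forall>r. 0 < r \<longrightarrow> r < r0 \<longrightarrow> cball z r \<subseteq> cball 0 R' \<and>
        - tpot e \<nu> z \<le> avg4 (\<lambda>z. - tpot e \<nu> z) z r + C * r ^ 4)" using r0 by blast
  qed simp
  \<comment> \<open>The discarded mass is put back: it is at most \<eta>, and \<open>a\<close> has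
    positive distance from the support, which bounds the kernel below.\<close>
  moreover have "- \<eta> * \<bar>ln (infdist a S)\<bar> \<le> (\<integral>t. indicator (- L) t * tlog e (a - t) \<partial>\<mu>)"
  proof -
    have d: "0 < infdist a S"
      using a S(1) S_ne infdist_pos_not_in_closed[of S a] by (auto simp: S_def)
    have "(\<integral>t. indicator (- L) t * (- \<bar>ln (infdist a S)\<bar>) \<partial>\<mu>) \<le> (\<integral>t. indicator (- L) t * tlog e (a - t) \<partial>\<mu>)"
    proof (rule integral_mono_AE[OF iind tpot_restrict_add(3)[OF L e(1)]])
      show "AE t in \<mu>. indicator (- L) t * (- \<bar>ln (infdist a S)\<bar>) \<le> indicator (- L) t * tlog e (a - t)"
        using S(3)
      proof eventually_elim
        case (elim t)
        have le: "infdist a S \<le> cmod (a - t)" using infdist_le[OF elim, of a] by (simp add: dist_norm)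
        then have "ln (infdist a S) \<le> ln (cmod (a - t))" using d by (intro ln_mono) auto
        also have "\<dots> \<le> tlog e (a - t)" using le d e by (intro ln_le_tlog) auto
        finally have "- \<bar>ln (infdist a S)\<bar> \<le> tlog e (a - t)" by linarith
        then show ?case by (auto simp: indicator_def)
      qed
    qed
    moreover have "measure \<mu> (- L) * \<bar>ln (infdist a S)\<bar> \<le> \<eta> * \<bar>ln (infdist a S)\<bar>"
      using mLc by (intro mult_right_mono) auto
    ultimately show ?thesis using icL[of "- \<bar>ln (infdist a S)\<bar>"] by simp
  qed
  ultimately have "- W - \<eta> * \<bar>ln (infdist a S)\<bar> \<le> tpot e \<mu> a"
    using tpot_restrict_add(1)[OF L e(1), of a] by (simp add: \<nu>_def)
  also have "\<dots> \<le> tpot e0 \<mu> a" using e by (intro tpot_mono[OF bm]) auto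
  finally show ?thesis unfolding W_def S_def by (simp add: algebra_simps)
qed

text \<open>The half of Frostman's theorem that holds at every point. Off the support the
  approximate bound has an error of \<eta> times a number depending on \<open>a\<close> alone, and
  \<eta> tends to 0.\<close>

lemma tpot_ge_neg_V:
  assumes "0 < e"
  shows "- V \<le> tpot e \<mu> a"
proof (cases "a \<in> msupport \<mu>")
  case True
  obtain k where "eps k < e" using eps_less_ex[OF assms] by blast
  then show ?thesis using tpot_support_ge[OF True, of k] tpot_mono[OF bm eps_pos, of k e a] by simp
next
  case False
  define c where "c = ln D + 2 + \<bar>ln (infdist a (msupport \<mu>))\<bar>"
  have c: "0 < c" using lnD_nonneg by (simp add: c_def)
  show ?thesis
  proof (rule field_le_epsilon)
    fix x :: real assume x: "0 < x"
    define \<eta> where "\<eta> = min (1/2) (x / c)"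
    have \<eta>: "0 < \<eta>" "\<eta> \<le> 1/2" "\<eta> * c \<le> x" using c x by (auto simp: \<eta>_def min_def field_simps)
    show "- V \<le> tpot e \<mu> a + x"
      using tpot_ge_neg_V_approx[OF False \<eta>(1,2) assms] \<eta>(3) by (simp add: c_def)
  qed
qed

end

section \<open>A Bernstein-Walsh inequality\<close>

lemma log_potential_tendsto:
  assumes "ball_measure R \<nu>"
  shows "(\<lambda>n. ereal (tpot (eps n) \<nu> z)) \<longlonglongrightarrow> log_potential \<nu> z" "log_potential \<nu> z \<noteq> \<infinity>"
proof -
  have "log_potential \<nu> z = (INF n. ereal (tpot (eps n) \<nu> z))"
  proof (rule antisym)
    show "log_potential \<nu> z \<le> (INF n. ereal (tpot (eps n) \<nu> z))"
      by (intro INF_greatest log_potential_le[OF assms])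
    show "(INF n. ereal (tpot (eps n) \<nu> z)) \<le> log_potential \<nu> z"
    proof (cases "INF n. ereal (tpot (eps n) \<nu> z)")
      case (real r)
      then have "ereal r \<le> ereal (tpot (eps n) \<nu> z)" for n by (metis INF_lower UNIV_I)
      then show ?thesis using real log_potential_ge_iff[OF assms, of r z] by simp
    next
      case PInf
      then have "\<infinity> \<le> ereal (tpot (eps 0) \<nu> z)" by (metis INF_lower UNIV_I)
      then show ?thesis by simp
    qed simp
  qed
  moreover have "decseq (\<lambda>n. ereal (tpot (eps n) \<nu> z))"
    by (auto simp: decseq_def intro!: tpot_mono[OF assms] eps_antimono)
  ultimately show "(\<lambda>n. ereal (tpot (eps n) \<nu> z)) \<longlonglongrightarrow> log_potential \<nu> z"
    using LIMSEQ_INF by simp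
  show "log_potential \<nu> z \<noteq> \<infinity>" using log_potential_le[OF assms, of z 0] by auto
qed

text \<open>Addition of extended reals is continuous away from \<infinity> - \<infinity>, and a
  potential of a compactly supported measure never equals \<infinity>; this is carried through the
  induction.\<close>

lemma sum_log_potential_tendsto:
  assumes "\<And>j. j < (m :: nat) \<Longrightarrow> ball_measure R (\<nu> j)"
  shows "(\<lambda>n. ereal (\<Sum>j<m. tpot (eps n) (\<nu> j) z)) \<longlonglongrightarrow> (\<Sum>j<m. log_potential (\<nu> j) z)
    \<and> (\<Sum>j<m. log_potential (\<nu> j) z) \<noteq> \<infinity>"
  using assms
proof (induction m)
  case (Suc m)
  then have IH: "(\<lambda>n. ereal (\<Sum>j<m. tpot (eps n) (\<nu> j) z)) \<longlonglongrightarrow> (\<Sum>j<m. log_potential (\<nu> j) z)"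
    "(\<Sum>j<m. log_potential (\<nu> j) z) \<noteq> \<infinity>" by auto
  note l = log_potential_tendsto[OF Suc.prems[OF lessI], of z]
  have "(\<lambda>n. ereal (\<Sum>j<m. tpot (eps n) (\<nu> j) z) + ereal (tpot (eps n) (\<nu> m) z))
      \<longlonglongrightarrow> (\<Sum>j<m. log_potential (\<nu> j) z) + log_potential (\<nu> m) z"
    using IH l by (intro tendsto_add_ereal_general) auto
  then show ?case using IH(2) l(2) by simp
qed (simp add: zero_ereal_def)

lemma avg4_diff_sum:
  "avg4 (\<lambda>z. (\<Sum>j<(m::nat). f j z) - g z) z r = (\<Sum>j<m. avg4 (f j) z r) - avg4 g z r"
  by (simp add: avg4_def sum.distrib sum_divide_distrib[symmetric] diff_divide_distrib[symmetric])

context energy_minimiser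
begin

text \<open>The difference of the potentials of the family and of \<open>\<mu>\<close> is
  subharmonic off \<open>E\<close>, bounded near \<open>E\<close> by \<open>M\<close> and
  \<open>tpot_ge_neg_V\<close>, and tends to 0 at infinity because both total masses are 1. The
  second claim shows that this value at infinity respects the bound too.\<close>

lemma Bernstein_Walsh:
  assumes \<nu>: "\<And>j. j < (m :: nat) \<Longrightarrow> ball_measure R1 (\<nu> j)" and mass: "(\<Sum>j<m. measure (\<nu> j) UNIV) = 1"
    and le_M: "\<And>z. z \<in> E \<Longrightarrow> (\<Sum>j<m. log_potential (\<nu> j) z) \<le> ereal M"
    and \<eta>: "0 < \<eta>"
  shows "\<exists>e0. 0 < e0 \<and> (\<forall>e a. 0 < e \<longrightarrow> e \<le> e0 \<longrightarrow> (\<Sum>j<m. tpot e (\<nu> j) a) \<le> M + V + \<eta> + tpot e \<mu> a)"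
    and "0 \<le> M + V + \<eta>"
proof -
  define P where "P e z = (\<Sum>j<m. tpot e (\<nu> j) z)" for e z
  have P_mono: "P e z \<le> P e' z" if "0 < e" "e \<le> e'" for e e' z
    unfolding P_def using that \<nu> by (intro sum_mono tpot_mono) auto
  have P_cont: "continuous_on A (P e)" if "0 < e" for e A
    unfolding P_def using that \<nu> by (intro continuous_intros continuous_on_tpot[of R1]) auto
  \<comment> \<open>Dini's argument: the continuous truncations decrease to a limit at most
    \<open>M\<close> on \<open>E\<close>, so one of these open sets contains \<open>E\<close>, and
    even a neighbourhood of it.\<close>
  define U where "U n = {z. P (eps n) z < M + \<eta> / 2}" for n
  have oU: "open (U n)" for n unfolding U_def
    by (intro open_Collect_less P_cont continuous_intros) auto
  have "E \<subseteq> (\<Union>n. U n)"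
  proof
    fix z assume z: "z \<in> E"
    have "(\<Sum>j<m. log_potential (\<nu> j) z) < ereal (M + \<eta> / 2)"
      by (rule order.strict_trans1[OF le_M[OF z]]) (use \<eta> in simp)
    moreover have "(\<lambda>n. ereal (P (eps n) z)) \<longlonglongrightarrow> (\<Sum>j<m. log_potential (\<nu> j) z)"
      unfolding P_def by (rule sum_log_potential_tendsto[of m R1 \<nu> z, THEN conjunct1]) (rule \<nu>)
    ultimately have "\<forall>\<^sub>F n in sequentially. ereal (P (eps n) z) < ereal (M + \<eta> / 2)"
      by (rule order_tendstoD(2)[rotated])
    from eventually_happens'[OF sequentially_bot this] show "z \<in> (\<Union>n. U n)" by (simp add: U_def)
  qed
  with compactE_image[OF compact_E, of UNIV U] oU
  obtain I where I: "finite I" "E \<subseteq> (\<Union>n\<in>I. U n)" by metis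
  define n where "n = Max (insert 0 I)"
  have En: "E \<subseteq> U n"
  proof
    fix z assume "z \<in> E"
    with I(2) have "z \<in> (\<Union>n\<in>I. U n)" by (rule subsetD)
    then obtain k where k: "k \<in> I" "z \<in> U k" by (rule UN_E)
    have "k \<le> n" using k I by (simp add: n_def)
    then show "z \<in> U n" using k P_mono[OF eps_pos eps_antimono[of k n], of z] by (auto simp: U_def)
  qed
  obtain \<rho> where \<rho>: "0 < \<rho>" "(\<Union>x\<in>E. ball x \<rho>) \<subseteq> U n"
    using compact_subset_open_imp_ball_epsilon_subset[OF compact_E oU En] by blast
  define e0 where "e0 = min (eps n) (\<rho> / 2)"
  have e0: "0 < e0" "e0 \<le> eps n" "e0 < \<rho>" using \<rho> by (auto simp: e0_def)
  have near: "P e z \<le> M + \<eta> / 2" if e: "0 < e" "e \<le> e0" and z: "infdist z E \<le> e" for e z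
  proof -
    obtain z' where z': "z' \<in> E" "dist z z' = infdist z E"
      using infdist_attains_inf[OF closed_E E_ne, of z] by metis
    then have "z \<in> ball z' \<rho>" using z e e0 by (auto simp: dist_commute)
    then have "z \<in> U n" using z'(1) by (intro subsetD[OF \<rho>(2)] UN_I)
    then have "P (eps n) z < M + \<eta> / 2" by (simp add: U_def)
    then show ?thesis using P_mono[of e "eps n" z] e e0 by simp
  qed
  \<comment> \<open>Reciprocity: the \<open>\<mu>\<close>-mean of the family's potential is the mean
    of the potential of \<open>\<mu>\<close> over the family, hence at least \<open>- V\<close>; on
    \<open>E\<close> that potential is at most \<open>M + \<eta> / 2\<close>.\<close>
  have MV: "0 \<le> M + V + \<eta> / 2"
  proof -
    have "(\<integral>z. P e0 z \<partial>\<mu>) = (\<Sum>j<m. \<integral>z. tpot e0 (\<nu> j) z \<partial>\<mu>)"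
      unfolding P_def using integrable_tpot[OF \<nu> e0(1) bm] by (intro Bochner_Integration.integral_sum) auto
    also have "\<dots> = (\<Sum>j<m. \<integral>z. tpot e0 \<mu> z \<partial>\<nu> j)"
      using tpot_swap[OF \<nu> e0(1) bm] by (intro sum.cong) auto
    also have "\<dots> \<ge> (\<Sum>j<m. - V * measure (\<nu> j) UNIV)"
    proof (rule sum_mono)
      fix j assume "j \<in> {..<m}"
      then have j: "ball_measure R1 (\<nu> j)" using \<nu> by simp
      interpret n: finite_measure "\<nu> j" using ball_measureD[OF j] by blast
      have "(\<integral>z. - V \<partial>\<nu> j) \<le> (\<integral>z. tpot e0 \<mu> z \<partial>\<nu> j)"
        using tpot_ge_neg_V[OF e0(1)] integrable_tpot[OF bm e0(1) j] by (intro integral_mono) auto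
      then show "- V * measure (\<nu> j) UNIV \<le> (\<integral>z. tpot e0 \<mu> z \<partial>\<nu> j)"
        using ball_measureD(4)[OF j] by (simp add: mult.commute)
    qed
    also have "(\<Sum>j<m. - V * measure (\<nu> j) UNIV) = - V"
      unfolding sum_distrib_left[symmetric] mass by simp
    finally have "- V \<le> (\<integral>z. P e0 z \<partial>\<mu>)" .
    also have "\<dots> \<le> (\<integral>z. M + \<eta> / 2 \<partial>\<mu>)"
    proof (rule integral_mono_AE)
      show "integrable \<mu> (P e0)" unfolding P_def using integrable_tpot[OF \<nu> e0(1) bm] by auto
      show "AE z in \<mu>. P e0 z \<le> M + \<eta> / 2"
        using AE_E by eventually_elim (use near[OF e0(1) order_refl] e0(1) in simp)
    qed simp
    finally show ?thesis using prob_space by simp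
  qed
  then show "0 \<le> M + V + \<eta>" using \<eta> by simp
  have "P e a \<le> M + V + \<eta> + tpot e \<mu> a" if e: "0 < e" "e \<le> e0" for e a
  proof -
    define R2 where "R2 = max R R1"
    have R2: "1 \<le> R2" "R \<le> R2" "R1 \<le> R2" using R_ge_1 by (auto simp: R2_def)
    \<comment> \<open>On this circle all kernels lie between \<open>ln (R' - R2)\<close> and
      \<open>ln (R' + R2)\<close>, which differ by at most \<open>\<eta> / 2\<close>.\<close>
    define R' where "R' = R2 + 4 * R2 / \<eta> + cmod a + 1"
    have R': "R2 < R'" "4 * R2 / \<eta> \<le> R' - R2" "cmod a \<le> R'"
      using R2 \<eta> by (auto simp: R'_def add_nonneg_pos add_pos_nonneg)
    have e1: "e \<le> 1" using e(2) e0(2) eps_le_1[of n] by linarith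
    have "P e a - tpot e \<mu> a \<le> M + V + \<eta>"
    proof (rule max_principle[where K = "cball 0 R'" and F = "{z. infdist z E \<le> e \<or> R' \<le> cmod z}"])
      show "continuous_on (cball 0 R') (\<lambda>z. P e z - tpot e \<mu> z)"
        by (intro continuous_intros continuous_on_tpot[OF bm] P_cont e)
      show "a \<in> cball 0 R'" using R' by simp
    next
      fix z assume z: "z \<in> cball 0 R'" "z \<in> {z. infdist z E \<le> e \<or> R' \<le> cmod z}"
      show "P e z - tpot e \<mu> z \<le> M + V + \<eta>"
      proof (cases "infdist z E \<le> e")
        case True then show ?thesis using near[OF e, of z] tpot_ge_neg_V[OF e(1), of z] \<eta> by simp
      next
        case False
        with z have zR: "cmod z = R'" by auto
        have "tpot e (\<nu> j) z \<le> ln (R' + R2) * measure (\<nu> j) UNIV" if "j < m" for j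
        proof (rule tpot_le[OF \<nu>[OF that] e(1)])
          fix t assume "cmod t \<le> R1"
          then show "tlog e (z - t) \<le> ln (R' + R2)"
            using norm_triangle_ineq4[of z t] zR R2 R' e e1 by (intro tlog_le) auto
        qed
        then have "P e z \<le> (\<Sum>j<m. ln (R' + R2) * measure (\<nu> j) UNIV)"
          unfolding P_def by (intro sum_mono) auto
        then have 1: "P e z \<le> ln (R' + R2)" unfolding sum_distrib_left[symmetric] mass by simp
        have "ln (R' - R2) * measure \<mu> UNIV \<le> tpot e \<mu> z"
        proof (rule tpot_ge[OF bm e(1)])
          fix t assume "cmod t \<le> R"
          then have le: "R' - R2 \<le> cmod (z - t)" using norm_triangle_ineq2[of z t] zR R2 by linarith
          then have "ln (R' - R2) \<le> ln (cmod (z - t))" using R' by (intro ln_mono) auto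
          also have "\<dots> \<le> tlog e (z - t)" using le R' e by (intro ln_le_tlog) auto
          finally show "ln (R' - R2) \<le> tlog e (z - t)" .
        qed
        then have 2: "ln (R' - R2) \<le> tpot e \<mu> z" using prob_space by simp
        have "ln (R' + R2) - ln (R' - R2) \<le> (R' + R2 - (R' - R2)) / (R' - R2)"
          using R' R2 by (intro ln_diff_le) auto
        also have "\<dots> \<le> \<eta> / 2" using R' R2 \<eta> by (simp add: field_simps)
        finally have "P e z - tpot e \<mu> z \<le> \<eta> / 2" using 1 2 by linarith
        then show ?thesis using MV by linarith
      qed
    next
      fix z assume z: "z \<in> cball 0 R'" "z \<notin> {z. infdist z E \<le> e \<or> R' \<le> cmod z}"
      define r0 where "r0 = min (e / 2) (min (infdist z E - e) (R' - cmod z))"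
      have r0: "0 < r0" using z e by (auto simp: r0_def)
      have "cball z r \<subseteq> cball 0 R' \<and> P e z - tpot e \<mu> z
          \<le> avg4 (\<lambda>z. P e z - tpot e \<mu> z) z r + (2 / e ^ 4) * r ^ 4" if r: "0 < r" "r < r0" for r
      proof
        show "cball z r \<subseteq> cball 0 R'"
          using r by (intro cball_subset_cball_iff[THEN iffD2]) (auto simp: r0_def dist_norm)
        have "AE t in \<mu>. e + r \<le> cmod (z - t)"
          using AE_E
        proof eventually_elim
          case (elim t)
          have "infdist z E \<le> cmod (z - t)" using infdist_le[OF elim, of z] by (simp add: dist_norm)
          then show ?case using r by (auto simp: r0_def)
        qed
        from avg4_tpot_le[OF bm r(1) e(1) this]
        have "avg4 (tpot e \<mu>) z r \<le> tpot e \<mu> z + 1 / e ^ 4 * r ^ 4" using prob_space by simp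
        moreover have "P e z \<le> (\<Sum>j<m. avg4 (tpot e (\<nu> j)) z r + measure (\<nu> j) UNIV / e ^ 4 * r ^ 4)"
          unfolding P_def using r by (intro sum_mono avg4_tpot_ge[OF \<nu>]) (auto simp: r0_def)
        moreover have "\<dots> = (\<Sum>j<m. avg4 (tpot e (\<nu> j)) z r) + 1 / e ^ 4 * r ^ 4"
          using mass by (simp add: sum.distrib flip: sum_divide_distrib sum_distrib_right)
        ultimately show "P e z - tpot e \<mu> z
            \<le> avg4 (\<lambda>z. P e z - tpot e \<mu> z) z r + (2 / e ^ 4) * r ^ 4"
          unfolding P_def avg4_diff_sum by simp
      qed
      then show "\<exists>C r0. 0 < r0 \<and> (\<forall>r. 0 < r \<longrightarrow> r < r0 \<longrightarrow> cball z r \<subseteq> cball 0 R' \<and>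
          P e z - tpot e \<mu> z \<le> avg4 (\<lambda>z. P e z - tpot e \<mu> z) z r + C * r ^ 4)" using r0 by blast
    qed simp
    then show ?thesis by simp
  qed
  then show "\<exists>e0. 0 < e0 \<and> (\<forall>e a. 0 < e \<longrightarrow> e \<le> e0 \<longrightarrow> (\<Sum>j<m. tpot e (\<nu> j) a) \<le> M + V + \<eta> + tpot e \<mu> a)"
    unfolding P_def using e0(1) by blast
qed

end

section \<open>The supremum of a potential is reached on the frontier\<close>

lemma frontier_nonempty:
  assumes "compact (E :: complex set)" "E \<noteq> {}"
  shows "frontier E \<noteq> {}"
proof
  assume "frontier E = {}"
  then have "E = UNIV" using assms(2) by (simp add: frontier_eq_empty)
  then show False using assms(1) not_compact_UNIV by blast
qed

lemma frontier_subset_compact: "compact (E :: complex set) \<Longrightarrow> frontier E \<subseteq> E"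
  by (rule frontier_subset_closed[OF compact_imp_closed])

lemma tpot_max_frontier:
  assumes "compact E" "E \<noteq> {}" "ball_measure R \<nu>" "0 < e"
  shows "\<exists>c\<in>frontier E. \<forall>z\<in>E. tpot e \<nu> z \<le> tpot e \<nu> c"
proof -
  have "compact (frontier E)" using assms(1) by (rule compact_frontier)
  from continuous_attains_sup[OF this frontier_nonempty[OF assms(1,2)] continuous_on_tpot[OF assms(3,4)]]
  obtain c where c: "c \<in> frontier E" "\<And>w. w \<in> frontier E \<Longrightarrow> tpot e \<nu> w \<le> tpot e \<nu> c" by blast
  have "tpot e \<nu> z \<le> tpot e \<nu> c" if "z \<in> E" for z
  proof (rule max_principle[where F = "frontier E"])
    show "compact E" "continuous_on E (tpot e \<nu>)" "z \<in> E" by (fact assms that continuous_on_tpot[OF assms(3,4)])+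
    fix w assume w: "w \<in> E" "w \<notin> frontier E"
    then have "w \<in> interior E" using compact_imp_closed[OF assms(1)] by (auto simp: frontier_def)
    then obtain d where d: "0 < d" "cball w d \<subseteq> E" using mem_interior_cball by blast
    have "cball w r \<subseteq> E \<and> tpot e \<nu> w \<le> avg4 (tpot e \<nu>) w r + measure \<nu> UNIV / e ^ 4 * r ^ 4"
      if "0 < r" "r < min d (e / 2)" for r
    proof
      have "cball w r \<subseteq> cball w d" using that by (intro subset_cball) auto
      then show "cball w r \<subseteq> E" using d by blast
      show "tpot e \<nu> w \<le> avg4 (tpot e \<nu>) w r + measure \<nu> UNIV / e ^ 4 * r ^ 4"
        using that by (intro avg4_tpot_ge[OF assms(3)]) auto
    qed
    moreover have "0 < min d (e / 2)" using d assms(4) by simp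
    ultimately show "\<exists>C r0. 0 < r0 \<and> (\<forall>r. 0 < r \<longrightarrow> r < r0 \<longrightarrow> cball w r \<subseteq> E \<and>
       tpot e \<nu> w \<le> avg4 (tpot e \<nu>) w r + C * r ^ 4)" by blast
  qed (rule c(2))
  with c(1) show ?thesis by blast
qed

text \<open>A limit point of the frontier maximisers of the truncations serves all levels at once:
  from some index on, the truncation used lies below the one at level \<open>k\<close>, which is
  continuous and passes to the limit.\<close>

lemma log_potential_max_frontier:
  assumes "compact E" "E \<noteq> {}" "ball_measure R \<nu>"
  shows "\<exists>c\<in>frontier E. \<forall>k. \<forall>z\<in>E. log_potential \<nu> z \<le> ereal (tpot (eps k) \<nu> c)"
proof -
  have "\<exists>c\<in>frontier E. \<forall>z\<in>E. tpot (eps n) \<nu> z \<le> tpot (eps n) \<nu> c" for n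
    by (rule tpot_max_frontier[OF assms eps_pos])
  then obtain c where c: "\<And>n. c n \<in> frontier E" "\<And>n z. z \<in> E \<Longrightarrow> tpot (eps n) \<nu> z \<le> tpot (eps n) \<nu> (c n)"
    by metis
  have "seq_compact (frontier E)" using compact_frontier[OF assms(1)] by (rule compact_imp_seq_compact)
  then obtain l r where l: "l \<in> frontier E" "strict_mono (r :: nat \<Rightarrow> nat)" "(c \<circ> r) \<longlonglongrightarrow> l"
    using c(1) unfolding seq_compact_def by metis
  have "log_potential \<nu> z \<le> ereal (tpot (eps k) \<nu> l)" if z: "z \<in> E" for k z
  proof (rule tendsto_lowerbound)
    have "isCont (tpot (eps k) \<nu>) l"
      using continuous_on_tpot[OF assms(3) eps_pos, of UNIV k] by (simp add: continuous_on_eq_continuous_at)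
    then show "(\<lambda>n. ereal (tpot (eps k) \<nu> ((c \<circ> r) n))) \<longlonglongrightarrow> ereal (tpot (eps k) \<nu> l)"
      using l(3) by (intro tendsto_ereal) (rule isCont_tendsto_compose)
    show "\<forall>\<^sub>F n in sequentially. log_potential \<nu> z \<le> ereal (tpot (eps k) \<nu> ((c \<circ> r) n))"
      using eventually_ge_at_top[of k]
    proof eventually_elim
      case (elim n)
      have "k \<le> r n" using elim seq_suble[OF l(2), of n] by simp
      have "log_potential \<nu> z \<le> ereal (tpot (eps (r n)) \<nu> z)" by (rule log_potential_le[OF assms(3)])
      also have "\<dots> \<le> ereal (tpot (eps (r n)) \<nu> (c (r n)))" using c(2)[OF z] by simp
      also have "\<dots> \<le> ereal (tpot (eps k) \<nu> (c (r n)))"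
        using tpot_mono[OF assms(3) eps_pos eps_antimono[OF \<open>k \<le> r n\<close>]] by simp
      finally show ?case by simp
    qed
  qed simp
  with l(1) show ?thesis by blast
qed

section \<open>The logarithm of the farthest distance to finitely many points\<close>

definition fdist :: "complex set \<Rightarrow> complex \<Rightarrow> real" where
  "fdist C z = Max ((\<lambda>c. cmod (z - c)) ` C)"

lemma fdist_ge: "finite C \<Longrightarrow> c \<in> C \<Longrightarrow> cmod (z - c) \<le> fdist C z"
  by (simp add: fdist_def)

lemma fdist_attained:
  assumes "finite C" "C \<noteq> {}"
  obtains c where "c \<in> C" "fdist C z = cmod (z - c)"
proof -
  have "fdist C z \<in> (\<lambda>c. cmod (z - c)) ` C" unfolding fdist_def using assms by (intro Max_in) auto
  then show ?thesis using that by blast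
qed

lemma fdist_leI: "finite C \<Longrightarrow> C \<noteq> {} \<Longrightarrow> (\<And>c. c \<in> C \<Longrightarrow> cmod (z - c) \<le> B) \<Longrightarrow> fdist C z \<le> B"
  by (simp add: fdist_def)

lemma fdist_le_add:
  assumes "finite C" "C \<noteq> {}"
  shows "fdist C z \<le> fdist C w + cmod (z - w)"
proof (rule fdist_leI[OF assms])
  fix c assume "c \<in> C"
  then show "cmod (z - c) \<le> fdist C w + cmod (z - w)"
    using fdist_ge[OF assms(1), of c w] norm_triangle_ineq[of "z - w" "w - c"] by simp
qed

lemma fdist_lipschitz:
  assumes "finite C" "C \<noteq> {}"
  shows "\<bar>fdist C z - fdist C w\<bar> \<le> cmod (z - w)"
  using fdist_le_add[OF assms, of z w] fdist_le_add[OF assms, of w z] by (simp add: norm_minus_commute)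

lemma continuous_on_fdist [continuous_intros]:
  assumes "finite C" "C \<noteq> {}"
  shows "continuous_on A (fdist C)"
proof -
  have "1-lipschitz_on A (fdist C)"
    using fdist_lipschitz[OF assms] by (intro lipschitz_onI) (auto simp: dist_norm)
  then show ?thesis by (rule lipschitz_on_continuous_on)
qed

lemma fdist_ge_half:
  assumes "finite C" "a \<in> C" "b \<in> C"
  shows "cmod (a - b) / 2 \<le> fdist C z"
  using fdist_ge[OF assms(1,2), of z] fdist_ge[OF assms(1,3), of z] norm_triangle_ineq4[of "z - b" "z - a"]
  by simp

text \<open>Two distinct points keep \<open>fdist C\<close> above half their distance, so that
  \<open>ln (fdist C z)\<close> is Lipschitz on the plane and has no pole.\<close>

locale two_points =
  fixes C :: "complex set" and a b :: complex
  assumes finite_C: "finite C" and a: "a \<in> C" and b: "b \<in> C" and a_neq_b: "a \<noteq> b"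
begin

definition \<kappa> :: real where "\<kappa> = cmod (a - b) / 2"

lemma \<kappa>_pos: "0 < \<kappa>" using a_neq_b by (simp add: \<kappa>_def)

lemma C_ne: "C \<noteq> {}" using a by blast

lemma fdist_ge_\<kappa>: "\<kappa> \<le> fdist C z"
  unfolding \<kappa>_def by (rule fdist_ge_half[OF finite_C a b])

lemma fdist_pos: "0 < fdist C z" using fdist_ge_\<kappa>[of z] \<kappa>_pos by linarith

lemma continuous_on_ln_fdist: "continuous_on A (\<lambda>z. ln (fdist C z))"
  using fdist_pos by (intro continuous_on_ln continuous_on_fdist[OF finite_C C_ne]) (auto simp: less_imp_neq[symmetric])

lemma ln_fdist_lipschitz: "\<bar>ln (fdist C z) - ln (fdist C w)\<bar> \<le> cmod (z - w) / \<kappa>"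
proof -
  have "\<bar>ln (fdist C z) - ln (fdist C w)\<bar> \<le> \<bar>fdist C z - fdist C w\<bar> / \<kappa>"
    by (intro ln_diff_le_divide \<kappa>_pos fdist_ge_\<kappa>)
  also have "\<dots> \<le> cmod (z - w) / \<kappa>"
    using fdist_lipschitz[OF finite_C C_ne] \<kappa>_pos by (intro divide_right_mono) auto
  finally show ?thesis .
qed

lemma integrable_ln_fdist: "ball_measure R \<nu> \<Longrightarrow> integrable \<nu> (\<lambda>z. ln (fdist C z))"
  by (rule integrable_continuous_ball_measure[OF _ continuous_on_ln_fdist])

lemma card_C_pos: "0 < card C" using finite_C C_ne by (simp add: card_gt_0_iff)

text \<open>As \<open>n\<close> grows, the \<open>n\<close>-th root of the modulus of the power sum
  approaches \<open>fdist C z\<close> off the set of ties, so the normalised counting measures of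
  these zeros approximate the Riesz measure of \<open>ln (fdist C z)\<close>.\<close>

definition is_roots :: "nat \<Rightarrow> (nat \<Rightarrow> complex) \<Rightarrow> bool" where
  "is_roots n r \<longleftrightarrow> (\<forall>z. (\<Sum>c\<in>C. (z - c) ^ n) = of_nat (card C) * (\<Prod>i<n. z - r i))"

lemma is_roots_exists: "\<exists>r. is_roots n r"
proof -
  define p where "p = (\<Sum>c\<in>C. [:- c, 1:] ^ n)"
  have dp: "degree ([:- c, 1:] ^ n) = n" for c :: complex by (simp add: degree_power_eq)
  have lc: "coeff ([:- c, 1:] ^ n) n = 1" for c :: complex
    using lead_coeff_power[of "[:- c, 1:]" n] dp[of c] by simp
  have co: "coeff p n = of_nat (card C)" unfolding p_def coeff_sum lc by simp
  have "degree p \<le> n" unfolding p_def by (rule degree_sum_le[OF finite_C]) (simp add: dp)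
  moreover have "n \<le> degree p" using co card_C_pos by (intro le_degree) auto
  ultimately have d: "degree p = n" by simp
  obtain r where r: "smult (lead_coeff p) (\<Prod>i<degree p. [:- r i, 1:]) = p"
    using complex_poly_decompose' by blast
  have "(\<Sum>c\<in>C. (z - c) ^ n) = of_nat (card C) * (\<Prod>i<n. z - r i)" for z
  proof -
    have "(\<Sum>c\<in>C. (z - c) ^ n) = poly p z"
      unfolding p_def poly_sum poly_power by simp
    also have "\<dots> = poly (smult (lead_coeff p) (\<Prod>i<degree p. [:- r i, 1:])) z" by (simp only: r)
    also have "\<dots> = of_nat (card C) * (\<Prod>i<n. z - r i)" by (simp add: d co poly_prod)
    finally show ?thesis .
  qed
  then show ?thesis unfolding is_roots_def by blast
qed

lemma norm_prod_roots_le: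
  assumes "is_roots n r"
  shows "(\<Prod>i<n. cmod (w - r i)) \<le> fdist C w ^ n"
proof -
  have "real (card C) * (\<Prod>i<n. cmod (w - r i)) = cmod (\<Sum>c\<in>C. (w - c) ^ n)"
    using assms by (simp add: is_roots_def norm_mult prod_norm)
  also have "\<dots> \<le> (\<Sum>c\<in>C. fdist C w ^ n)"
    using fdist_ge[OF finite_C] by (intro sum_norm_le) (auto simp: norm_power intro!: power_mono)
  finally show ?thesis using card_C_pos by simp
qed

text \<open>Jensen's inequality: reflecting the zeros in the disc changes no modulus on its boundary
  and turns the value at the centre into the product of the truncated distances.\<close>

lemma sum_tlog_roots_le:
  assumes r: "is_roots n r" and e: "0 < e"
  shows "(\<Sum>i<n. tlog e (z - r i)) \<le> real n * ln (fdist C z + e)"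
proof -
  define \<beta> where "\<beta> i w = (if cmod (z - r i) < e
      then (of_real (e\<^sup>2) - cnj (r i - z) * (w - z)) / of_real e else w - r i)" for i w
  have \<beta>_bd: "cmod (\<beta> i w) = cmod (w - r i)" if "cmod (w - z) = e" for i w
  proof (cases "cmod (z - r i) < e")
    case True
    have "of_real (e\<^sup>2) = (w - z) * cnj (w - z)"
      using that complex_norm_square[of "w - z"] by simp
    then have "of_real (e\<^sup>2) - cnj (r i - z) * (w - z) = (w - z) * cnj (w - r i)"
      by (simp add: algebra_simps)
    moreover have "cmod (cnj (w - r i)) = cmod (w - r i)" by (rule complex_mod_cnj)
    ultimately have "cmod (of_real (e\<^sup>2) - cnj (r i - z) * (w - z)) = e * cmod (w - r i)"
      using that by (simp only: norm_mult)
    then show ?thesis using True e by (simp add: \<beta>_def norm_divide)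
  next
    case False then show ?thesis by (simp add: \<beta>_def)
  qed
  have \<beta>_z: "cmod (\<beta> i z) = max (cmod (z - r i)) e" for i
    using e by (auto simp: \<beta>_def norm_divide power2_eq_square)
  have "cmod (\<Prod>i<n. \<beta> i z) \<le> (fdist C z + e) ^ n"
  proof (rule maximum_modulus_frontier[where S = "cball z e" and f = "\<lambda>w. \<Prod>i<n. \<beta> i w" and \<xi> = z])
    have hol: "(\<lambda>w. \<Prod>i<n. \<beta> i w) holomorphic_on A" for A
    proof (rule holomorphic_on_prod)
      show "\<beta> i holomorphic_on A" for i
        using e by (cases "cmod (z - r i) < e") (auto simp: \<beta>_def[abs_def] intro!: holomorphic_intros)
    qed
    show "(\<lambda>w. \<Prod>i<n. \<beta> i w) holomorphic_on interior (cball z e)" by (rule hol)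
    show "continuous_on (closure (cball z e)) (\<lambda>w. \<Prod>i<n. \<beta> i w)"
      by (rule holomorphic_on_imp_continuous_on[OF hol])
    show "z \<in> cball z e" using e by simp
    fix w assume "w \<in> frontier (cball z e)"
    then have w: "cmod (w - z) = e" using e by (simp add: dist_norm norm_minus_commute)
    have "cmod (\<Prod>i<n. \<beta> i w) = (\<Prod>i<n. cmod (w - r i))" unfolding prod_norm[symmetric] \<beta>_bd[OF w] ..
    also have "\<dots> \<le> fdist C w ^ n" by (rule norm_prod_roots_le[OF r])
    also have "\<dots> \<le> (fdist C z + e) ^ n"
      using fdist_le_add[OF finite_C C_ne, of w z] w fdist_pos[of w] by (intro power_mono) auto
    finally show "cmod (\<Prod>i<n. \<beta> i w) \<le> (fdist C z + e) ^ n" .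
  qed simp
  then have *: "(\<Prod>i<n. max (cmod (z - r i)) e) \<le> (fdist C z + e) ^ n"
    unfolding prod_norm[symmetric] \<beta>_z .
  have pos: "0 < max (cmod (z - r i)) e" for i using e by auto
  have "(\<Sum>i<n. tlog e (z - r i)) = ln (\<Prod>i<n. max (cmod (z - r i)) e)"
    unfolding tlog_def using pos by (subst ln_prod) (auto simp: less_imp_neq[symmetric])
  also have "\<dots> \<le> ln ((fdist C z + e) ^ n)"
    using * pos by (intro ln_mono prod_pos) auto
  also have "\<dots> = real n * ln (fdist C z + e)"
    using fdist_pos[of z] e by (simp add: ln_realpow)
  finally show ?thesis .
qed

text \<open>Moving away from a farthest point \<open>c\<close> along the ray from \<open>c\<close>
  through \<open>z\<close> adds the full \<open>s\<close> to the distance from \<open>c\<close>.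
  Another point could keep up only with equality in the triangle inequality, which forces it to be
  \<open>c\<close>.\<close>

lemma dominating_point_nearby:
  assumes "0 < s"
  shows "\<exists>w c. cmod (w - z) = s \<and> c \<in> C \<and> (\<forall>c'\<in>C - {c}. cmod (w - c') < cmod (w - c))"
proof -
  obtain c where c: "c \<in> C" "fdist C z = cmod (z - c)" using fdist_attained[OF finite_C C_ne] by blast
  define l where "l = cmod (z - c)"
  have l: "0 < l" using fdist_pos[of z] c by (simp add: l_def)
  define y where "y = (s / l) *\<^sub>R (z - c)"
  have ny: "cmod y = s" using l assms by (simp add: y_def l_def)
  have "z + y - c = (1 + s / l) *\<^sub>R (z - c)" by (simp add: y_def scaleR_left_distrib algebra_simps)
  then have "cmod (z + y - c) = \<bar>1 + s / l\<bar> * l" by (simp only: norm_scaleR l_def)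
  also have "\<dots> = l + s" using l assms by (simp add: distrib_right)
  finally have wc: "cmod (z + y - c) = l + s" .
  have "cmod (z + y - c') < cmod (z + y - c)" if c': "c' \<in> C - {c}" for c'
  proof (rule ccontr)
    assume "\<not> ?thesis"
    then have ge: "l + s \<le> cmod (z + y - c')" using wc by simp
    have le1: "cmod (z - c') \<le> l" using fdist_ge[OF finite_C, of c' z] c' c by (simp add: l_def)
    have le2: "cmod ((z - c') + y) \<le> cmod (z - c') + s" using norm_triangle_ineq[of "z - c'" y] ny by simp
    have eq: "(z - c') + y = z + y - c'" by simp
    have n1: "cmod (z - c') = l" and n2: "cmod ((z - c') + y) = cmod (z - c') + cmod y"
      using ge le1 le2 ny unfolding eq by linarith+
    have "cmod (z - c') *\<^sub>R y = cmod y *\<^sub>R (z - c')" using n2 by (simp add: norm_triangle_eq)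
    moreover have "l *\<^sub>R y = s *\<^sub>R (z - c)" using l by (simp add: y_def)
    ultimately have "s *\<^sub>R (z - c) = s *\<^sub>R (z - c')" unfolding n1 ny by simp
    then show False using assms c' by simp
  qed
  then show ?thesis using c(1) ny by (intro exI[of _ "z + y"] exI[of _ c]) auto
qed

text \<open>With a strictly farthest point, its power outgrows the others geometrically. The lost
  factor 2 disappears after taking \<open>n\<close>-th roots.\<close>

lemma eventually_no_cancellation:
  assumes c: "c \<in> C" and dom: "\<And>c'. c' \<in> C - {c} \<Longrightarrow> cmod (w - c') < cmod (w - c)"
  shows "\<forall>\<^sub>F n in sequentially. fdist C w ^ n \<le> 2 * cmod (\<Sum>c\<in>C. (w - c) ^ n)"
proof -
  have fd: "fdist C w = cmod (w - c)"
  proof (rule antisym)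
    show "fdist C w \<le> cmod (w - c)" using dom by (intro fdist_leI finite_C C_ne) (metis DiffI less_imp_le order_refl singletonD)
    show "cmod (w - c) \<le> fdist C w" by (rule fdist_ge[OF finite_C c])
  qed
  have l: "0 < cmod (w - c)" using fdist_pos[of w] fd by simp
  have "(\<lambda>n. \<Sum>c'\<in>C - {c}. (cmod (w - c') / cmod (w - c)) ^ n) \<longlonglongrightarrow> (\<Sum>c'\<in>C - {c}. 0)"
    using l dom by (intro tendsto_sum LIMSEQ_realpow_zero) auto
  then have "\<forall>\<^sub>F n in sequentially. (\<Sum>c'\<in>C - {c}. (cmod (w - c') / cmod (w - c)) ^ n) < 1/2"
    by (intro order_tendstoD(2)[where y = 0]) auto
  then show ?thesis
  proof eventually_elim
    case (elim n)
    have "(\<Sum>c'\<in>C - {c}. (cmod (w - c')) ^ n)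
        = (\<Sum>c'\<in>C - {c}. (cmod (w - c') / cmod (w - c)) ^ n) * cmod (w - c) ^ n"
      using l by (simp add: sum_distrib_right power_divide)
    also have "\<dots> \<le> 1/2 * cmod (w - c) ^ n" using elim by (intro mult_right_mono) auto
    finally have "(\<Sum>c'\<in>C - {c}. (cmod (w - c')) ^ n) \<le> cmod (w - c) ^ n / 2" by simp
    moreover have "cmod (\<Sum>c'\<in>C - {c}. (w - c') ^ n) \<le> (\<Sum>c'\<in>C - {c}. (cmod (w - c')) ^ n)"
      by (intro sum_norm_le) (simp add: norm_power)
    moreover have "(\<Sum>c\<in>C. (w - c) ^ n) = (w - c) ^ n + (\<Sum>c'\<in>C - {c}. (w - c') ^ n)"
      using finite_C c by (rule sum.remove)
    moreover have "cmod ((w - c) ^ n) - cmod (\<Sum>c'\<in>C - {c}. (w - c') ^ n)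
        \<le> cmod ((w - c) ^ n + (\<Sum>c'\<in>C - {c}. (w - c') ^ n))" by (rule norm_diff_ineq)
    ultimately show ?case by (simp add: fd norm_power)
  qed
qed

text \<open>Cancellation in the power sum may spoil the bound at \<open>z\<close> itself, so it is
  taken at the nearby \<open>w\<close> and transported by the Lipschitz estimate for the truncated
  kernel.\<close>

lemma sum_tlog_roots_ge_pointwise:
  assumes r: "is_roots n r" and e: "0 < e" and "cmod (w - z) \<le> \<rho>"
    and Q: "fdist C w ^ n \<le> 2 * cmod (\<Sum>c\<in>C. (w - c) ^ n)"
  shows "real n * ln (fdist C w) - ln (2 * real (card C)) - real n * (\<rho> / e) \<le> (\<Sum>i<n. tlog e (z - r i))"
proof -
  have fp: "0 < fdist C w ^ n" using fdist_pos by simp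
  have Qr: "cmod (\<Sum>c\<in>C. (w - c) ^ n) = real (card C) * (\<Prod>i<n. cmod (w - r i))"
    using r by (simp add: is_roots_def norm_mult prod_norm)
  then have P: "fdist C w ^ n \<le> 2 * real (card C) * (\<Prod>i<n. cmod (w - r i))" using Q by simp
  have P0: "(\<Prod>i<n. cmod (w - r i)) \<noteq> 0"
  proof
    assume 0: "(\<Prod>i<n. cmod (w - r i)) = 0"
    show False using P fp unfolding 0 by simp
  qed
  moreover have "0 \<le> (\<Prod>i<n. cmod (w - r i))" by (intro prod_nonneg) auto
  ultimately have Pp: "0 < (\<Prod>i<n. cmod (w - r i))" by linarith
  have nz: "cmod (w - r i) \<noteq> 0" if "i < n" for i using P0 that by (auto simp: prod_zero_iff)
  have "real n * ln (fdist C w) = ln (fdist C w ^ n)" using fdist_pos by (simp add: ln_realpow)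
  also have "\<dots> \<le> ln (2 * real (card C) * (\<Prod>i<n. cmod (w - r i)))" using P fp by (intro ln_mono)
  also have "\<dots> = ln (2 * real (card C)) + ln (\<Prod>i<n. cmod (w - r i))"
    using card_C_pos Pp by (intro ln_mult_pos) auto
  also have "ln (\<Prod>i<n. cmod (w - r i)) = (\<Sum>i<n. ln (cmod (w - r i)))"
    using nz by (intro ln_prod) auto
  also have "\<dots> \<le> (\<Sum>i<n. tlog e (z - r i) + \<rho> / e)"
  proof (rule sum_mono)
    fix i assume "i \<in> {..<n}"
    then have p: "0 < cmod (w - r i)" using nz by simp
    have "\<bar>tlog e (w - r i) - tlog e (z - r i)\<bar> \<le> cmod (w - r i - (z - r i)) / e"
      by (rule tlog_lipschitz[OF e])
    also have "\<dots> \<le> \<rho> / e" using assms(3) e by (intro divide_right_mono) auto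
    finally show "ln (cmod (w - r i)) \<le> tlog e (z - r i) + \<rho> / e"
      using ln_le_tlog[OF e p] by linarith
  qed
  also have "\<dots> = (\<Sum>i<n. tlog e (z - r i)) + real n * (\<rho> / e)" by (simp add: sum.distrib)
  finally show ?thesis by simp
qed

text \<open>A finite net reduces the choice of good points to finitely many, which gives one
  \<open>N\<close> for all of \<open>K\<close>. Per zero the costs are
  \<open>ln (2 * real (card C)) / n\<close>, \<open>\<rho> / e\<close> and
  \<open>\<rho> / \<kappa>\<close>, each at most \<open>\<eta> / 3\<close>.\<close>

lemma sum_tlog_roots_ge:
  assumes "compact K" "0 < e" "0 < \<eta>"
  shows "\<exists>N>0. \<forall>n\<ge>N. \<forall>r. is_roots n r \<longrightarrow> (\<forall>z\<in>K. real n * (ln (fdist C z) - \<eta>) \<le> (\<Sum>i<n. tlog e (z - r i)))"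
proof -
  define \<rho> where "\<rho> = min (e * \<eta> / 3) (\<kappa> * \<eta> / 3)"
  have \<rho>1: "0 < \<rho>" "\<rho> \<le> e * \<eta> / 3" "\<rho> \<le> \<kappa> * \<eta> / 3"
    using assms \<kappa>_pos by (auto simp: \<rho>_def)
  have \<rho>: "0 < \<rho>" "\<rho> / e \<le> \<eta> / 3" "\<rho> / \<kappa> \<le> \<eta> / 3"
    using \<rho>1 assms(2) \<kappa>_pos by (simp_all add: pos_divide_le_eq mult.commute)
  have "\<forall>e>0. \<exists>k. finite k \<and> K \<subseteq> (\<Union>x\<in>k. ball x e)"
    using assms(1) unfolding compact_eq_totally_bounded by (rule conjunct2)
  then obtain F where F: "finite F" "K \<subseteq> (\<Union>x\<in>F. ball x (\<rho> / 2))"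
    using \<rho>(1) by (elim allE[of _ "\<rho> / 2"]) auto
  have "\<exists>w. cmod (w - x) = \<rho> / 2 \<and> (\<forall>\<^sub>F n in sequentially. fdist C w ^ n \<le> 2 * cmod (\<Sum>c\<in>C. (w - c) ^ n))" for x
  proof -
    obtain w c where "cmod (w - x) = \<rho> / 2" "c \<in> C" "\<forall>c'\<in>C - {c}. cmod (w - c') < cmod (w - c)"
      using dominating_point_nearby[of "\<rho> / 2" x] \<rho>(1) by auto
    then show ?thesis using eventually_no_cancellation[of c w] by blast
  qed
  then obtain w where w: "\<And>x. cmod (w x - x) = \<rho> / 2"
    "\<And>x. \<forall>\<^sub>F n in sequentially. fdist C (w x) ^ n \<le> 2 * cmod (\<Sum>c\<in>C. (w x - c) ^ n)" by metis
  have "\<forall>\<^sub>F n in sequentially. \<forall>x\<in>F. fdist C (w x) ^ n \<le> 2 * cmod (\<Sum>c\<in>C. (w x - c) ^ n)"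
    using F(1) w(2) by (intro eventually_ball_finite) auto
  then obtain N0 where N0: "\<And>n x. N0 \<le> n \<Longrightarrow> x \<in> F \<Longrightarrow> fdist C (w x) ^ n \<le> 2 * cmod (\<Sum>c\<in>C. (w x - c) ^ n)"
    unfolding eventually_at_top_linorder by blast
  obtain N1 :: nat where N1: "3 * ln (2 * real (card C)) / \<eta> \<le> real N1" using real_arch_simple by blast
  define N where "N = Suc (max N0 N1)"
  have "real n * (ln (fdist C z) - \<eta>) \<le> (\<Sum>i<n. tlog e (z - r i))"
    if n: "N \<le> n" and r: "is_roots n r" and z: "z \<in> K" for n r z
  proof -
    have n': "N0 \<le> n" "real N1 \<le> real n" using n by (auto simp: N_def)
    have "z \<in> (\<Union>x\<in>F. ball x (\<rho> / 2))" using F(2) z by (rule subsetD)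
    then obtain x where x: "x \<in> F" "dist x z < \<rho> / 2" by auto
    have wz: "cmod (w x - z) \<le> \<rho>"
      using norm_triangle_ineq[of "w x - x" "x - z"] w(1)[of x] x(2) by (simp add: dist_norm)
    have "real n * ln (fdist C (w x)) - ln (2 * real (card C)) - real n * (\<rho> / e) \<le> (\<Sum>i<n. tlog e (z - r i))"
      by (rule sum_tlog_roots_ge_pointwise[OF r assms(2) wz N0[OF n'(1) x(1)]])
    moreover have "real n * (\<rho> / e) \<le> real n * (\<eta> / 3)" using \<rho> by (intro mult_left_mono) auto
    moreover have "ln (2 * real (card C)) \<le> real n * (\<eta> / 3)"
    proof -
      have "3 * ln (2 * real (card C)) / \<eta> \<le> real n" using N1 n'(2) by linarith
      then show ?thesis using assms(3) by (simp add: field_simps)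
    qed
    moreover have "real n * (ln (fdist C z) - \<eta> / 3) \<le> real n * ln (fdist C (w x))"
    proof (rule mult_left_mono)
      have "cmod (w x - z) / \<kappa> \<le> \<rho> / \<kappa>" using wz \<kappa>_pos by (intro divide_right_mono) auto
      then show "ln (fdist C z) - \<eta> / 3 \<le> ln (fdist C (w x))"
        using ln_fdist_lipschitz[of "w x" z] \<rho>(3) by linarith
    qed simp
    ultimately show ?thesis unfolding right_diff_distrib times_divide_eq_right by linarith
  qed
  then show ?thesis by (intro exI[of _ N]) (auto simp: N_def)
qed

end

context energy_minimiser
begin

text \<open>Up to small errors, \<open>ln (fdist C z)\<close> is an average of truncated logarithmic kernels with poles at
  the zeros of \<open>\<Sum>c\<in>C. (z - c) ^ n\<close>, so the Bernstein-Walsh inequality can be applied at each zero.\<close>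

lemma integral_ln_fdist_le:
  assumes \<nu>: "\<And>j. j < (m :: nat) \<Longrightarrow> ball_measure R1 (\<nu> j)" and mass: "(\<Sum>j<m. measure (\<nu> j) UNIV) = 1"
    and le_M: "\<And>z. z \<in> E \<Longrightarrow> (\<Sum>j<m. log_potential (\<nu> j) z) \<le> ereal M"
    and C: "finite C" "a \<in> C" "b \<in> C" "a \<noteq> b"
  shows "(\<Sum>j<m. \<integral>z. ln (fdist C z) \<partial>\<nu> j) \<le> M + V + (\<integral>z. ln (fdist C z) \<partial>\<mu>)"
proof -
  interpret two_points C a b using C by unfold_locales
  let ?u = "\<lambda>z. ln (fdist C z)"
  note u_int = integrable_ln_fdist
  have main: "(\<Sum>j<m. \<integral>z. ?u z \<partial>\<nu> j) \<le> M + V + (\<integral>z. ?u z \<partial>\<mu>) + 3 * \<eta>" if \<eta>: "0 < \<eta>" for \<eta>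
  proof -
    obtain e0 where e0: "0 < e0"
      "\<And>e a. 0 < e \<Longrightarrow> e \<le> e0 \<Longrightarrow> (\<Sum>j<m. tpot e (\<nu> j) a) \<le> M + V + \<eta> + tpot e \<mu> a"
      using Bernstein_Walsh(1)[where \<nu> = \<nu> and m = m and ?R1.0 = R1 and M = M, OF _ mass _ \<eta>] \<nu> le_M by blast
    \<comment> \<open>The second bound makes replacing \<open>ln (fdist C z + e)\<close> by
      \<open>ln (fdist C z)\<close> cost at most \<eta>.\<close>
    define e where "e = min e0 (\<eta> * \<kappa>)"
    have e: "0 < e" "e \<le> e0" "e / \<kappa> \<le> \<eta>" using e0 \<eta> \<kappa>_pos
      by (auto simp: e_def pos_divide_le_eq)
    obtain N where N: "0 < N" "\<And>n r z. N \<le> n \<Longrightarrow> is_roots n r \<Longrightarrow> cmod z \<le> R1 \<Longrightarrow>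
        real n * (?u z - \<eta>) \<le> (\<Sum>i<n. tlog e (z - r i))"
      using sum_tlog_roots_ge[OF compact_cball e(1) \<eta>, of 0 R1] by auto
    obtain r where r: "is_roots N r" using is_roots_exists by blast
    define v where "v z = (\<Sum>i<N. tlog e (z - r i)) / real N" for z
    have tl_int: "integrable \<sigma> (\<lambda>z. tlog e (z - x))" if "ball_measure R' \<sigma>" for R' \<sigma> x
      using integrable_tlog[OF that e(1), of x] by (simp add: tlog_commute)
    have v_int: "integrable \<sigma> v" "(\<integral>z. v z \<partial>\<sigma>) = (\<Sum>i<N. tpot e \<sigma> (r i)) / real N"
      if "ball_measure R' \<sigma>" for R' \<sigma>
      unfolding v_def tpot_def using tl_int[OF that] by (auto simp: tlog_commute[of e "r _"])
    have v_ge: "?u z \<le> v z + \<eta>" if "cmod z \<le> R1" for z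
      using N(2)[OF order_refl r that] N(1) by (simp add: v_def field_simps)
    have v_le: "v z \<le> ?u z + \<eta>" for z
    proof -
      have "v z \<le> ln (fdist C z + e)"
        using sum_tlog_roots_le[OF r e(1), of z] N(1) by (simp add: v_def field_simps)
      also have "\<dots> \<le> ?u z + e / \<kappa>"
        using ln_diff_le_divide[of \<kappa> "fdist C z + e" "fdist C z"] \<kappa>_pos fdist_ge_\<kappa>[of z] e(1) by auto
      finally show ?thesis using e(3) by simp
    qed
    have "(\<Sum>j<m. \<integral>z. ?u z \<partial>\<nu> j) \<le> (\<Sum>j<m. (\<integral>z. v z \<partial>\<nu> j) + \<eta> * measure (\<nu> j) UNIV)"
    proof (rule sum_mono)
      fix j assume "j \<in> {..<m}"
      then have j: "ball_measure R1 (\<nu> j)" using \<nu> by simp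
      interpret n: finite_measure "\<nu> j" using ball_measureD[OF j] by blast
      have "(\<integral>z. ?u z \<partial>\<nu> j) \<le> (\<integral>z. v z + \<eta> \<partial>\<nu> j)"
      proof (rule integral_mono_AE)
        show "AE z in \<nu> j. ?u z \<le> v z + \<eta>"
          using ball_measureD(3)[OF j] by eventually_elim (rule v_ge)
      qed (use u_int[OF j] v_int[OF j] in auto)
      then show "(\<integral>z. ?u z \<partial>\<nu> j) \<le> (\<integral>z. v z \<partial>\<nu> j) + \<eta> * measure (\<nu> j) UNIV"
        using v_int(1)[OF j] ball_measureD(4)[OF j] by (simp add: mult.commute)
    qed
    also have "\<dots> = (\<Sum>j<m. \<integral>z. v z \<partial>\<nu> j) + \<eta>"
      unfolding sum.distrib sum_distrib_left[symmetric] mass by simp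
    also have "(\<Sum>j<m. \<integral>z. v z \<partial>\<nu> j) = (\<Sum>j<m. (\<Sum>i<N. tpot e (\<nu> j) (r i)) / real N)"
      using v_int(2)[OF \<nu>] by (intro sum.cong) auto
    \<comment> \<open>The exchange of integrals in discrete form: the mean of \<open>v\<close> over
      the family becomes the average of the family's potential over the zeros.\<close>
    also have "\<dots> = (\<Sum>i<N. \<Sum>j<m. tpot e (\<nu> j) (r i)) / real N"
      unfolding sum_divide_distrib[symmetric] by (subst sum.swap) simp
    also have "\<dots> \<le> (\<Sum>i<N. M + V + \<eta> + tpot e \<mu> (r i)) / real N"
      using e0(2)[OF e(1,2)] by (intro divide_right_mono sum_mono) auto
    also have "\<dots> = M + V + \<eta> + (\<integral>z. v z \<partial>\<mu>)"
      using N(1) unfolding v_int(2)[OF bm] by (simp add: sum.distrib add_divide_distrib)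
    also have "(\<integral>z. v z \<partial>\<mu>) \<le> (\<integral>z. ?u z + \<eta> \<partial>\<mu>)"
      using v_le v_int(1)[OF bm] u_int[OF bm] by (intro integral_mono) auto
    also have "\<dots> = (\<integral>z. ?u z \<partial>\<mu>) + \<eta>" using u_int[OF bm] prob_space by simp
    finally show ?thesis by simp
  qed
  show ?thesis
  proof (rule field_le_epsilon)
    fix x :: real assume "0 < x"
    then show "(\<Sum>j<m. \<integral>z. ?u z \<partial>\<nu> j) \<le> M + V + (\<integral>z. ?u z \<partial>\<mu>) + x" using main[of "x / 3"] by simp
  qed
qed

end

section \<open>Extremal configurations of frontier points\<close>

lemma compact_sequences_common_subseq:
  fixes c :: "nat \<Rightarrow> nat \<Rightarrow> complex"
  assumes "compact F" "\<And>n k. k < m \<Longrightarrow> c n k \<in> F"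
  shows "\<exists>l r. strict_mono (r :: nat \<Rightarrow> nat) \<and> (\<forall>k<m. l k \<in> F \<and> (\<lambda>n. c (r n) k) \<longlonglongrightarrow> l k)"
  using assms(2)
proof (induction m)
  case 0
  then show ?case by (intro exI[of _ "\<lambda>_. 0"] exI[of _ id]) (auto simp: strict_mono_def)
next
  case (Suc m)
  have "\<exists>l r. strict_mono (r :: nat \<Rightarrow> nat) \<and> (\<forall>k<m. l k \<in> F \<and> (\<lambda>n. c (r n) k) \<longlonglongrightarrow> l k)"
    by (rule Suc.IH) (simp add: Suc.prems)
  then obtain l r where r: "strict_mono (r :: nat \<Rightarrow> nat)"
    and l: "\<And>k. k < m \<Longrightarrow> l k \<in> F" "\<And>k. k < m \<Longrightarrow> (\<lambda>n. c (r n) k) \<longlonglongrightarrow> l k" by blast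
  have "seq_compact F" using assms(1) by (rule compact_imp_seq_compact)
  moreover have "\<forall>n. c (r n) m \<in> F" using Suc.prems by simp
  ultimately obtain x s where x: "x \<in> F" and s: "strict_mono (s :: nat \<Rightarrow> nat)"
    and lim: "((\<lambda>n. c (r n) m) \<circ> s) \<longlonglongrightarrow> x"
    unfolding seq_compact_def by metis
  have "strict_mono (r \<circ> s)" using r s by (rule strict_mono_o)
  moreover have "(l(m := x)) k \<in> F \<and> (\<lambda>n. c ((r \<circ> s) n) k) \<longlonglongrightarrow> (l(m := x)) k" if "k < Suc m" for k
  proof (cases "k = m")
    case True then show ?thesis using x lim by (simp add: o_def)
  next
    case False
    then have "k < m" using that by simp
    then show ?thesis using l(1) LIMSEQ_subseq_LIMSEQ[OF l(2) s] False by (simp add: o_def)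
  qed
  ultimately show ?case by blast
qed

lemma farthest_in_frontier:
  assumes "t \<in> E" "\<And>s. s \<in> E \<Longrightarrow> cmod (z - s) \<le> cmod (z - t)"
  shows "t \<in> frontier E"
proof -
  have "E \<subseteq> cball z (cmod (z - t))" using assms(2) by (auto simp: dist_norm)
  then have "interior E \<subseteq> ball z (cmod (z - t))" using interior_mono interior_cball by metis
  then have "t \<notin> interior E" by (auto simp: dist_norm)
  then show ?thesis using assms(1) closure_subset by (auto simp: frontier_def)
qed

lemma farthest_attained:
  assumes "compact E" "E \<noteq> {}"
  shows "\<exists>t\<in>frontier E. farthest_dist E z = cmod (z - t)" "\<And>t. t \<in> E \<Longrightarrow> cmod (z - t) \<le> farthest_dist E z"
proof -
  have "continuous_on E (\<lambda>t. cmod (z - t))" by (intro continuous_intros)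
  then obtain t where t: "t \<in> E" "\<And>s. s \<in> E \<Longrightarrow> cmod (z - s) \<le> cmod (z - t)"
    using continuous_attains_sup[OF assms] by blast
  have eq: "farthest_dist E z = cmod (z - t)"
    unfolding farthest_dist_def using t by (intro cSup_eq_maximum) auto
  then show "\<And>s. s \<in> E \<Longrightarrow> cmod (z - s) \<le> farthest_dist E z" using t by simp
  have "t \<in> frontier E" by (rule farthest_in_frontier[OF t])
  with eq show "\<exists>t\<in>frontier E. farthest_dist E z = cmod (z - t)" by blast
qed

lemma farthest_dist_lipschitz:
  assumes "compact E" "E \<noteq> {}"
  shows "\<bar>farthest_dist E z - farthest_dist E w\<bar> \<le> cmod (z - w)"
proof -
  have "farthest_dist E z \<le> farthest_dist E w + cmod (z - w)" for z w
  proof -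
    obtain t where t: "t \<in> frontier E" "farthest_dist E z = cmod (z - t)"
      using farthest_attained(1)[OF assms] by blast
    have "cmod (w - t) \<le> farthest_dist E w"
      using t(1) frontier_subset_compact[OF assms(1)] by (intro farthest_attained(2)[OF assms]) auto
    then show ?thesis using t(2) norm_triangle_ineq[of "z - w" "w - t"] by simp
  qed
  from this[of z w] this[of w z] show ?thesis by (simp add: norm_minus_commute)
qed

lemma continuous_on_farthest_dist:
  assumes "compact E" "E \<noteq> {}"
  shows "continuous_on A (farthest_dist E)"
proof -
  have "1-lipschitz_on A (farthest_dist E)"
    using farthest_dist_lipschitz[OF assms] by (intro lipschitz_onI) (auto simp: dist_norm)
  then show ?thesis by (rule lipschitz_on_continuous_on)
qed

context energy_minimiser
begin

text \<open>An atom would drive the truncated potentials at that point to -\<infinity>, below the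
  bound \<open>- V\<close>.\<close>

lemma singleton_null: "emeasure \<mu> {c} = 0"
proof -
  define B where "B = ln (cmod c + R + 1)"
  have le: "- V \<le> measure \<mu> {c} * ln (eps n) + B" for n
  proof -
    have ii: "integrable \<mu> (\<lambda>t. indicator {c} t * ln (eps n))"
      by (intro integrable_mult_left integrable_real_indicator) (auto simp: less_top[symmetric])
    have "- V \<le> tpot (eps n) \<mu> c" by (rule tpot_ge_neg_V[OF eps_pos])
    also have "\<dots> \<le> (\<integral>t. indicator {c} t * ln (eps n) + B \<partial>\<mu>)"
      unfolding tpot_def
    proof (rule integral_mono_AE[OF integrable_tlog[OF bm eps_pos]])
      show "AE t in \<mu>. tlog (eps n) (c - t) \<le> indicator {c} t * ln (eps n) + B"
        using ball_measureD(3)[OF bm]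
      proof eventually_elim
        case (elim t)
        have "0 \<le> B" unfolding B_def using R_ge_1 by (intro ln_ge_zero) (auto intro: add_increasing)
        moreover have "tlog (eps n) (c - t) \<le> B" unfolding B_def
          using norm_triangle_ineq4[of c t] elim eps_le_1[of n] R_ge_1 norm_ge_zero[of c]
          by (intro tlog_le eps_pos) linarith+
        moreover have "tlog (eps n) 0 = ln (eps n)" by (simp add: tlog_def max_def less_imp_le)
        ultimately show ?case by (auto simp: indicator_def)
      qed
    qed (use ii in simp)
    also have "\<dots> = measure \<mu> {c} * ln (eps n) + B" using ii prob_space by simp
    finally show ?thesis .
  qed
  have "measure \<mu> {c} = 0"
  proof (rule ccontr)
    assume "measure \<mu> {c} \<noteq> 0"
    then have p: "0 < measure \<mu> {c}" by (simp add: zero_less_measure_iff)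
    define x where "x = (V + B + 1) / measure \<mu> {c}"
    obtain n where "eps n < exp (- x)" using eps_less_ex[of "exp (- x)"] by auto
    then have "ln (eps n) < - x" using ln_less_cancel_iff[of "eps n" "exp (- x)"] by simp
    then have "measure \<mu> {c} * ln (eps n) < measure \<mu> {c} * (- x)" using p by (rule mult_strict_left_mono)
    also have "\<dots> = - (V + B + 1)" using p by (simp add: x_def)
    finally show False using le[of n] by linarith
  qed
  then show ?thesis by (simp add: emeasure_eq_measure)
qed

lemma two_points_E: "\<exists>a\<in>E. \<exists>b\<in>E. a \<noteq> b"
proof (rule ccontr)
  assume neg: "\<not> ?thesis"
  obtain c where "c \<in> E" using E_ne by blast
  with neg have "E \<subseteq> {c}" by blast
  then have "AE z in \<mu>. z \<in> {c}" using AE_E by (auto elim: AE_mp)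
  then have "measure \<mu> {c} = 1" by (subst prob_eq_1) auto
  then show False using singleton_null[of c] by (simp add: emeasure_eq_measure)
qed

text \<open>Here \<open>C\<close> may consist of one point, where \<open>ln (fdist C z)\<close> has
  a pole. The truncated integrand still dominates the truncated kernel at any \<open>c\<close> in
  \<open>C\<close>, whose mean is a value of the equilibrium potential.\<close>

lemma tfdist_bounds:
  assumes C: "finite C" "C \<noteq> {}" "C \<subseteq> E"
  shows "AE z in \<mu>. ln (max (fdist C z) (eps n)) \<le> ln D" "integrable \<mu> (\<lambda>z. ln (max (fdist C z) (eps n)))"
    "- V \<le> (\<integral>z. ln (max (fdist C z) (eps n)) \<partial>\<mu>)"
proof -
  obtain c where c: "c \<in> C" using C by blast
  have up: "ln (max (fdist C z) (eps n)) \<le> ln D" if z: "z \<in> E" for z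
  proof (rule ln_mono)
    have "fdist C z \<le> D"
    proof (rule fdist_leI[OF C(1,2)])
      fix c assume "c \<in> C"
      then have "cmod c \<le> R" "cmod z \<le> R" using C(3) z E_subset by auto
      then show "cmod (z - c) \<le> D" using norm_triangle_ineq4[of z c] by (simp add: D_def)
    qed
    then show "max (fdist C z) (eps n) \<le> D" using D_ge_1 order_trans[OF eps_le_1] by auto
  qed (simp add: less_max_iff_disj)
  then show AE: "AE z in \<mu>. ln (max (fdist C z) (eps n)) \<le> ln D" using AE_E by (auto elim: AE_mp)
  have lo: "tlog (eps n) (z - c) \<le> ln (max (fdist C z) (eps n))" for z
    unfolding tlog_def 
    by (rule ln_mono[OF max.mono[OF fdist_ge[OF C(1) c] order_refl] less_le_trans[OF eps_pos max.cobounded2]])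
  have cont: "continuous_on UNIV (\<lambda>z. ln (max (fdist C z) (eps n)))"
  proof (intro continuous_on_ln continuous_on_max continuous_on_fdist[OF C(1,2)] continuous_on_const)
    have "0 < max (fdist C z) (eps n)" for z by (auto simp: less_max_iff_disj)
    then show "\<forall>z\<in>UNIV. max (fdist C z) (eps n) \<noteq> 0" by (metis less_irrefl)
  qed
  have "AE z in \<mu>. norm (ln (max (fdist C z) (eps n))) \<le> \<bar>ln (eps n)\<bar> + ln D"
    using AE
  proof eventually_elim
    case (elim z)
    have "ln (eps n) \<le> ln (max (fdist C z) (eps n))" by (intro ln_mono) auto
    then show ?case using elim lnD_nonneg unfolding real_norm_def by linarith
  qed
  then show i: "integrable \<mu> (\<lambda>z. ln (max (fdist C z) (eps n)))"
    using borel_measurable_continuous_onI[OF cont] by (intro integrable_const_bound) auto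
  have "- V \<le> tpot (eps n) \<mu> c" by (rule tpot_ge_neg_V[OF eps_pos])
  also have "\<dots> \<le> (\<integral>z. ln (max (fdist C z) (eps n)) \<partial>\<mu>)"
    unfolding tpot_def tlog_commute[of _ c]
  proof (rule integral_mono[OF _ i lo])
    show "integrable \<mu> (\<lambda>t. tlog (eps n) (t - c))"
      using integrable_tlog[OF bm eps_pos, of n c] by (simp add: tlog_commute[of _ c])
  qed
  finally show "- V \<le> (\<integral>z. ln (max (fdist C z) (eps n)) \<partial>\<mu>)" .
qed

lemma AE_fdist_pos:
  assumes "finite C" "C \<noteq> {}"
  shows "AE z in \<mu>. 0 < fdist C z"
proof -
  obtain c where c: "c \<in> C" using assms by blast
  have "{c} \<in> null_sets \<mu>" using singleton_null by (auto simp: null_sets_def)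
  then have "AE z in \<mu>. z \<notin> {c}" by (rule AE_not_in)
  then show ?thesis
  proof eventually_elim
    case (elim z)
    then have "0 < cmod (z - c)" by simp
    then show ?case using fdist_ge[OF assms(1) c, of z] by linarith
  qed
qed

text \<open>The truncated integrals decrease but stay above \<open>- V\<close>; monotone convergence
  for \<open>ln D\<close> minus the integrand then gives integrability, pole or no pole.\<close>

lemma ln_fdist_integral:
  assumes C: "finite C" "C \<noteq> {}" "C \<subseteq> E"
  shows "integrable \<mu> (\<lambda>z. ln (fdist C z))"
    "(\<lambda>n. \<integral>z. ln (max (fdist C z) (eps n)) \<partial>\<mu>) \<longlonglongrightarrow> (\<integral>z. ln (fdist C z) \<partial>\<mu>)"
    "- V \<le> (\<integral>z. ln (fdist C z) \<partial>\<mu>)"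
proof -
  define f where "f n z = ln D - ln (max (fdist C z) (eps n))" for n z
  note b = tfdist_bounds[OF C]
  have fi: "integrable \<mu> (f n)" for n unfolding f_def using b(2) by simp
  have feq: "(\<integral>z. f n z \<partial>\<mu>) = ln D - (\<integral>z. ln (max (fdist C z) (eps n)) \<partial>\<mu>)" for n
    unfolding f_def using b(2) prob_space by simp
  have mono: "f n z \<le> f n' z" if "n \<le> n'" for n n' z
    unfolding f_def using eps_antimono[OF that] by (intro diff_left_mono ln_mono) (auto simp: less_max_iff_disj)
  have "incseq (\<lambda>n. \<integral>z. f n z \<partial>\<mu>)"
    unfolding incseq_def using mono fi by (auto intro!: integral_mono)
  moreover have "(\<integral>z. f n z \<partial>\<mu>) \<le> ln D + V" for n using feq[of n] b(3)[of n] by simp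
  ultimately obtain x where x: "(\<lambda>n. \<integral>z. f n z \<partial>\<mu>) \<longlonglongrightarrow> x"
    using incseq_convergent[of "\<lambda>n. \<integral>z. f n z \<partial>\<mu>" "ln D + V"] by blast
  have [measurable]: "fdist C \<in> borel_measurable borel"
    by (intro borel_measurable_continuous_onI continuous_on_fdist[OF C(1,2)])
  have lim: "AE z in \<mu>. (\<lambda>n. f n z) \<longlonglongrightarrow> ln D - ln (fdist C z)"
    using AE_fdist_pos[OF C(1,2)]
  proof eventually_elim
    case (elim z)
    obtain N where N: "eps N < fdist C z" using eps_less_ex[OF elim] by blast
    have "f n z = ln D - ln (fdist C z)" if "N \<le> n" for n
      using N eps_antimono[OF that] by (simp add: f_def max_def)
    then have "\<forall>\<^sub>F n in sequentially. f n z = ln D - ln (fdist C z)"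
      by (auto simp: eventually_at_top_linorder)
    then show ?case by (rule tendsto_eventually)
  qed
  have A: "integrable \<mu> (\<lambda>z. ln D - ln (fdist C z))" and I: "(\<integral>z. ln D - ln (fdist C z) \<partial>\<mu>) = x"
  proof -
    have 1: "AE z in \<mu>. mono (\<lambda>n. f n z)" using mono by (auto simp: mono_def)
    have 2: "AE z in \<mu>. 0 \<le> f n z" for n using b(1)[of n] by (auto simp: f_def)
    have 3: "(\<lambda>z. ln D - ln (fdist C z)) \<in> borel_measurable \<mu>" by measurable
    show "integrable \<mu> (\<lambda>z. ln D - ln (fdist C z))"
      by (rule integral_monotone_convergence_nonneg(1)[OF fi 1 2 lim x 3])
    show "(\<integral>z. ln D - ln (fdist C z) \<partial>\<mu>) = x"
      by (rule integral_monotone_convergence_nonneg(2)[OF fi 1 2 lim x 3])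
  qed
  have "integrable \<mu> (\<lambda>z. ln D - (ln D - ln (fdist C z)))"
    by (rule Bochner_Integration.integrable_diff[OF _ A]) simp
  then show i: "integrable \<mu> (\<lambda>z. ln (fdist C z))" by simp
  have xeq: "x = ln D - (\<integral>z. ln (fdist C z) \<partial>\<mu>)" using I i prob_space by simp
  have "(\<lambda>n. ln D - (\<integral>z. f n z \<partial>\<mu>)) \<longlonglongrightarrow> ln D - x" using x by (intro tendsto_intros)
  then show t: "(\<lambda>n. \<integral>z. ln (max (fdist C z) (eps n)) \<partial>\<mu>) \<longlonglongrightarrow> (\<integral>z. ln (fdist C z) \<partial>\<mu>)"
    unfolding feq xeq by simp
  show "- V \<le> (\<integral>z. ln (fdist C z) \<partial>\<mu>)"
    by (rule tendsto_lowerbound[OF t]) (auto simp: b(3))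
qed

lemma fdist_le_farthest:
  assumes "finite C" "C \<noteq> {}" "C \<subseteq> E"
  shows "fdist C z \<le> farthest_dist E z"
  using assms(3) by (intro fdist_leI[OF assms(1,2)] farthest_attained(2)[OF compact_E E_ne]) auto

lemma farthest_pos: "0 < farthest_dist E z"
proof -
  obtain a b where ab: "a \<in> E" "b \<in> E" "a \<noteq> b" using two_points_E by blast
  have "cmod (a - b) / 2 \<le> fdist {a, b} z" by (rule fdist_ge_half) auto
  also have "\<dots> \<le> farthest_dist E z" using ab by (intro fdist_le_farthest) auto
  finally show ?thesis using ab(3) by (smt (verit) half_gt_zero_iff right_minus_eq zero_less_norm_iff)
qed

lemma ln_farthest_integrable: "integrable \<mu> (\<lambda>z. ln (farthest_dist E z))"
proof -
  have cont: "continuous_on A (\<lambda>z. ln (farthest_dist E z))" for A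
    using farthest_pos by (intro continuous_on_ln continuous_on_farthest_dist compact_E E_ne) (auto simp: less_imp_neq[symmetric])
  show ?thesis by (rule integrable_continuous_ball_measure[OF bm cont])
qed

lemma AE_ln_fdist_le:
  assumes "finite C" "C \<noteq> {}" "C \<subseteq> E"
  shows "AE z in \<mu>. ln (fdist C z) \<le> ln (farthest_dist E z)"
  using AE_fdist_pos[OF assms(1,2)]
  by eventually_elim (intro ln_mono fdist_le_farthest[OF assms])

lemma integral_ln_fdist_le_farthest:
  assumes "finite C" "C \<noteq> {}" "C \<subseteq> E"
  shows "(\<integral>z. ln (fdist C z) \<partial>\<mu>) \<le> (\<integral>z. ln (farthest_dist E z) \<partial>\<mu>)"
  by (intro integral_mono_AE ln_fdist_integral(1)[OF assms] ln_farthest_integrable AE_ln_fdist_le[OF assms])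

text \<open>As \<open>ln (log_cap E)\<close> is \<open>- V\<close>, the constant
  \<open>C_const_m E m\<close> is \<open>Sup (Gset m) + V\<close>. Repetitions in \<open>c\<close>
  are allowed, so configurations of fewer points are included.\<close>

definition Gset :: "nat \<Rightarrow> real set" where
  "Gset m = {\<integral>z. ln (fdist (c ` {..<m}) z) \<partial>\<mu> | c. \<forall>k<m. c k \<in> frontier E}"

lemma frontier_image:
  assumes "\<forall>k<m. c k \<in> frontier E" "1 \<le> (m :: nat)"
  shows "finite (c ` {..<m})" "c ` {..<m} \<noteq> {}" "c ` {..<m} \<subseteq> E"
  using assms frontier_subset_compact[OF compact_E] by (auto simp: lessThan_empty_iff)

lemma Gset_ne: "Gset m \<noteq> {}"
proof -
  obtain x where "x \<in> frontier E" using frontier_nonempty[OF compact_E E_ne] by blast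
  then have "(\<integral>z. ln (fdist ((\<lambda>_. x) ` {..<m}) z) \<partial>\<mu>) \<in> Gset m" unfolding Gset_def
    by (intro CollectI exI[of _ "\<lambda>_. x"]) auto
  then show ?thesis by blast
qed

lemma Gset_le:
  assumes "1 \<le> m" "x \<in> Gset m"
  shows "x \<le> (\<integral>z. ln (farthest_dist E z) \<partial>\<mu>)"
  using assms frontier_image[OF _ assms(1)] by (auto simp: Gset_def intro!: integral_ln_fdist_le_farthest)

lemma Gset_bdd: "1 \<le> m \<Longrightarrow> bdd_above (Gset m)"
  using Gset_le by (intro bdd_aboveI) auto

lemma Gset_upper:
  assumes "1 \<le> m" "\<forall>k<m. c k \<in> frontier E"
  shows "(\<integral>z. ln (fdist (c ` {..<m}) z) \<partial>\<mu>) \<le> Sup (Gset m)"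
  using assms by (intro cSup_upper Gset_bdd) (auto simp: Gset_def)

lemma Gset_Sup_ge: "1 \<le> m \<Longrightarrow> - V \<le> Sup (Gset m)"
proof -
  assume m: "1 \<le> m"
  obtain x where x: "x \<in> frontier E" using frontier_nonempty[OF compact_E E_ne] by blast
  have "- V \<le> (\<integral>z. ln (fdist ((\<lambda>_. x) ` {..<m}) z) \<partial>\<mu>)"
    using x by (intro ln_fdist_integral(3) frontier_image m) auto
  also have "\<dots> \<le> Sup (Gset m)" using x by (intro Gset_upper m) auto
  finally show ?thesis .
qed

lemma fdist_image_le_add:
  assumes "1 \<le> (m :: nat)"
  shows "fdist (c ` {..<m}) z \<le> fdist (c' ` {..<m}) z + (\<Sum>k<m. cmod (c k - c' k))"
proof (rule fdist_leI)
  fix x assume "x \<in> c ` {..<m}"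
  then obtain k where k: "k < m" "x = c k" by auto
  have "cmod (z - c k) \<le> cmod (z - c' k) + cmod (c k - c' k)"
    using norm_triangle_ineq4[of "z - c' k" "c k - c' k"] by simp
  also have "cmod (z - c' k) \<le> fdist (c' ` {..<m}) z" using k by (intro fdist_ge) auto
  also have "cmod (c k - c' k) \<le> (\<Sum>k<m. cmod (c k - c' k))" using k by (intro member_le_sum) auto
  finally show "cmod (z - x) \<le> fdist (c' ` {..<m}) z + (\<Sum>k<m. cmod (c k - c' k))" using k by simp
qed (use assms in \<open>auto simp: lessThan_empty_iff\<close>)

text \<open>Upper semicontinuity in the configuration. At a fixed level the integrand is Lipschitz
  in the points, with constant \<open>1 / eps N\<close>, so the limit configuration is treated
  there; only afterwards does \<open>N\<close> grow, as the untruncated integrand may have a pole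
  when the limit points coincide.\<close>

lemma Gset_Sup_attained:
  assumes m: "1 \<le> m"
  shows "\<exists>c. (\<forall>k<m. c k \<in> frontier E) \<and> (\<integral>z. ln (fdist (c ` {..<m}) z) \<partial>\<mu>) = Sup (Gset m)"
proof -
  have "\<exists>c. (\<forall>k<m. c k \<in> frontier E) \<and> Sup (Gset m) - eps n < (\<integral>z. ln (fdist (c ` {..<m}) z) \<partial>\<mu>)" for n
  proof -
    obtain x where "x \<in> Gset m" "Sup (Gset m) - eps n < x"
      using less_cSupD[OF Gset_ne, of "Sup (Gset m) - eps n" m] by auto
    then show ?thesis by (auto simp: Gset_def)
  qed
  then obtain c where c: "\<And>n k. k < m \<Longrightarrow> c n k \<in> frontier E"
    "\<And>n. Sup (Gset m) - eps n < (\<integral>z. ln (fdist (c n ` {..<m}) z) \<partial>\<mu>)" by metis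
  obtain l r where r: "strict_mono (r :: nat \<Rightarrow> nat)" and l: "\<And>k. k < m \<Longrightarrow> l k \<in> frontier E"
    "\<And>k. k < m \<Longrightarrow> (\<lambda>n. c (r n) k) \<longlonglongrightarrow> l k"
    using compact_sequences_common_subseq[OF compact_frontier[OF compact_E], of m c] c(1) by blast
  note fl = frontier_image[of m l, OF _ m]
  have fl': "finite (l ` {..<m})" "l ` {..<m} \<noteq> {}" "l ` {..<m} \<subseteq> E" using fl l(1) by auto
  define \<delta> where "\<delta> n = (\<Sum>k<m. cmod (c (r n) k - l k))" for n
  have "\<delta> \<longlonglongrightarrow> (\<Sum>k<m. 0)" unfolding \<delta>_def
    using l(2) by (intro tendsto_sum tendsto_norm_zero) (auto simp: LIM_zero_iff)
  then have \<delta>: "\<delta> \<longlonglongrightarrow> 0" by simp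
  have "Sup (Gset m) \<le> (\<integral>z. ln (max (fdist (l ` {..<m}) z) (eps N)) \<partial>\<mu>)" for N
  proof -
    have le: "Sup (Gset m) - eps n \<le> (\<integral>z. ln (max (fdist (l ` {..<m}) z) (eps N)) \<partial>\<mu>) + \<delta> n / eps N" for n
    proof -
      have fc: "finite (c (r n) ` {..<m})" "c (r n) ` {..<m} \<noteq> {}" "c (r n) ` {..<m} \<subseteq> E"
        using frontier_image[of m "c (r n)", OF _ m] c(1) by auto
      have "Sup (Gset m) - eps n \<le> Sup (Gset m) - eps (r n)"
        using eps_antimono[OF seq_suble[OF r, of n]] by simp
      also have "\<dots> \<le> (\<integral>z. ln (fdist (c (r n) ` {..<m}) z) \<partial>\<mu>)" using c(2)[of "r n"] by simp
      also have "\<dots> \<le> (\<integral>z. ln (max (fdist (l ` {..<m}) z) (eps N)) + \<delta> n / eps N \<partial>\<mu>)"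
      proof (rule integral_mono_AE[OF ln_fdist_integral(1)[OF fc]])
        show "AE z in \<mu>. ln (fdist (c (r n) ` {..<m}) z) \<le> ln (max (fdist (l ` {..<m}) z) (eps N)) + \<delta> n / eps N"
          using AE_fdist_pos[OF fc(1,2)]
        proof eventually_elim
          case (elim z)
          let ?x = "max (fdist (c (r n) ` {..<m}) z) (eps N)" and ?y = "max (fdist (l ` {..<m}) z) (eps N)"
          have "fdist (c (r n) ` {..<m}) z \<le> fdist (l ` {..<m}) z + \<delta> n"
            unfolding \<delta>_def by (rule fdist_image_le_add[OF m])
          moreover have d0: "0 \<le> \<delta> n" unfolding \<delta>_def by (intro sum_nonneg) auto
          ultimately have xy: "?x \<le> ?y + \<delta> n" by auto
          have "ln (fdist (c (r n) ` {..<m}) z) \<le> ln ?x" using elim by (intro ln_mono) auto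
          also have "\<dots> \<le> ln (?y + \<delta> n)" using xy by (intro ln_mono) (auto simp: less_max_iff_disj)
          also have "\<dots> \<le> ln ?y + \<delta> n / eps N"
            using ln_diff_le_divide[of "eps N" "?y + \<delta> n" ?y] d0 by (auto simp: add_increasing2)
          finally show ?case .
        qed
      qed (use tfdist_bounds(2)[OF fl'] in simp)
      also have "\<dots> = (\<integral>z. ln (max (fdist (l ` {..<m}) z) (eps N)) \<partial>\<mu>) + \<delta> n / eps N"
        using tfdist_bounds(2)[OF fl'] prob_space by simp
      finally show ?thesis .
    qed
    have e0: "eps \<longlonglongrightarrow> 0"
      unfolding eps_def[abs_def] using LIMSEQ_inverse_real_of_nat by (simp add: inverse_eq_divide add.commute)
    have 1: "(\<lambda>n. Sup (Gset m) - eps n) \<longlonglongrightarrow> Sup (Gset m) - 0"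
      by (intro tendsto_intros e0)
    have 2: "(\<lambda>n. (\<integral>z. ln (max (fdist (l ` {..<m}) z) (eps N)) \<partial>\<mu>) + \<delta> n / eps N)
        \<longlonglongrightarrow> (\<integral>z. ln (max (fdist (l ` {..<m}) z) (eps N)) \<partial>\<mu>) + 0 / eps N"
      using \<delta> by (intro tendsto_intros) (auto simp: less_imp_neq[OF eps_pos, symmetric])
    show ?thesis using LIMSEQ_le[OF 1 2] le by auto
  qed
  then have "Sup (Gset m) \<le> (\<integral>z. ln (fdist (l ` {..<m}) z) \<partial>\<mu>)"
    by (intro tendsto_lowerbound[OF ln_fdist_integral(2)[OF fl']]) auto
  moreover have "(\<integral>z. ln (fdist (l ` {..<m}) z) \<partial>\<mu>) \<le> Sup (Gset m)"
    using l(1) by (intro Gset_upper[OF m]) auto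
  ultimately show ?thesis using l(1) by (intro exI[of _ l]) auto
qed

text \<open>Equal integrals force the nonnegative difference to vanish almost everywhere. Strict
  inequality holds on an open set, which cannot be null if it contains a support point.\<close>

lemma equality_imp_dominates:
  assumes C: "finite C" "C \<noteq> {}" "C \<subseteq> E"
    and eq: "(\<integral>z. ln (fdist C z) \<partial>\<mu>) = (\<integral>z. ln (farthest_dist E z) \<partial>\<mu>)"
    and z0: "z0 \<in> msupport \<mu>"
  shows "fdist C z0 = farthest_dist E z0"
proof (rule ccontr)
  assume "fdist C z0 \<noteq> farthest_dist E z0"
  then have lt: "fdist C z0 < farthest_dist E z0" using fdist_le_farthest[OF C, of z0] by simp
  define U where "U = {z. fdist C z < farthest_dist E z}"
  have oU: "open U" unfolding U_def
    by (intro open_Collect_less continuous_on_fdist[OF C(1,2)] continuous_on_farthest_dist compact_E E_ne)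
  then obtain d where d: "0 < d" "ball z0 d \<subseteq> U" using lt open_contains_ball[of U] by (auto simp: U_def)
  have "integrable \<mu> (\<lambda>z. ln (farthest_dist E z) - ln (fdist C z))"
    using ln_farthest_integrable ln_fdist_integral(1)[OF C] by simp
  moreover have "(\<integral>z. ln (farthest_dist E z) - ln (fdist C z) \<partial>\<mu>) = 0"
    using eq ln_farthest_integrable ln_fdist_integral(1)[OF C] by simp
  moreover have "AE z in \<mu>. 0 \<le> ln (farthest_dist E z) - ln (fdist C z)"
    using AE_ln_fdist_le[OF C] by eventually_elim simp
  ultimately have "AE z in \<mu>. ln (farthest_dist E z) - ln (fdist C z) = 0"
    using integral_nonneg_eq_0_iff_AE by blast
  then have AE: "AE z in \<mu>. z \<notin> U"
    using AE_fdist_pos[OF C(1,2)]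
  proof eventually_elim
    case (elim z)
    then have "fdist C z = farthest_dist E z" using farthest_pos[of z] by (simp add: ln_inj_iff)
    then show ?case by (simp add: U_def)
  qed
  have "emeasure \<mu> U = 0"
    using AE oU by (subst AE_iff_measurable[symmetric, where P = "\<lambda>z. z \<notin> U"]) auto
  moreover have "emeasure \<mu> (ball z0 d) \<le> emeasure \<mu> U" using d(2) oU by (intro emeasure_mono) auto
  ultimately show False using z0 d(1) by (auto simp: msupport_def)
qed

lemma dominates_imp_equality:
  assumes C: "finite C" "C \<noteq> {}" "C \<subseteq> E"
    and "\<And>z. z \<in> msupport \<mu> \<Longrightarrow> fdist C z = farthest_dist E z"
  shows "(\<integral>z. ln (fdist C z) \<partial>\<mu>) = (\<integral>z. ln (farthest_dist E z) \<partial>\<mu>)"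
proof (rule integral_cong_AE)
  show "(\<lambda>z. ln (fdist C z)) \<in> borel_measurable \<mu>" "(\<lambda>z. ln (farthest_dist E z)) \<in> borel_measurable \<mu>"
    using ln_fdist_integral(1)[OF C] ln_farthest_integrable by auto
  show "AE z in \<mu>. ln (fdist C z) = ln (farthest_dist E z)"
    using AE_msupport[OF sets_mu] by eventually_elim (simp add: assms(4))
qed

end

section \<open>The inequality\<close>

lemma admissible_family_ball_measure:
  assumes "admissible_family m \<nu>"
  shows "\<exists>R. \<forall>j<m. ball_measure R (\<nu> j)"
proof -
  have "\<exists>R. ball_measure R (\<nu> j)" if "j < m" for j
  proof -
    from assms that have s: "sets (\<nu> j) = sets borel" and f: "finite_measure (\<nu> j)"
      and ex: "\<exists>K. compact K \<and> emeasure (\<nu> j) (UNIV - K) = 0" by (auto simp: admissible_family_def)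
    from ex obtain K where K: "compact K" "emeasure (\<nu> j) (UNIV - K) = 0" by blast
    obtain R where R: "K \<subseteq> cball 0 R" using compact_subset_cball[OF K(1)] by blast
    have "UNIV - K \<in> null_sets (\<nu> j)" using K s compact_imp_closed[OF K(1)] by (auto simp: null_sets_def)
    then have "AE t in \<nu> j. t \<notin> UNIV - K" by (rule AE_not_in)
    then have "AE t in \<nu> j. cmod t \<le> R" by eventually_elim (use R in auto)
    then show ?thesis using s f unfolding ball_measure_def by blast
  qed
  then obtain R where R: "\<And>j. j < m \<Longrightarrow> ball_measure (R j) (\<nu> j)" by metis
  have "ball_measure (Max (insert 0 (R ` {..<m}))) (\<nu> j)" if "j < m" for j
    using that by (intro ball_measure_mono[OF R[OF that]] Max_ge) auto
  then show ?thesis by blast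
qed

context energy_minimiser
begin

lemma inequality_real:
  assumes \<nu>: "\<And>j. j < m \<Longrightarrow> ball_measure R1 (\<nu> j)" and mass: "(\<Sum>j<m. measure (\<nu> j) UNIV) = 1"
    and le_M: "\<And>z. z \<in> E \<Longrightarrow> (\<Sum>j<m. log_potential (\<nu> j) z) \<le> ereal M" and m: "1 \<le> (m :: nat)"
  shows "(\<Sum>j<m. (SUP z\<in>E. log_potential (\<nu> j) z)) \<le> ereal (M + V + Sup (Gset m))"
proof -
  have "\<exists>c\<in>frontier E. \<forall>k. \<forall>z\<in>E. log_potential (\<nu> j) z \<le> ereal (tpot (eps k) (\<nu> j) c)" if "j < m" for j
    by (rule log_potential_max_frontier[OF compact_E E_ne \<nu>[OF that]])
  then obtain c where c: "\<And>j. j < m \<Longrightarrow> c j \<in> frontier E"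
    and cmax: "\<And>j k z. j < m \<Longrightarrow> z \<in> E \<Longrightarrow> log_potential (\<nu> j) z \<le> ereal (tpot (eps k) (\<nu> j) (c j))"
    by metis
  have le_k: "(\<Sum>j<m. (SUP z\<in>E. log_potential (\<nu> j) z)) \<le> ereal (\<Sum>j<m. tpot (eps k) (\<nu> j) (c j))" for k
  proof -
    have "(\<Sum>j<m. (SUP z\<in>E. log_potential (\<nu> j) z)) \<le> (\<Sum>j<m. ereal (tpot (eps k) (\<nu> j) (c j)))"
      using cmax by (intro sum_mono SUP_least) auto
    then show ?thesis by simp
  qed
  define C where "C = c ` {..<m}"
  have C: "finite C" "C \<noteq> {}" "C \<subseteq> E" unfolding C_def using frontier_image[of m c] c m by auto
  have G: "(\<integral>z. ln (fdist C z) \<partial>\<mu>) \<le> Sup (Gset m)" unfolding C_def using c by (intro Gset_upper[OF m]) auto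
  show ?thesis
  proof (cases "\<exists>a\<in>C. \<exists>b\<in>C. a \<noteq> b")
    case True
    then obtain a b where ab: "a \<in> C" "b \<in> C" "a \<noteq> b" by blast
    interpret two_points C a b using C ab by unfold_locales
    \<comment> \<open>A level below the minimum of \<open>fdist C\<close>, so that even the
      truncated kernel at \<open>c j\<close> stays below \<open>ln (fdist C t)\<close>.\<close>
    obtain k where k: "eps k < \<kappa>" using eps_less_ex[OF \<kappa>_pos] by blast
    have "tpot (eps k) (\<nu> j) (c j) \<le> (\<integral>z. ln (fdist C z) \<partial>\<nu> j)" if j: "j < m" for j
      unfolding tpot_def
    proof (rule integral_mono[OF integrable_tlog[OF \<nu>[OF j] eps_pos]])
      show "tlog (eps k) (c j - t) \<le> ln (fdist C t)" for t
        unfolding tlog_commute[of _ "c j"] using fdist_ge[OF C(1), of "c j" t] j k fdist_ge_\<kappa>[of t]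
        by (intro tlog_le eps_pos) (auto simp: C_def)
      show "integrable (\<nu> j) (\<lambda>z. ln (fdist C z))" by (rule integrable_ln_fdist[OF \<nu>[OF j]])
    qed
    then have "(\<Sum>j<m. tpot (eps k) (\<nu> j) (c j)) \<le> (\<Sum>j<m. \<integral>z. ln (fdist C z) \<partial>\<nu> j)"
      by (intro sum_mono) auto
    also have "\<dots> \<le> M + V + (\<integral>z. ln (fdist C z) \<partial>\<mu>)"
      by (rule integral_ln_fdist_le[where ?R1.0 = R1, OF \<nu> mass le_M C(1) ab])
    finally have "(\<Sum>j<m. tpot (eps k) (\<nu> j) (c j)) \<le> M + V + Sup (Gset m)" using G by linarith
    then show ?thesis using le_k[of k] by (simp add: order_trans)
  next
    case False
    have "c j \<in> C" if "j < m" for j using that by (simp add: C_def)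
    moreover have "c 0 \<in> C" using m by (simp add: C_def)
    ultimately have c0: "c j = c 0" if "j < m" for j using False that by blast
    have "(\<Sum>j<m. tpot (eps k) (\<nu> j) (c j)) = (\<Sum>j<m. tpot (eps k) (\<nu> j) (c 0))" for k
      by (rule sum.cong[OF refl]) (metis c0 lessThan_iff)
    then have "(\<Sum>j<m. (SUP z\<in>E. log_potential (\<nu> j) z)) \<le> ereal (\<Sum>j<m. tpot (eps k) (\<nu> j) (c 0))" for k
      using le_k[of k] by simp
    moreover have "(\<lambda>k. ereal (\<Sum>j<m. tpot (eps k) (\<nu> j) (c 0))) \<longlonglongrightarrow> (\<Sum>j<m. log_potential (\<nu> j) (c 0))"
      by (rule sum_log_potential_tendsto[of m R1 \<nu> "c 0", THEN conjunct1]) (rule \<nu>)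
    ultimately have "(\<Sum>j<m. (SUP z\<in>E. log_potential (\<nu> j) z)) \<le> (\<Sum>j<m. log_potential (\<nu> j) (c 0))"
      by (intro tendsto_lowerbound[where F = sequentially]) auto
    also have "\<dots> \<le> ereal M" using C(3) m by (intro le_M) (auto simp: C_def)
    also have "\<dots> \<le> ereal (M + V + Sup (Gset m))" using Gset_Sup_ge[OF m] by simp
    finally show ?thesis .
  qed
qed

lemma inequality:
  assumes adm: "admissible_family m \<nu>" and m: "1 \<le> m"
  shows "(\<Sum>j<m. (SUP z\<in>E. log_potential (\<nu> j) z))
     \<le> ereal (Sup (Gset m) + V) + (SUP z\<in>E. \<Sum>j<m. log_potential (\<nu> j) z)" (is "?L \<le> _ + ?S")
proof -
  obtain R1 where R1: "\<And>j. j < m \<Longrightarrow> ball_measure R1 (\<nu> j)"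
    using admissible_family_ball_measure[OF adm] by blast
  have mass: "(\<Sum>j<m. measure (\<nu> j) UNIV) = 1" using adm by (simp add: admissible_family_def)
  have up: "(\<Sum>j<m. log_potential (\<nu> j) z) \<le> ?S" if "z \<in> E" for z using that by (rule SUP_upper)
  show ?thesis
  proof (cases ?S)
    case (real s)
    have "?L \<le> ereal (s + V + Sup (Gset m))"
      using up real by (intro inequality_real[where ?R1.0 = R1, OF R1 mass _ m]) auto
    then show ?thesis using real by (simp add: add_ac)
  next
    case PInf then show ?thesis by simp
  next
    case MInf
    have "(\<Sum>j<m. log_potential (\<nu> j) z) \<le> ereal (- V - 2)" if "z \<in> E" for z using up[OF that] MInf by simp
    then have "0 \<le> (- V - 2) + V + 1"
      by (intro Bernstein_Walsh(2)[where ?R1.0 = R1 and \<nu> = \<nu> and m = m, OF R1 mass]) auto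
    then show ?thesis by simp
  qed
qed

end

section \<open>Sharpness\<close>

lemma return_prob_measures_on:
  assumes "z \<in> K" "closed K"
  shows "return borel z \<in> prob_measures_on K"
  using assms borel_closed[OF assms(2)] by (auto simp: prob_measures_on_def emeasure_return)

text \<open>Comparing a near-minimiser of the truncated energy with its mixtures with point masses gives
  a pointwise bound for its potential.\<close>

lemma capacity_zero_small_potential:
  assumes "compact K" "K \<noteq> {}"
    and inf: "\<And>\<sigma> A. \<sigma> \<in> prob_measures_on K \<Longrightarrow> \<exists>n. A < tenergy (eps n) \<sigma> \<sigma>"
  shows "\<exists>\<sigma>\<in>prob_measures_on K. \<exists>n. \<forall>z\<in>K. tpot (eps n) \<sigma> z \<le> - L"
proof -
  have cl: "closed K" using assms(1) compact_imp_closed by blast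
  obtain R where R: "1 \<le> R" "K \<subseteq> cball 0 R" using compact_subset_cball[OF assms(1)] by blast
  note bm = prob_measures_on_ball_measure[OF _ cl R(2)]
  have "\<exists>n. \<forall>\<sigma>\<in>prob_measures_on K. L + 1 \<le> tenergy (eps n) \<sigma> \<sigma>"
  proof (rule ccontr)
    assume "\<not> ?thesis"
    then obtain \<sigma> where \<sigma>: "\<And>n. \<sigma> n \<in> prob_measures_on K" "\<And>n. tenergy (eps n) (\<sigma> n) (\<sigma> n) < L + 1"
      by (metis not_le)
    obtain \<mu>' where "\<mu>' \<in> prob_measures_on K" "\<And>n. tenergy (eps n) \<mu>' \<mu>' \<le> L + 1"
      using energy_lower_semicontinuous[OF assms(1) \<sigma>(1) less_imp_le[OF \<sigma>(2)] tendsto_const] by blast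
    then show False using inf[of \<mu>' "L + 1"] by (meson not_le)
  qed
  then obtain n where n: "\<And>\<sigma>. \<sigma> \<in> prob_measures_on K \<Longrightarrow> L + 1 \<le> tenergy (eps n) \<sigma> \<sigma>" by blast
  define S where "S = (\<lambda>\<sigma>. tenergy (eps n) \<sigma> \<sigma>) ` prob_measures_on K"
  have S_ne: "S \<noteq> {}" unfolding S_def using return_prob_measures_on[OF _ cl] assms(2) by blast
  have S_bdd: "bdd_below S" unfolding S_def using n by (intro bdd_belowI[of _ "L + 1"]) auto
  define d where "d = ln (2 * R)"
  have d: "0 \<le> d" using R by (simp add: d_def)
  define B where "B = \<bar>Inf S\<bar> + 1 + 2 * d + \<bar>ln (eps n)\<bar>"
  define s where "s = 1 / (B + 1)"
  have B: "0 \<le> B" using d unfolding B_def by linarith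
  have s: "0 < s" "s \<le> 1" "s * B < 1" using B by (auto simp: s_def)
  obtain \<sigma> where \<sigma>: "\<sigma> \<in> prob_measures_on K" "tenergy (eps n) \<sigma> \<sigma> < Inf S + s"
    using cInf_lessD[OF S_ne, of "Inf S + s"] s by (auto simp: S_def)
  define I where "I = tenergy (eps n) \<sigma> \<sigma>"
  have "tpot (eps n) \<sigma> z \<le> - L" if z: "z \<in> K" for z
  proof (rule ccontr)
    assume neg: "\<not> tpot (eps n) \<sigma> z \<le> - L"
    define U where "U = - tpot (eps n) \<sigma> z"
    let ?r = "return borel z"
    have r: "?r \<in> prob_measures_on K" by (rule return_prob_measures_on[OF z cl])
    have U: "tenergy (eps n) \<sigma> ?r = U"
      unfolding tenergy_def U_def using measurable_tpot[OF bm[OF \<sigma>(1)] eps_pos] by (simp add: integral_return)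
    have "tpot (eps n) ?r = (\<lambda>w. tlog (eps n) (w - z))"
      unfolding tpot_def by (intro ext integral_return) auto
    moreover have "(\<integral>w. tlog (eps n) (w - z) \<partial>?r) = tlog (eps n) (z - z)"
      by (rule integral_return) auto
    ultimately have W: "tenergy (eps n) ?r ?r = - ln (eps n)"
      unfolding tenergy_def by (simp add: tlog_def max_def less_imp_le)
    obtain \<kappa> where \<kappa>: "\<kappa> \<in> prob_measures_on K" "\<forall>e>0. tenergy e \<kappa> \<kappa>
       = (1 - s)\<^sup>2 * tenergy e \<sigma> \<sigma> + 2 * s * (1 - s) * tenergy e \<sigma> ?r + s\<^sup>2 * tenergy e ?r ?r"
      using tenergy_mixture[OF assms(1) \<sigma>(1) r, of s] s by auto
    have "Inf S \<le> tenergy (eps n) \<kappa> \<kappa>" using \<kappa>(1) S_bdd by (intro cInf_lower) (auto simp: S_def)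
    moreover have "tenergy (eps n) \<kappa> \<kappa> = (1 - s)\<^sup>2 * I + 2 * s * (1 - s) * U + s\<^sup>2 * (- ln (eps n))"
      using \<kappa>(2)[rule_format, OF eps_pos[of n]] unfolding U W I_def .
    moreover have "I < Inf S + s" using \<sigma>(2) by (simp add: I_def)
    ultimately have "I - s < (1 - s)\<^sup>2 * I + 2 * s * (1 - s) * U + s\<^sup>2 * (- ln (eps n))" by linarith
    then have "s * (2 * (I - U)) < s * (1 + s * (I - 2 * U - ln (eps n)))"
      by (simp add: power2_eq_square algebra_simps)
    then have "2 * (I - U) < 1 + s * (I - 2 * U - ln (eps n))" using s(1) by (simp only: mult_less_cancel_left_pos)
    also have "s * (I - 2 * U - ln (eps n)) \<le> s * B"
    proof (rule mult_left_mono)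
      have "tpot (eps n) \<sigma> z \<le> d * measure \<sigma> UNIV"
      proof (rule tpot_le[OF bm[OF \<sigma>(1)] eps_pos])
        fix t assume "cmod t \<le> R"
        then show "tlog (eps n) (z - t) \<le> d" unfolding d_def
          using norm_triangle_ineq4[of z t] subsetD[OF R(2) z] R(1) eps_le_1[of n] unfolding mem_cball_0
          by (intro tlog_le eps_pos) linarith+
      qed
      then have "- d \<le> U" using prob_measures_onD(4)[OF \<sigma>(1)] by (simp add: U_def)
      then show "I - 2 * U - ln (eps n) \<le> B" using \<sigma>(2) s unfolding B_def I_def by linarith
    qed (use s in simp)
    finally have "2 * (I - U) < 2" using s(3) by linarith
    moreover have "1 < I - U" using n[OF \<sigma>(1)] neg by (simp add: I_def U_def)
    ultimately show False by simp
  qed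
  then show ?thesis using \<sigma>(1) by blast
qed

context energy_minimiser
begin

lemma perturbed_equilibrium:
  assumes \<eta>: "0 < \<eta>" and \<delta>: "0 < \<delta>" "\<delta> < 1"
  shows "\<exists>\<kappa>\<in>prob_measures_on E. \<exists>\<tau>\<in>prob_measures_on E.
     (\<forall>f :: complex \<Rightarrow> real. f \<in> borel_measurable borel \<longrightarrow> bounded (f ` E) \<longrightarrow>
        (\<integral>z. f z \<partial>\<kappa>) = (1 - \<delta>) * (\<integral>z. f z \<partial>\<mu>) + \<delta> * (\<integral>z. f z \<partial>\<tau>)) \<and>
     (\<forall>z\<in>E. \<exists>n. tpot (eps n) \<kappa> z \<le> - V + \<eta> + \<delta> * (\<bar>V\<bar> + ln D))"
proof -
  define K where "K = E \<inter> {z. \<forall>n. - V + \<eta> \<le> tpot (eps n) \<mu> z}"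
  have "closed {z. \<forall>n. - V + \<eta> \<le> tpot (eps n) \<mu> z}"
    by (intro closed_Collect_all closed_Collect_le continuous_intros continuous_on_tpot[OF bm]) auto
  then have K: "compact K" unfolding K_def using compact_E by (intro compact_Int_closed)
  have KE: "K \<subseteq> E" by (auto simp: K_def)
  define L where "L = (ln D + \<bar>V\<bar>) / \<delta>"
  have "\<exists>\<tau>\<in>prob_measures_on E. \<exists>k. \<forall>z\<in>K. tpot (eps k) \<tau> z \<le> - L"
  proof (cases "K = {}")
    case True then show ?thesis using mu_on by blast
  next
    case False
    have on_E: "\<sigma> \<in> prob_measures_on E" if "\<sigma> \<in> prob_measures_on K" for \<sigma>
    proof (rule prob_measures_onI[OF _ _ _ closed_E])
      show "AE t in \<sigma>. t \<in> E"
        using prob_measures_on_AE[OF that compact_imp_closed[OF K]] by eventually_elim (use KE in blast)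
    qed (use prob_measures_onD[OF that] in auto)
    have "\<exists>n. A < tenergy (eps n) \<sigma> \<sigma>" if \<sigma>: "\<sigma> \<in> prob_measures_on K" for \<sigma> A
    proof (rule ccontr)
      assume "\<not> ?thesis"
      then have fin: "\<And>n. tenergy (eps n) \<sigma> \<sigma> \<le> A" by (auto simp: not_less)
      interpret s: prob_space \<sigma> by (rule prob_measures_onD[OF \<sigma>])
      have "tenergy (eps n) \<mu> \<sigma> \<le> V - \<eta>" for n
      proof -
        have "(\<integral>z. - V + \<eta> \<partial>\<sigma>) \<le> (\<integral>z. tpot (eps n) \<mu> z \<partial>\<sigma>)"
        proof (rule integral_mono_AE)
          show "integrable \<sigma> (tpot (eps n) \<mu>)" by (rule integrable_tpot[OF bm eps_pos bm_on[OF on_E[OF \<sigma>]]])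
          show "AE z in \<sigma>. - V + \<eta> \<le> tpot (eps n) \<mu> z"
            using prob_measures_on_AE[OF \<sigma> compact_imp_closed[OF K]] by eventually_elim (auto simp: K_def)
        qed simp
        then show ?thesis using s.prob_space by (simp add: tenergy_def)
      qed
      then have "V \<le> V - \<eta>" by (rule variation[OF on_E[OF \<sigma>] fin])
      then show False using \<eta> by simp
    qed
    from capacity_zero_small_potential[OF K False this, of L] show ?thesis using on_E by blast
  qed
  then obtain \<tau> k where \<tau>: "\<tau> \<in> prob_measures_on E" and k: "\<And>z. z \<in> K \<Longrightarrow> tpot (eps k) \<tau> z \<le> - L" by blast
  obtain \<kappa> where \<kappa>: "\<kappa> \<in> prob_measures_on E"
    and I: "\<And>f :: complex \<Rightarrow> real. f \<in> borel_measurable borel \<Longrightarrow> bounded (f ` E) \<Longrightarrow>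
        (\<integral>z. f z \<partial>\<kappa>) = (1 - \<delta>) * (\<integral>z. f z \<partial>\<mu>) + \<delta> * (\<integral>z. f z \<partial>\<tau>)"
    using prob_measures_on_mixture[OF mu_on \<tau> closed_E, of \<delta>] \<delta> by auto
  have p: "tpot (eps n) \<kappa> z = (1 - \<delta>) * tpot (eps n) \<mu> z + \<delta> * tpot (eps n) \<tau> z" for n z
    unfolding tpot_def using bounded_image_tlog[OF compact_E eps_pos] by (intro I) auto
  have "\<exists>n. tpot (eps n) \<kappa> z \<le> - V + \<eta> + \<delta> * (\<bar>V\<bar> + ln D)" if z: "z \<in> E" for z
  proof -
    have zR: "cmod z \<le> R" using z E_subset by auto
    note ub = tpot_le_lnD[OF _ zR eps_pos eps_le_1]
    have pos: "0 \<le> \<delta> * (\<bar>V\<bar> + ln D)" using \<delta> lnD_nonneg by simp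
    show ?thesis
    proof (cases "z \<in> K")
      case True
      have "(1 - \<delta>) * tpot (eps k) \<mu> z \<le> (1 - \<delta>) * ln D" using \<delta> ub[OF mu_on] by (intro mult_left_mono) auto
      also have "\<dots> \<le> ln D" using \<delta> lnD_nonneg by (simp add: mult_left_le_one_le)
      finally have "(1 - \<delta>) * tpot (eps k) \<mu> z \<le> ln D" .
      moreover have "\<delta> * tpot (eps k) \<tau> z \<le> \<delta> * (- L)" using \<delta> k[OF True] by (intro mult_left_mono) auto
      moreover have "\<delta> * L = ln D + \<bar>V\<bar>" using \<delta> by (simp add: L_def)
      ultimately have "tpot (eps k) \<kappa> z \<le> - \<bar>V\<bar>" unfolding p by simp
      then have "tpot (eps k) \<kappa> z \<le> - V + \<eta> + \<delta> * (\<bar>V\<bar> + ln D)" using \<eta> pos by linarith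
      then show ?thesis by blast
    next
      case False
      then obtain n where n: "tpot (eps n) \<mu> z < - V + \<eta>" using z by (auto simp: K_def not_le)
      have "(1 - \<delta>) * tpot (eps n) \<mu> z \<le> (1 - \<delta>) * (- V + \<eta>)" using \<delta> n by (intro mult_left_mono) auto
      moreover have "\<delta> * tpot (eps n) \<tau> z \<le> \<delta> * ln D" using \<delta> ub[OF \<tau>] by (intro mult_left_mono) auto
      moreover have "\<delta> * V \<le> \<delta> * \<bar>V\<bar>" "0 \<le> \<delta> * \<eta>" using \<delta> \<eta> by (auto intro!: mult_left_mono)
      ultimately have "tpot (eps n) \<kappa> z \<le> - V + \<eta> + \<delta> * (\<bar>V\<bar> + ln D)"
        unfolding p by (simp add: algebra_simps)
      then show ?thesis by blast
    qed
  qed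
  then show ?thesis using \<kappa> \<tau> I by blast
qed

text \<open>The measure is cut into the cells in which a given one of the points \<open>c k\<close> is farthest.\<close>

lemma farthest_cells:
  assumes \<kappa>: "\<kappa> \<in> prob_measures_on E" and m: "1 \<le> (m :: nat)" and c: "\<And>k. k < m \<Longrightarrow> c k \<in> frontier E"
    and ab: "a \<in> c ` {..<m}" "b \<in> c ` {..<m}" "a \<noteq> b"
  shows "\<exists>\<nu>. admissible_family m \<nu> \<and>
     ereal (\<integral>z. ln (fdist (c ` {..<m}) z) \<partial>\<kappa>) \<le> (\<Sum>k<m. (SUP z\<in>E. log_potential (\<nu> k) z)) \<and>
     (\<forall>z n. (\<Sum>k<m. log_potential (\<nu> k) z) \<le> ereal (tpot (eps n) \<kappa> z))"
proof -
  define C where "C = c ` {..<m}"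
  have C: "finite C" "C \<noteq> {}" "C \<subseteq> E" unfolding C_def using frontier_image[of m c] c m by auto
  interpret two_points C a b using C ab by unfold_locales (auto simp: C_def)
  interpret k: prob_space \<kappa> by (rule prob_measures_onD[OF \<kappa>])
  have bm\<kappa>: "ball_measure R \<kappa>" by (rule bm_on[OF \<kappa>])
  have sp: "space \<kappa> = UNIV" and sk: "sets \<kappa> = sets borel" using prob_measures_onD[OF \<kappa>] by auto
  have [measurable]: "fdist C \<in> borel_measurable borel"
    by (intro borel_measurable_continuous_onI continuous_on_fdist[OF C(1,2)])
  define A where "A k = {z. cmod (z - c k) = fdist C z \<and> (\<forall>i\<in>{..<k}. cmod (z - c i) \<noteq> fdist C z)}" for k
  have A[measurable]: "A k \<in> sets borel" for k unfolding A_def by measurable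
  have disj: "disjoint_family_on A {..<m}"
    unfolding disjoint_family_on_def
  proof (intro ballI impI)
    fix i j :: nat assume "i \<noteq> j"
    then consider "i < j" | "j < i" by linarith
    then show "A i \<inter> A j = {}" by cases (auto simp: A_def)
  qed
  have cover: "(\<Union>k<m. A k) = UNIV"
  proof -
    have "\<exists>k<m. z \<in> A k" for z
    proof -
      obtain x where "x \<in> C" "fdist C z = cmod (z - x)" using fdist_attained[OF C(1,2)] by blast
      then obtain k0 where k0: "k0 < m" "cmod (z - c k0) = fdist C z" by (auto simp: C_def)
      define k where "k = (LEAST k. cmod (z - c k) = fdist C z)"
      have "cmod (z - c k) = fdist C z" unfolding k_def by (rule LeastI) (rule k0(2))
      moreover have "k \<le> k0" unfolding k_def by (rule Least_le) (rule k0(2))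
      moreover have "cmod (z - c i) \<noteq> fdist C z" if "i < k" for i
        using that not_less_Least unfolding k_def by blast
      ultimately show ?thesis using k0(1) by (intro exI[of _ k]) (auto simp: A_def)
    qed
    then show ?thesis by auto
  qed
  define \<nu> where "\<nu> k = density \<kappa> (\<lambda>t. ennreal (indicator (A k) t))" for k
  have bm\<nu>: "ball_measure R (\<nu> k)" and m\<nu>: "measure (\<nu> k) UNIV = measure \<kappa> (A k)"
    and I\<nu>: "\<And>f :: complex \<Rightarrow> real. f \<in> borel_measurable borel \<Longrightarrow> (\<integral>t. f t \<partial>\<nu> k) = (\<integral>t. indicator (A k) t * f t \<partial>\<kappa>)" for k
    unfolding \<nu>_def using restrict_ball_measure[OF bm\<kappa> A[of k]] by auto
  have sumI: "(\<Sum>k<m. \<integral>t. indicator (A k) t * f t \<partial>\<kappa>) = (\<integral>t. f t \<partial>\<kappa>)"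
    if i: "integrable \<kappa> f" for f :: "complex \<Rightarrow> real"
  proof -
    have ik: "integrable \<kappa> (\<lambda>t. indicator (A k) t * f t)" for k
      using integrable_mult_indicator[OF _ i, of "A k"] sk by simp
    have "(\<Sum>k<m. \<integral>t. indicator (A k) t * f t \<partial>\<kappa>) = (\<integral>t. (\<Sum>k<m. indicator (A k) t * f t) \<partial>\<kappa>)"
      using ik by (intro Bochner_Integration.integral_sum[symmetric]) auto
    also have "\<dots> = (\<integral>t. f t \<partial>\<kappa>)"
    proof (intro Bochner_Integration.integral_cong refl)
      fix t
      have "(\<Sum>k<m. indicator (A k) t) = (indicator (\<Union>k<m. A k) t :: real)"
        using disj by (intro indicator_UN_disjoint[symmetric]) auto
      then show "(\<Sum>k<m. indicator (A k) t * f t) = f t" unfolding cover by (simp flip: sum_distrib_right)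
    qed
    finally show ?thesis .
  qed
  have "(\<Sum>k<m. measure (\<nu> k) UNIV) = 1"
  proof -
    have "(\<Sum>k<m. measure \<kappa> (A k)) = measure \<kappa> (\<Union>k<m. A k)"
      by (rule k.finite_measure_finite_Union[symmetric, OF finite_lessThan _ disj])
         (simp add: sk image_subset_iff A)
    also have "\<dots> = 1" unfolding cover using k.prob_space unfolding sp .
    finally show ?thesis unfolding m\<nu> .
  qed
  moreover have "emeasure (\<nu> k) (UNIV - cball 0 R) = 0" for k
  proof (subst AE_iff_measurable[symmetric, where P = "\<lambda>t. cmod t \<le> R"])
    show "AE t in \<nu> k. cmod t \<le> R" by (rule ball_measureD(3)[OF bm\<nu>])
    show "UNIV - cball 0 R \<in> sets (\<nu> k)" unfolding ball_measureD(1)[OF bm\<nu>] by simp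
    show "{t \<in> space (\<nu> k). \<not> cmod t \<le> R} = UNIV - cball 0 R" unfolding ball_measureD(4)[OF bm\<nu>] by auto
  qed
  ultimately have "admissible_family m \<nu>"
    unfolding admissible_family_def
    by (auto simp: ball_measureD(1,2)[OF bm\<nu>] intro!: exI[of _ "cball 0 R"])
  moreover have "ereal (\<integral>z. ln (fdist C z) \<partial>\<kappa>) \<le> (\<Sum>k<m. (SUP z\<in>E. log_potential (\<nu> k) z))"
  proof -
    have iu: "integrable \<kappa> (\<lambda>z. ln (fdist C z))" by (rule integrable_ln_fdist[OF bm\<kappa>])
    have "ereal (\<integral>z. ln (fdist C z) \<partial>\<kappa>) = (\<Sum>k<m. ereal (\<integral>t. indicator (A k) t * ln (fdist C t) \<partial>\<kappa>))"
      using sumI[OF iu] by simp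
    also have "\<dots> \<le> (\<Sum>k<m. (SUP z\<in>E. log_potential (\<nu> k) z))"
    proof (rule sum_mono)
      fix k assume "k \<in> {..<m}"
      then have ck: "c k \<in> E" using c frontier_subset_compact[OF compact_E] by auto
      have "(\<integral>t. indicator (A k) t * ln (fdist C t) \<partial>\<kappa>) \<le> tpot (eps n) (\<nu> k) (c k)" for n
      proof -
        have "(\<integral>t. indicator (A k) t * ln (fdist C t) \<partial>\<kappa>) \<le> (\<integral>t. indicator (A k) t * tlog (eps n) (c k - t) \<partial>\<kappa>)"
        proof (rule integral_mono)
          show "integrable \<kappa> (\<lambda>t. indicator (A k) t * ln (fdist C t))"
            using integrable_mult_indicator[OF _ iu, of "A k"] sk by simp
          show "integrable \<kappa> (\<lambda>t. indicator (A k) t * tlog (eps n) (c k - t))"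
            using integrable_mult_indicator[OF _ integrable_tlog[OF bm\<kappa> eps_pos], of "A k"] sk by simp
          fix t
          have "ln (fdist C t) \<le> tlog (eps n) (c k - t)" if "t \<in> A k"
          proof -
            have "fdist C t = cmod (c k - t)" using that by (simp add: A_def norm_minus_commute)
            then show ?thesis using ln_le_tlog[OF eps_pos, of "c k - t" n] fdist_pos[of t] by simp
          qed
          then show "indicator (A k) t * ln (fdist C t) \<le> indicator (A k) t * tlog (eps n) (c k - t)"
            by (auto simp: indicator_def)
        qed
        then show ?thesis unfolding tpot_def by (subst I\<nu>) auto
      qed
      then have "ereal (\<integral>t. indicator (A k) t * ln (fdist C t) \<partial>\<kappa>) \<le> log_potential (\<nu> k) (c k)"
        using log_potential_ge_iff[OF bm\<nu>] by blast
      also have "\<dots> \<le> (SUP z\<in>E. log_potential (\<nu> k) z)" using ck by (rule SUP_upper)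
      finally show "ereal (\<integral>t. indicator (A k) t * ln (fdist C t) \<partial>\<kappa>) \<le> (SUP z\<in>E. log_potential (\<nu> k) z)" .
    qed
    finally show ?thesis .
  qed
  moreover have "(\<Sum>k<m. log_potential (\<nu> k) z) \<le> ereal (tpot (eps n) \<kappa> z)" for z n
  proof -
    have "(\<Sum>k<m. log_potential (\<nu> k) z) \<le> (\<Sum>k<m. ereal (tpot (eps n) (\<nu> k) z))"
      by (intro sum_mono log_potential_le[OF bm\<nu>])
    also have "\<dots> = ereal (\<Sum>k<m. \<integral>t. indicator (A k) t * tlog (eps n) (z - t) \<partial>\<kappa>)"
      unfolding tpot_def by (subst I\<nu>) auto
    also have "\<dots> = ereal (tpot (eps n) \<kappa> z)"
      unfolding tpot_def using sumI[OF integrable_tlog[OF bm\<kappa> eps_pos]] by simp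
    finally show ?thesis .
  qed
  ultimately show ?thesis unfolding C_def by blast
qed

lemma two_points_frontier: "\<exists>a\<in>frontier E. \<exists>b\<in>frontier E. a \<noteq> b"
proof -
  obtain a where a: "a \<in> frontier E" using frontier_nonempty[OF compact_E E_ne] by blast
  obtain b where b: "b \<in> frontier E" "farthest_dist E a = cmod (a - b)"
    using farthest_attained(1)[OF compact_E E_ne] by blast
  have "a \<noteq> b" using b(2) farthest_pos[of a] by auto
  then show ?thesis using a b by blast
qed

lemma sharpness:
  assumes m: "2 \<le> m" and c0: "c0 < Sup (Gset m) + V"
  shows "\<exists>\<nu>. admissible_family m \<nu> \<and> \<not> ((\<Sum>j<m. (SUP z\<in>E. log_potential (\<nu> j) z))
     \<le> ereal c0 + (SUP z\<in>E. \<Sum>j<m. log_potential (\<nu> j) z))"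
proof -
  have m1: "1 \<le> m" using m by simp
  obtain c1 where c1: "\<forall>k<m. c1 k \<in> frontier E" "(\<integral>z. ln (fdist (c1 ` {..<m}) z) \<partial>\<mu>) = Sup (Gset m)"
    using Gset_Sup_attained[OF m1] by blast
  have "\<exists>c a b. (\<forall>k<m. c k \<in> frontier E) \<and> a \<in> c ` {..<m} \<and> b \<in> c ` {..<m} \<and> a \<noteq> b \<and>
      Sup (Gset m) \<le> (\<integral>z. ln (fdist (c ` {..<m}) z) \<partial>\<mu>)"
  proof (cases "\<exists>a\<in>c1 ` {..<m}. \<exists>b\<in>c1 ` {..<m}. a \<noteq> b")
    case True then show ?thesis using c1 by (intro exI[of _ c1]) auto
  next
    case False
    have "c1 k \<in> c1 ` {..<m}" if "k < m" for k using that by simp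
    moreover have "c1 0 \<in> c1 ` {..<m}" using m by simp
    ultimately have eq: "c1 k = c1 0" if "k < m" for k using False that by blast
    obtain b where b: "b \<in> frontier E" "b \<noteq> c1 0" using two_points_frontier by metis
    define c where "c = c1(1 := b)"
    have c: "\<forall>k<m. c k \<in> frontier E" using c1(1) b by (simp add: c_def)
    have ab: "c1 0 \<in> c ` {..<m}" "b \<in> c ` {..<m}"
      using m by (auto simp: c_def image_iff intro: bexI[of _ 0] bexI[of _ 1])
    have sub: "c1 ` {..<m} \<subseteq> c ` {..<m}" using eq ab(1) by (metis image_subsetI lessThan_iff)
    note f1 = frontier_image[OF c1(1) m1] and f = frontier_image[OF c m1]
    have "(\<integral>z. ln (fdist (c1 ` {..<m}) z) \<partial>\<mu>) \<le> (\<integral>z. ln (fdist (c ` {..<m}) z) \<partial>\<mu>)"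
    proof (rule integral_mono_AE[OF ln_fdist_integral(1)[OF f1] ln_fdist_integral(1)[OF f]])
      show "AE z in \<mu>. ln (fdist (c1 ` {..<m}) z) \<le> ln (fdist (c ` {..<m}) z)"
        using AE_fdist_pos[OF f1(1,2)]
      proof eventually_elim
        case (elim z)
        have "fdist (c1 ` {..<m}) z \<le> fdist (c ` {..<m}) z"
          using sub by (intro fdist_leI[OF f1(1,2)] fdist_ge[OF f(1)]) auto
        then show ?case using elim by (intro ln_mono)
      qed
    qed
    then show ?thesis using c ab b(2) c1(2) by (intro exI[of _ c] exI[of _ "c1 0"] exI[of _ b]) auto
  qed
  then obtain c a b where c: "\<And>k. k < m \<Longrightarrow> c k \<in> frontier E"
    and ab: "a \<in> c ` {..<m}" "b \<in> c ` {..<m}" "a \<noteq> b"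
    and G: "Sup (Gset m) \<le> (\<integral>z. ln (fdist (c ` {..<m}) z) \<partial>\<mu>)" by blast
  define u where "u z = ln (fdist (c ` {..<m}) z)" for z
  interpret two_points "c ` {..<m}" a b using ab by unfold_locales auto
  have cu: "continuous_on A u" for A unfolding u_def by (rule continuous_on_ln_fdist)
  have mu_u: "u \<in> borel_measurable borel" using cu by (rule borel_measurable_continuous_onI)
  have "compact (u ` E)" using cu compact_E by (intro compact_continuous_image)
  then have bu: "bounded (u ` E)" by (rule compact_imp_bounded)
  then obtain B where B: "\<And>z. z \<in> E \<Longrightarrow> \<bar>u z\<bar> \<le> B" unfolding bounded_iff real_norm_def by blast
  have B0: "0 \<le> B" using B E_ne by force
  have u_bd: "\<bar>\<integral>z. u z \<partial>\<sigma>\<bar> \<le> B" if "\<sigma> \<in> prob_measures_on E" for \<sigma>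
  proof -
    interpret s: prob_space \<sigma> by (rule prob_measures_onD[OF that])
    have AE: "AE z in \<sigma>. \<bar>u z\<bar> \<le> B"
      using prob_measures_on_AE[OF that closed_E] by eventually_elim (rule B)
    have i: "integrable \<sigma> u"
      using AE measurable_ball_measure[OF bm_on[OF that] mu_u] by (intro s.integrable_const_bound) auto
    have "\<bar>\<integral>z. u z \<partial>\<sigma>\<bar> \<le> (\<integral>z. \<bar>u z\<bar> \<partial>\<sigma>)" using integral_norm_bound[of \<sigma> u] by simp
    also have "\<dots> \<le> (\<integral>z. B \<partial>\<sigma>)" using i AE by (intro integral_mono_AE) auto
    finally show ?thesis using s.prob_space by simp
  qed
  define G1 where "G1 = (\<integral>z. u z \<partial>\<mu>)"
  define g where "g = G1 + V - c0"
  have g: "0 < g" using G c0 by (simp add: g_def G1_def u_def)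
  define h where "h = \<bar>V\<bar> + ln D + 2 * B + 1"
  have h: "0 < h" using lnD_nonneg B0 by (simp add: h_def)
  define \<delta> where "\<delta> = min (1/2) (g / (4 * h))"
  have \<delta>: "0 < \<delta>" "\<delta> < 1" "\<delta> * h \<le> g / 4" using g h by (auto simp: \<delta>_def min_def field_simps)
  have "\<delta> * (\<bar>V\<bar> + ln D) \<le> \<delta> * h" "\<delta> * (2 * B) \<le> \<delta> * h"
    using \<delta>(1) B0 lnD_nonneg by (auto intro!: mult_left_mono simp: h_def)
  then have d1: "\<delta> * (\<bar>V\<bar> + ln D) \<le> g / 4" and d2: "\<delta> * (2 * B) \<le> g / 4" using \<delta>(3) by linarith+
  obtain \<kappa> \<tau> where \<kappa>: "\<kappa> \<in> prob_measures_on E" and \<tau>: "\<tau> \<in> prob_measures_on E"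
    and I: "\<forall>f :: complex \<Rightarrow> real. f \<in> borel_measurable borel \<longrightarrow> bounded (f ` E) \<longrightarrow>
        (\<integral>z. f z \<partial>\<kappa>) = (1 - \<delta>) * (\<integral>z. f z \<partial>\<mu>) + \<delta> * (\<integral>z. f z \<partial>\<tau>)"
    and P: "\<forall>z\<in>E. \<exists>n. tpot (eps n) \<kappa> z \<le> - V + g / 4 + \<delta> * (\<bar>V\<bar> + ln D)"
    using perturbed_equilibrium[of "g / 4" \<delta>] g \<delta> by auto
  have "(\<integral>z. u z \<partial>\<kappa>) = (1 - \<delta>) * G1 + \<delta> * (\<integral>z. u z \<partial>\<tau>)"
    using I mu_u bu by (simp add: G1_def)
  moreover have "\<delta> * (G1 - (\<integral>z. u z \<partial>\<tau>)) \<le> \<delta> * (2 * B)"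
    using u_bd[OF \<tau>] u_bd[OF mu_on] \<delta>(1) by (intro mult_left_mono) (auto simp: G1_def)
  ultimately have U: "G1 - g / 4 \<le> (\<integral>z. u z \<partial>\<kappa>)" using d2 by (simp add: algebra_simps)
  obtain \<nu> where adm: "admissible_family m \<nu>"
    and lo: "ereal (\<integral>z. u z \<partial>\<kappa>) \<le> (\<Sum>k<m. (SUP z\<in>E. log_potential (\<nu> k) z))"
    and up: "\<And>z n. (\<Sum>k<m. log_potential (\<nu> k) z) \<le> ereal (tpot (eps n) \<kappa> z)"
    using farthest_cells[OF \<kappa> m1 c ab] unfolding u_def by blast
  have "(SUP z\<in>E. \<Sum>k<m. log_potential (\<nu> k) z) \<le> ereal (- V + g / 2)"
  proof (rule SUP_least)
    fix z assume "z \<in> E"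
    then obtain n where "tpot (eps n) \<kappa> z \<le> - V + g / 4 + \<delta> * (\<bar>V\<bar> + ln D)" using P by blast
    then have "tpot (eps n) \<kappa> z \<le> - V + g / 2" using d1 by linarith
    then show "(\<Sum>k<m. log_potential (\<nu> k) z) \<le> ereal (- V + g / 2)"
      using up[of z n] by (meson ereal_less_eq(3) order_trans)
  qed
  then have "ereal c0 + (SUP z\<in>E. \<Sum>k<m. log_potential (\<nu> k) z) \<le> ereal c0 + ereal (- V + g / 2)"
    by (rule add_left_mono)
  also have "\<dots> < ereal (\<integral>z. u z \<partial>\<kappa>)" using U g by (simp add: g_def field_simps)
  also note lo
  finally show ?thesis using adm by (intro exI[of _ \<nu>]) (simp add: not_le)
qed

end

lemma Sup_image_eq_fdist:
  assumes "finite S" "S \<noteq> {}"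
  shows "Sup ((\<lambda>t. cmod (z - t)) ` S) = fdist S z"
  unfolding fdist_def using assms by (intro cSup_eq_Max) auto

lemma dominant_card_le:
  assumes "dominant E S" "finite S"
  shows "dominant_card E \<le> enat (card S)"
proof -
  have "(LEAST n. \<exists>S. dominant E S \<and> finite S \<and> card S = n) \<le> card S"
    using assms by (intro Least_le) blast
  then show ?thesis using assms unfolding dominant_card_def by auto
qed

lemma dominant_card_leD:
  assumes "dominant_card E \<le> enat m"
  shows "\<exists>S. dominant E S \<and> finite S \<and> card S \<le> m"
proof -
  have ex: "\<exists>S. dominant E S \<and> finite S"
    using assms unfolding dominant_card_def by (auto split: if_splits)
  then have "\<exists>n S. dominant E S \<and> finite S \<and> card S = n" by blast
  from LeastI_ex[OF this] obtain S where
    S: "dominant E S" "finite S" "card S = (LEAST n. \<exists>S. dominant E S \<and> finite S \<and> card S = n)" by blast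
  have "dominant_card E = enat (card S)" using ex S(3) unfolding dominant_card_def by simp
  then show ?thesis using assms S(1,2) by auto
qed

theorem theorem2p4:
  fixes E :: "complex set"
  assumes "compact E" and "log_cap E > 0"
  shows
    "(\<forall>m \<ge> 1. \<forall>\<nu>. admissible_family m \<nu> \<longrightarrow>
        (\<Sum>j<m. (SUP z\<in>E. log_potential (\<nu> j) z))
          \<le> ereal (C_const_m E m) + (SUP z\<in>E. \<Sum>j<m. log_potential (\<nu> j) z))
   \<and> (\<forall>m \<ge> 2. \<forall>c < C_const_m E m. \<exists>\<nu>. admissible_family m \<nu> \<and>
        \<not> ((\<Sum>j<m. (SUP z\<in>E. log_potential (\<nu> j) z))
              \<le> ereal c + (SUP z\<in>E. \<Sum>j<m. log_potential (\<nu> j) z)))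
   \<and> (\<forall>m \<ge> 1. enat m < dominant_card E \<longrightarrow> C_const_m E m < C_const E)
   \<and> (\<forall>m \<ge> 1. dominant_card E \<le> enat m \<longrightarrow> C_const_m E m = C_const E)
   \<and> (dominant_card E = \<infinity> \<longrightarrow> (\<forall>m \<ge> 2. C_const_m E m < C_const E))"
proof -
  define \<mu> where "\<mu> = equilibrium_measure E"
  obtain V R where em: "energy_minimiser E \<mu> V R" and cap: "ln (log_cap E) = - V"
    using energy_minimiser_exists[OF assms] unfolding \<mu>_def by blast
  interpret energy_minimiser E \<mu> V R by fact
  let ?I = "\<integral>z. ln (farthest_dist E z) \<partial>\<mu>"
  have Cm: "C_const_m E m = Sup (Gset m) + V" for m
    unfolding C_const_m_def \<mu>_def[symmetric] Gset_def fdist_def image_image cap by simp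
  have CE: "C_const E = ?I + V"
    unfolding C_const_def \<mu>_def[symmetric] cap by simp
  have Sup_le: "Sup (Gset m) \<le> ?I" if "1 \<le> m" for m
    using Gset_ne Gset_le[OF that] by (rule cSup_least)
  have strict: "C_const_m E m < C_const E" if m: "1 \<le> m" and dc: "enat m < dominant_card E" for m
  proof (rule ccontr)
    assume "\<not> ?thesis"
    then have eq: "Sup (Gset m) = ?I" using Sup_le[OF m] by (simp add: Cm CE)
    obtain c where c: "\<forall>k<m. c k \<in> frontier E" "(\<integral>z. ln (fdist (c ` {..<m}) z) \<partial>\<mu>) = Sup (Gset m)"
      using Gset_Sup_attained[OF m] by blast
    note C = frontier_image[OF c(1) m]
    have "dominant E (c ` {..<m})"
      unfolding dominant_def \<mu>_def[symmetric]
      using C equality_imp_dominates[OF C] c(2) eq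
      by (simp add: Sup_image_eq_fdist[OF C(1,2)] finite_imp_closed)
    from dominant_card_le[OF this C(1)] have "dominant_card E \<le> enat (card (c ` {..<m}))" .
    also have "\<dots> \<le> enat m" using card_image_le[of "{..<m}" c] by simp
    finally show False using dc by simp
  qed
  have equal: "C_const_m E m = C_const E" if m: "1 \<le> m" and dc: "dominant_card E \<le> enat m" for m
  proof -
    obtain S where S: "dominant E S" "finite S" "card S \<le> m" using dominant_card_leD[OF dc] by blast
    have SE: "S \<subseteq> E" "S \<noteq> {}" using S(1) by (auto simp: dominant_def)
    have SF: "farthest_dist E z = fdist S z" if "z \<in> msupport \<mu>" for z
      using S(1) that Sup_image_eq_fdist[OF S(2) SE(2)] by (simp add: dominant_def \<mu>_def)
    define T where "T = S \<inter> frontier E"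
    have T: "finite T" "T \<subseteq> E" "card T \<le> m"
      using S SE card_mono[OF S(2), of T] by (auto simp: T_def)
    have far: "\<exists>s\<in>T. farthest_dist E z = cmod (z - s)" if z: "z \<in> msupport \<mu>" for z
    proof -
      obtain s where s: "s \<in> S" "fdist S z = cmod (z - s)" using fdist_attained[OF S(2) SE(2)] by blast
      have "s \<in> frontier E"
      proof (rule farthest_in_frontier)
        show "s \<in> E" using s SE by blast
        show "cmod (z - t) \<le> cmod (z - s)" if "t \<in> E" for t
          using farthest_attained(2)[OF compact_E E_ne that, of z] SF[OF z] s(2) by simp
      qed
      then show ?thesis using s SF[OF z] by (auto simp: T_def)
    qed
    obtain z0 where "z0 \<in> msupport \<mu>"
    proof -
      have "msupport \<mu> \<noteq> {}" using AE_msupport[OF sets_mu] by auto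
      then show ?thesis using that by blast
    qed
    then have T_ne: "T \<noteq> {}" using far by blast
    obtain h where h: "bij_betw h {0..<card T} T" using ex_bij_betw_nat_finite[OF T(1)] by blast
    have cT: "0 < card T" using T_ne T(1) by (simp add: card_gt_0_iff)
    define c where "c k = (if k < card T then h k else h 0)" for k
    have "c ` {..<m} = T"
    proof
      show "c ` {..<m} \<subseteq> T"
        using bij_betw_apply[OF h] cT by (auto simp: c_def)
      show "T \<subseteq> c ` {..<m}"
      proof
        fix t assume "t \<in> T"
        then have "t \<in> h ` {0..<card T}" using h by (simp add: bij_betw_def)
        then obtain k where "k < card T" "t = h k" by auto
        then show "t \<in> c ` {..<m}" using T(3) by (intro image_eqI[of _ _ k]) (auto simp: c_def)
      qed
    qed
    moreover have "\<forall>k<m. c k \<in> frontier E" using calculation by (auto simp: T_def)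
    ultimately have "(\<integral>z. ln (fdist T z) \<partial>\<mu>) \<le> Sup (Gset m)" using Gset_upper[OF m, of c] by simp
    moreover have "(\<integral>z. ln (fdist T z) \<partial>\<mu>) = ?I"
    proof (rule dominates_imp_equality[OF T(1) T_ne T(2)])
      fix z assume z: "z \<in> msupport \<mu>"
      obtain s where "s \<in> T" "farthest_dist E z = cmod (z - s)" using far[OF z] by blast
      then show "fdist T z = farthest_dist E z"
        using fdist_ge[OF T(1), of s z] fdist_le_farthest[OF T(1) T_ne T(2), of z] by simp
    qed
    ultimately show ?thesis using Sup_le[OF m] by (simp add: Cm CE)
  qed
  have main: "(\<Sum>j<m. (SUP z\<in>E. log_potential (\<nu> j) z))
        \<le> ereal (C_const_m E m) + (SUP z\<in>E. \<Sum>j<m. log_potential (\<nu> j) z)"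
    if "1 \<le> m" "admissible_family m \<nu>" for m \<nu>
    unfolding Cm using that by (intro inequality)
  have sharp: "\<exists>\<nu>. admissible_family m \<nu> \<and>
        \<not> ((\<Sum>j<m. (SUP z\<in>E. log_potential (\<nu> j) z))
              \<le> ereal c + (SUP z\<in>E. \<Sum>j<m. log_potential (\<nu> j) z))"
    if "2 \<le> m" "c < C_const_m E m" for m c
    using that unfolding Cm by (rule sharpness)
  show ?thesis using main sharp strict equal by (auto simp: numeral_2_eq_2)
qed

end
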